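(* Let $K\in\mathbb{T}^3$ and let $\lambda\mapsto T_\lambda$ be any strictly increasing function in $(0,+\infty)$ with $$\lim_{\lambda\to+\infty}\frac{\lambda}{T_\lambda}=+\infty .$$ There exist $\gamma_2=\gamma_2(K)>0$ and $\tilde\gamma_2=\tilde\gamma_2(K)>\gamma_2$ with the following properties. (i) For any $\gamma\in(0,\gamma_2)$ there exists $\lambda_4=\lambda_4(K,\gamma)>0$ such that for any $\lambda>\lambda_4$ the operator $H_{\gamma,\lambda}(K)$ has no eigenvalues in the gap $[\tau_{\gamma,\max}(K,\lambda),\tau_{\gamma,\max}(K,\lambda)+T_\lambda]$. (ii) For any $\gamma>\gamma_2$ there exists $\lambda_5=\lambda_5(K,\gamma)>0$ such that for any $\lambda>\lambda_5$ the operator $H_{\gamma,\lambda}(K)$ has an eigenvalue in the gap $[\tau_{\gamma,\max}(K,\lambda),\tau_{\gamma,\max}(K,\lambda)+T_\lambda]$. (iii) For any $\gamma>\tilde\gamma_2$ there exists $\lambda_6=\lambda_6(K,\gamma)>0$ such that for any $\lambda>\lambda_6$ the operator $H_{\gamma,\lambda}(K)$ has at least three eigenvalues (counted with multiplicity) in the gap $[\tau_{\gamma,\max}(K,\lambda),\tau_{\gamma,\max}(K,\lambda)+T_\lambda]$.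
   Context: $\mathbb{T}^3=(-\pi,\pi]^3$ is the three-dimensional torus (coordinates mod $2\pi$) and $\epsilon(p)=\sum_{i=1}^3(1-\cos p_i)$. For $\gamma>0$ and $K\in\mathbb{T}^3$ put $\mathcal{E}_{\gamma,K}(p,q)=\epsilon(p)+\epsilon(q)+\gamma\,\epsilon(K-p-q)$. Let $L^{2,a}((\mathbb{T}^3)^2)$ be the Hilbert space of $f\in L^2(\mathbb{T}^3\times\mathbb{T}^3)$ with $f(p,q)=-f(q,p)$. For $\lambda\ge0$, $H_{\gamma,\lambda}(K)$ is the bounded self-adjoint operator on $L^{2,a}((\mathbb{T}^3)^2)$ given by $$H_{\gamma,\lambda}(K)f(p,q)=\mathcal{E}_{\gamma,K}(p,q)f(p,q)-\frac{\lambda}{(2\pi)^3}\int_{\mathbb{T}^3}f(s,q)\,ds-\frac{\lambda}{(2\pi)^3}\int_{\mathbb{T}^3}f(p,s)\,ds .$$ For $q\in\mathbb{T}^3$ let $h_{\gamma,\lambda}(K,q)$ be the self-adjoint operator on $L^2(\mathbb{T}^3)$, $h_{\gamma,\lambda}(K,q)f(p)=\mathcal{E}_{\gamma,K}(p,q)f(p)-\frac{\lambda}{(2\pi)^3}\int_{\mathbb{T}^3}f(s)\,ds$, and let $z_{\gamma,\lambda}(K,q)=\inf\sigma(h_{\gamma,\lambda}(K,q))$. Set $\tau_{\gamma,\min}(K,\lambda)=\min_q z_{\gamma,\lambda}(K,q)$ and $\tau_{\gamma,\max}(K,\lambda)=\max_q z_{\gamma,\lambda}(K,q)$. The essential spectrum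 of $H_{\gamma,\lambda}(K)$ is $[\tau_{\gamma,\min}(K,\lambda),\tau_{\gamma,\max}(K,\lambda)]\cup[\min\mathcal{E}_{\gamma,K},\max\mathcal{E}_{\gamma,K}]$; for large $\lambda$ these two segments are disjoint, with a gap between them.
   Formalization: Parts (ii) and (iii) additionally assume that T_λ tends to +∞; for bounded strictly increasing T (e.g. T_λ = arctan λ) they fail, because for large γ the eigenvalues lie farther than sup T above τ_max. *)

theory Defs
  imports "HOL-Analysis.Analysis" "HOL-Library.Extended_Nat"
begin

section \<open>Operators on subspaces of complex \<open>L\<^sup>2\<close>\<close>

text \<open>
  Elements of \<open>L\<^sup>2(M)\<close> are handled through representatives: equality of vectors is equality almost
  everywhere, and an operator is a map on representatives. A closed subspace \<open>S\<close> of \<open>L\<^sup>2(M)\<close> is a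
  set of representatives that is saturated under almost-everywhere equality.
\<close>

definition L2 :: "'a measure \<Rightarrow> ('a \<Rightarrow> complex) set" where
  "L2 M = {f \<in> borel_measurable M. integrable M (\<lambda>x. (cmod (f x))\<^sup>2)}"

definition L2_norm :: "'a measure \<Rightarrow> ('a \<Rightarrow> complex) \<Rightarrow> real" where
  "L2_norm M f = sqrt (\<integral>x. (cmod (f x))\<^sup>2 \<partial>M)"

text \<open>
  \<open>z\<close> is in the resolvent set when \<open>A - z\<close> is onto \<open>S\<close> and has a bounded inverse; the norm bound
  contains injectivity.
\<close>

definition resolvent_set ::
    "'a measure \<Rightarrow> ('a \<Rightarrow> complex) set \<Rightarrow> (('a \<Rightarrow> complex) \<Rightarrow> 'a \<Rightarrow> complex) \<Rightarrow> complex set" where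
  "resolvent_set M S A =
     {z. (\<exists>C. \<forall>f\<in>S. L2_norm M f \<le> C * L2_norm M (\<lambda>x. A f x - z * f x)) \<and>
         (\<forall>g\<in>S. \<exists>f\<in>S. AE x in M. A f x - z * f x = g x)}"

definition spectrum ::
    "'a measure \<Rightarrow> ('a \<Rightarrow> complex) set \<Rightarrow> (('a \<Rightarrow> complex) \<Rightarrow> 'a \<Rightarrow> complex) \<Rightarrow> complex set" where
  "spectrum M S A = - resolvent_set M S A"

definition eigenspace ::
    "'a measure \<Rightarrow> ('a \<Rightarrow> complex) set \<Rightarrow> (('a \<Rightarrow> complex) \<Rightarrow> 'a \<Rightarrow> complex) \<Rightarrow> complex
      \<Rightarrow> ('a \<Rightarrow> complex) set" where
  "eigenspace M S A z = {f \<in> S. AE x in M. A f x = z * f x}"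

definition is_eigenvalue ::
    "'a measure \<Rightarrow> ('a \<Rightarrow> complex) set \<Rightarrow> (('a \<Rightarrow> complex) \<Rightarrow> 'a \<Rightarrow> complex) \<Rightarrow> complex \<Rightarrow> bool" where
  "is_eigenvalue M S A z \<longleftrightarrow> (\<exists>f\<in>eigenspace M S A z. \<not> (AE x in M. f x = 0))"

definition independent_ae :: "'a measure \<Rightarrow> nat \<Rightarrow> (nat \<Rightarrow> 'a \<Rightarrow> complex) \<Rightarrow> bool" where
  "independent_ae M m f \<longleftrightarrow>
     (\<forall>c::nat \<Rightarrow> complex. (AE x in M. (\<Sum>i<m. c i * f i x) = 0) \<longrightarrow> (\<forall>i<m. c i = 0))"

text \<open>The dimension of the eigenspace in \<open>L\<^sup>2(M)\<close>, possibly infinite; it is 0 if \<open>z\<close> is not an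
  eigenvalue.\<close>

definition multiplicity_ev ::
    "'a measure \<Rightarrow> ('a \<Rightarrow> complex) set \<Rightarrow> (('a \<Rightarrow> complex) \<Rightarrow> 'a \<Rightarrow> complex) \<Rightarrow> complex \<Rightarrow> enat" where
  "multiplicity_ev M S A z =
     Sup {enat m | m. \<exists>f. (\<forall>i<m. f i \<in> eigenspace M S A z) \<and> independent_ae M m f}"

text \<open>The number of eigenvalues in a set of reals, counted with multiplicity.\<close>

definition eigenvalue_count ::
    "'a measure \<Rightarrow> ('a \<Rightarrow> complex) set \<Rightarrow> (('a \<Rightarrow> complex) \<Rightarrow> 'a \<Rightarrow> complex) \<Rightarrow> real set \<Rightarrow> enat" where
  "eigenvalue_count M S A I =
     (SUP Z\<in>{Z. finite Z \<and> Z \<subseteq> I}. \<Sum>z\<in>Z. multiplicity_ev M S A (of_real z))"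


section \<open>The three-particle operator\<close>

definition torus3 :: "(real^3) set" where
  "torus3 = {p. \<forall>i. - pi < p $ i \<and> p $ i \<le> pi}"

abbreviation torus_measure :: "(real^3) measure" where
  "torus_measure \<equiv> restrict_space lborel torus3"

abbreviation torus_measure2 :: "((real^3) \<times> (real^3)) measure" where
  "torus_measure2 \<equiv> torus_measure \<Otimes>\<^sub>M torus_measure"

text \<open>\<open>dispersion\<close> is \<open>2\<pi>\<close>-periodic in each coordinate, so \<open>K - p - q\<close> needs no reduction to the
  fundamental domain.\<close>

definition dispersion :: "real^3 \<Rightarrow> real" where
  "dispersion p = (\<Sum>i\<in>UNIV. 1 - cos (p $ i))"

definition total_energy :: "real \<Rightarrow> real^3 \<Rightarrow> real^3 \<Rightarrow> real^3 \<Rightarrow> real" where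
  "total_energy \<gamma> K p q = dispersion p + dispersion q + \<gamma> * dispersion (K - p - q)"

definition L2_antisym :: "((real^3) \<times> (real^3) \<Rightarrow> complex) set" where
  "L2_antisym = {f \<in> L2 torus_measure2. AE (p, q) in torus_measure2. f (p, q) = - f (q, p)}"

definition H_op :: "real \<Rightarrow> real \<Rightarrow> real^3
    \<Rightarrow> ((real^3) \<times> (real^3) \<Rightarrow> complex) \<Rightarrow> (real^3) \<times> (real^3) \<Rightarrow> complex" where
  "H_op \<gamma> lam K f = (\<lambda>(p, q).
     of_real (total_energy \<gamma> K p q) * f (p, q)
     - of_real (lam / (2 * pi) ^ 3) * (\<integral>s. f (s, q) \<partial>torus_measure)
     - of_real (lam / (2 * pi) ^ 3) * (\<integral>s. f (p, s) \<partial>torus_measure))"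

definition h_op :: "real \<Rightarrow> real \<Rightarrow> real^3 \<Rightarrow> real^3 \<Rightarrow> (real^3 \<Rightarrow> complex) \<Rightarrow> real^3 \<Rightarrow> complex" where
  "h_op \<gamma> lam K q f = (\<lambda>p.
     of_real (total_energy \<gamma> K p q) * f p
     - of_real (lam / (2 * pi) ^ 3) * (\<integral>s. f s \<partial>torus_measure))"

text \<open>\<open>h_op\<close> is self-adjoint, so its spectrum is real and taking real parts only changes the type.\<close>

definition z_inf :: "real \<Rightarrow> real \<Rightarrow> real^3 \<Rightarrow> real^3 \<Rightarrow> real" where
  "z_inf \<gamma> lam K q = Inf (Re ` spectrum torus_measure (L2 torus_measure) (h_op \<gamma> lam K q))"

text \<open>The supremum is a maximum, since \<open>z_inf\<close> is continuous and periodic in \<open>q\<close>.\<close>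

definition tau_max :: "real \<Rightarrow> real^3 \<Rightarrow> real \<Rightarrow> real" where
  "tau_max \<gamma> K lam = (SUP q\<in>torus3. z_inf \<gamma> lam K q)"

abbreviation H_eigenvalue :: "real \<Rightarrow> real \<Rightarrow> real^3 \<Rightarrow> real \<Rightarrow> bool" where
  "H_eigenvalue \<gamma> lam K z \<equiv>
     is_eigenvalue torus_measure2 L2_antisym (H_op \<gamma> lam K) (complex_of_real z)"

abbreviation H_eigenvalue_count :: "real \<Rightarrow> real \<Rightarrow> real^3 \<Rightarrow> real set \<Rightarrow> enat" where
  "H_eigenvalue_count \<gamma> lam K I \<equiv>
     eigenvalue_count torus_measure2 L2_antisym (H_op \<gamma> lam K) I"

end

(*
If H f = - zeta f with f antisymmetric, then u(q) = int f(s,q) ds (normalised measure) determines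
f = lam (u(q) - u(p)) / (E(p,q) + zeta) and satisfies D u = int k(p,.) u(p) dp, where
k = zeta^2 / (E + zeta) = zeta - E + O(1/zeta) and D = int k dp - zeta^2 / lam. The function D of q is
nonnegative with a zero exactly when - zeta = tau_max, and u has mean zero, so as lam tends to infinity
the equation becomes the threshold problem for (6 - eps(q)) u = gamma V u on mean-zero functions, V being
the rank six operator with kernel sum_i cos(K_i - p_i - q_i). The critical coupling is the least gamma for
which gamma V exceeds 6 - eps in the sense of forms; it is positive because 1 / (6 - eps) is integrable
in dimension three.

Below it, a Taylor expansion of D at its minimiser, translated to the maximiser of eps, shows that
D dominates (1 - o(1)) (6 - eps), which leaves only u = 0. Above it, the operator D minus the
O(1/zeta) kernel is inverted by a Neumann series in the sup norm, which turns the equation at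
distance at least c > 0 from tau_max into the kernel of a symmetric 6 x 6 form depending continuously
on zeta. This form has positive index at least n near tau_max, where n is the index of the threshold
problem, and is negative definite far away, so that the dimensions of its kernels in between add up
to at least n.
*)

theory Submission
  imports Defs "HOL-Probability.Probability_Measure"
begin

section \<open>Positive index of a continuous path of symmetric forms\<close>

definition form_kernel :: "('a::euclidean_space \<Rightarrow> 'a \<Rightarrow> real) \<Rightarrow> 'a set" where
  "form_kernel B = {x. \<forall>y. B x y = 0}"

definition positive_on :: "('a::euclidean_space \<Rightarrow> 'a \<Rightarrow> real) \<Rightarrow> 'a set \<Rightarrow> bool" where
  "positive_on B S \<longleftrightarrow> subspace S \<and> (\<forall>x\<in>S. x \<noteq> 0 \<longrightarrow> B x x > 0)"

definition positive_index :: "('a::euclidean_space \<Rightarrow> 'a \<Rightarrow> real) \<Rightarrow> nat" where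
  "positive_index B = Max {dim S | S. positive_on B S}"

lemma finite_positive_dims: "finite {dim S | S. positive_on (B :: 'a::euclidean_space \<Rightarrow> _) S}"
  by (rule finite_subset[of _ "{..DIM('a)}"]) (auto simp: dim_subset_UNIV)

lemma positive_index_ge: "positive_on B S \<Longrightarrow> dim S \<le> positive_index B"
  unfolding positive_index_def by (rule Max_ge[OF finite_positive_dims]) auto

lemma positive_index_attained: "\<exists>S. positive_on B S \<and> dim S = positive_index B"
proof -
  have "positive_on B {0}" by (auto simp: positive_on_def)
  then have "{dim S | S. positive_on B S} \<noteq> {}" by auto
  from Max_in[OF finite_positive_dims this] show ?thesis unfolding positive_index_def by auto
qed

lemma subspace_form_kernel:
  assumes "bilinear B" shows "subspace (form_kernel B)"
  unfolding form_kernel_def subspace_def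
  by (auto simp: bilinear_ladd[OF assms] bilinear_lmul[OF assms] bilinear_lzero[OF assms])

lemma semidefinite_null:
  assumes B: "bilinear B" and sym: "\<And>x y. B x y = B y x" and S: "subspace S"
    and neg: "\<And>x. x \<in> S \<Longrightarrow> B x x \<le> (0::real)" and x: "x \<in> S" "B x x = 0" and y: "y \<in> S"
  shows "B x y = 0"
proof (rule ccontr)
  assume n: "B x y \<noteq> 0"
  have q: "2 * t * B x y + B y y \<le> 0" for t
  proof -
    have "t *\<^sub>R x + y \<in> S" using S x y by (simp add: subspace_add subspace_scale)
    from neg[OF this] show ?thesis
      using x sym[of y x] by (simp add: bilinear_ladd[OF B] bilinear_radd[OF B] bilinear_lmul[OF B] bilinear_rmul[OF B] algebra_simps)
  qed
  from q[of "(1 - B y y) / (2 * B x y)"] n show False by (simp add: field_simps)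
qed

lemma negative_complement:
  fixes B :: "'a::euclidean_space \<Rightarrow> 'a \<Rightarrow> real"
  assumes B: "bilinear B" and sym: "\<And>x y. B x y = B y x"
  shows "\<exists>N. subspace N \<and> (\<forall>x\<in>N. x \<noteq> 0 \<longrightarrow> B x x < 0) \<and>
           DIM('a) \<le> dim N + positive_index B + dim (form_kernel B)"
proof -
  obtain W where W: "positive_on B W" "dim W = positive_index B"
    using positive_index_attained by blast
  have sW: "subspace W" and pW: "\<And>x. x \<in> W \<Longrightarrow> x \<noteq> 0 \<Longrightarrow> B x x > 0"
    using W(1) by (auto simp: positive_on_def)
  define A where "A x = (\<Sum>b\<in>Basis. B x b *\<^sub>R b)" for x
  have BA: "B x y = A x \<bullet> y" for x y
  proof -
    interpret linear "B x" using B by (simp add: bilinear_def)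
    have "B x y = B x (\<Sum>b\<in>Basis. (y \<bullet> b) *\<^sub>R b)" by (simp add: euclidean_representation)
    also have "\<dots> = (\<Sum>b\<in>Basis. (y \<bullet> b) * B x b)" by (simp add: sum scale)
    also have "\<dots> = A x \<bullet> y" unfolding A_def inner_sum_left by (intro sum.cong) (simp_all add: inner_commute)
    finally show ?thesis .
  qed
  have lA: "linear A"
    unfolding A_def by (rule linearI)
      (auto simp: bilinear_ladd[OF B] bilinear_lmul[OF B] scaleR_add_left sum.distrib scaleR_sum_right)
  define P where "P = {x. \<forall>w\<in>W. B w x = 0}"
  have sP: "subspace P" unfolding P_def subspace_def
    by (auto simp: bilinear_radd[OF B] bilinear_rmul[OF B] bilinear_rzero[OF B])
  have "dim {y \<in> UNIV. \<forall>x\<in>A ` W. orthogonal x y} + dim (A ` W) = dim (UNIV :: 'a set)"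
    by (rule dim_subspace_orthogonal_to_vectors) (auto intro: linear_subspace_image[OF lA sW])
  moreover have "{y \<in> UNIV. \<forall>x\<in>A ` W. orthogonal x y} = P"
    by (auto simp: P_def BA orthogonal_def)
  moreover have "dim (A ` W) \<le> dim W" by (rule dim_image_le[OF lA])
  ultimately have dP: "DIM('a) \<le> dim P + dim W" by simp
  have WP: "W \<inter> P = {0}"
  proof (rule antisym)
    show "W \<inter> P \<subseteq> {0}"
    proof
      fix x assume "x \<in> W \<inter> P"
      then have "x \<in> W" "B x x = 0" by (auto simp: P_def)
      then show "x \<in> {0}" using pW[of x] by auto
    qed
  qed (use sW sP in \<open>auto simp: subspace_0\<close>)
  have "dim {x + y |x y. x \<in> W \<and> y \<in> P} + dim (W \<inter> P) = dim W + dim P"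
    by (rule dim_sums_Int[OF sW sP])
  then have "DIM('a) \<le> dim {x + y |x y. x \<in> W \<and> y \<in> P}" using dP WP by simp
  then have "span {x + y |x y. x \<in> W \<and> y \<in> P} = UNIV"
    by (intro dim_eq_full[THEN iffD1] antisym dim_subset_UNIV)
  then have full: "{x + y |x y. x \<in> W \<and> y \<in> P} = UNIV"
    using span_eq_iff[THEN iffD2, OF subspace_sums[OF sW sP]] by argo
  have nonpos: "B x x \<le> 0" if x: "x \<in> P" for x
  proof (rule ccontr)
    assume c: "\<not> B x x \<le> 0"
    then have x0: "x \<noteq> 0" using bilinear_lzero[OF B, of 0] by fastforce
    have "positive_on B (span (insert x W))"
      unfolding positive_on_def
    proof safe
      fix v assume v: "v \<in> span (insert x W)" "v \<noteq> 0"
      from v(1) obtain k where "v - k *\<^sub>R x \<in> span W" by (auto simp: span_insert)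
      then have wW: "v - k *\<^sub>R x \<in> W" by (simp add: span_eq_iff[THEN iffD2, OF sW])
      define w where "w = v - k *\<^sub>R x"
      have vw: "v = w + k *\<^sub>R x" by (simp add: w_def)
      have wW: "w \<in> W" using wW w_def by simp
      have "B w x = 0" "B x w = 0" using x wW sym by (auto simp: P_def)
      then have "B v v = B w w + k * k * B x x"
        by (simp add: vw bilinear_ladd[OF B] bilinear_radd[OF B] bilinear_lmul[OF B] bilinear_rmul[OF B])
      moreover have "B w w \<ge> 0" using pW[OF wW] bilinear_lzero[OF B, of 0] by (cases "w = 0") (simp_all add: less_imp_le)
      moreover have "w \<noteq> 0 \<or> k \<noteq> 0" using v(2) vw by auto
      moreover have "k * k * B x x > 0" if "k \<noteq> 0"
        by (rule mult_pos_pos) (use that c in \<open>auto simp: not_le zero_less_mult_iff linorder_neq_iff\<close>)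
      ultimately show "0 < B v v"
        using pW[OF wW] by (cases "k = 0") (auto intro!: add_nonneg_pos)
    qed
    from positive_index_ge[OF this] have "dim (insert x W) \<le> dim W" using W(2) by simp
    moreover have "x \<notin> span W" using sW WP x x0 by (metis IntI singletonD span_eq_iff)
    ultimately show False by (simp add: dim_insert)
  qed
  define N where "N = {y \<in> P. \<forall>x\<in>form_kernel B. orthogonal x y}"
  have kP: "form_kernel B \<subseteq> P" using sym by (force simp: form_kernel_def P_def)
  have dN: "dim N + dim (form_kernel B) = dim P"
    unfolding N_def by (rule dim_subspace_orthogonal_to_vectors[OF subspace_form_kernel[OF B] sP kP])
  have sN: "subspace N"
    using sP unfolding N_def subspace_def by (auto simp: orthogonal_clauses)
  have "B x x < 0" if x: "x \<in> N" "x \<noteq> 0" for x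
  proof (rule ccontr)
    assume "\<not> B x x < 0"
    moreover have xP: "x \<in> P" using x by (simp add: N_def)
    ultimately have z: "B x x = 0" using nonpos[OF xP] by auto
    have "B x v = 0" for v
    proof -
      obtain w y where wy: "v = w + y" "w \<in> W" "y \<in> P" using full by blast
      have "B x y = 0" by (rule semidefinite_null[OF B sym sP nonpos xP z wy(3)])
      moreover have "B x w = 0" using xP wy sym by (auto simp: P_def)
      ultimately show ?thesis by (simp add: wy(1) bilinear_radd[OF B])
    qed
    then have "x \<in> form_kernel B" by (simp add: form_kernel_def)
    then have "orthogonal x x" using x by (simp add: N_def)
    then show False using x by (simp add: orthogonal_def)
  qed
  then show ?thesis using sN dN dP W(2) by (intro exI[of _ N]) auto
qed

lemma negative_definite_margin:
  fixes B :: "'a::euclidean_space \<Rightarrow> 'a \<Rightarrow> real"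
  assumes B: "bilinear B" and S: "subspace S" and neg: "\<And>x. x \<in> S \<Longrightarrow> x \<noteq> 0 \<Longrightarrow> B x x < 0"
  shows "\<exists>c>0. \<forall>x\<in>S. B x x \<le> - c * (norm x)\<^sup>2"
proof -
  interpret bounded_bilinear B using B by (simp add: bilinear_conv_bounded_bilinear)
  let ?K = "sphere 0 1 \<inter> S"
  have hom: "B x x = (norm x)\<^sup>2 * B (x /\<^sub>R norm x) (x /\<^sub>R norm x)" for x
  proof (cases "x = 0")
    case False
    then have "(norm x)\<^sup>2 * (inverse (norm x) * inverse (norm x)) = 1"
      by (simp add: power2_eq_square field_simps)
    then show ?thesis by (simp add: scaleR_left scaleR_right mult.assoc[symmetric])
  qed (simp add: zero_left)
  have mem: "x /\<^sub>R norm x \<in> ?K" if "x \<in> S" "x \<noteq> 0" for x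
    using that S by (auto simp: subspace_scale)
  show ?thesis
  proof (cases "?K = {}")
    case True
    then have "x = 0" if "x \<in> S" for x using mem that by blast
    then have "\<forall>x\<in>S. B x x \<le> - 1 * (norm x)\<^sup>2" using zero_left[of 0] by fastforce
    then show ?thesis by (intro exI[of _ 1]) simp
  next
    case False
    have comp: "compact ?K" using closed_subspace[OF S] by (auto intro: compact_Int_closed)
    have "continuous_on ?K (\<lambda>x. B x x)" by (intro continuous_on continuous_on_id)
    from continuous_attains_sup[OF comp False this]
    obtain m where m: "m \<in> ?K" "\<And>x. x \<in> ?K \<Longrightarrow> B x x \<le> B m m" by blast
    have "m \<noteq> 0" using m by auto
    then have "B m m < 0" using m neg by auto
    moreover have "B x x \<le> - (- B m m) * (norm x)\<^sup>2" if "x \<in> S" for x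
    proof (cases "x = 0")
      case True then show ?thesis by (simp add: zero_left)
    next
      case False
      have "(norm x)\<^sup>2 * B (x /\<^sub>R norm x) (x /\<^sub>R norm x) \<le> (norm x)\<^sup>2 * B m m"
        by (rule mult_left_mono[OF m(2)[OF mem[OF that False]]]) simp
      then show ?thesis using hom[of x] by (simp add: mult.commute)
    qed
    ultimately show ?thesis by (intro exI[of _ "- B m m"]) auto
  qed
qed

lemma form_close:
  fixes B :: "real \<Rightarrow> 'a::euclidean_space \<Rightarrow> 'a \<Rightarrow> real"
  assumes B: "\<And>t. t \<in> I \<Longrightarrow> bilinear (B t)" and cont: "\<And>x y. continuous_on I (\<lambda>t. B t x y)"
    and t: "t \<in> I" and e: "e > 0"
  shows "\<exists>d>0. \<forall>s\<in>I. \<bar>s - t\<bar> < d \<longrightarrow> (\<forall>x. \<bar>B s x x - B t x x\<bar> \<le> e * (norm x)\<^sup>2)"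
proof -
  define F where "F s = (\<Sum>i\<in>Basis. \<Sum>j\<in>Basis. \<bar>B s i j - B t i j\<bar>)" for s
  have "continuous_on I F" unfolding F_def by (intro continuous_intros cont)
  moreover have "F t = 0" by (simp add: F_def)
  ultimately obtain d where d: "d > 0" "\<And>s. s \<in> I \<Longrightarrow> dist s t < d \<Longrightarrow> dist (F s) (F t) < e"
    using t e unfolding continuous_on_iff by metis
  have expand: "B s x x = (\<Sum>i\<in>Basis. \<Sum>j\<in>Basis. (x \<bullet> i) * (x \<bullet> j) * B s i j)" if "s \<in> I" for s x
  proof -
    have "B s x x = B s (\<Sum>i\<in>Basis. (x \<bullet> i) *\<^sub>R i) (\<Sum>j\<in>Basis. (x \<bullet> j) *\<^sub>R j)"
      by (simp add: euclidean_representation)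
    also have "\<dots> = (\<Sum>(i,j)\<in>Basis \<times> Basis. (x \<bullet> i) * (x \<bullet> j) * B s i j)"
      unfolding bilinear_sum[OF B[OF that]]
      by (intro sum.cong) (auto simp: bilinear_lmul[OF B[OF that]] bilinear_rmul[OF B[OF that]])
    finally show ?thesis by (simp add: sum.cartesian_product)
  qed
  have "\<bar>B s x x - B t x x\<bar> \<le> e * (norm x)\<^sup>2" if s: "s \<in> I" "\<bar>s - t\<bar> < d" for s x
  proof -
    have "B s x x - B t x x = (\<Sum>i\<in>Basis. \<Sum>j\<in>Basis. (x \<bullet> i) * (x \<bullet> j) * (B s i j - B t i j))"
      by (simp add: expand s t algebra_simps sum_subtractf)
    also have "\<bar>\<dots>\<bar> \<le> (\<Sum>i\<in>Basis. \<Sum>j\<in>Basis. \<bar>(x \<bullet> i) * (x \<bullet> j) * (B s i j - B t i j)\<bar>)"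
      by (rule order_trans[OF sum_abs]) (intro sum_mono sum_abs)
    also have "\<dots> \<le> (\<Sum>i\<in>Basis. \<Sum>j\<in>Basis. (norm x)\<^sup>2 * \<bar>B s i j - B t i j\<bar>)"
      by (intro sum_mono) (auto simp: abs_mult power2_eq_square intro!: mult_right_mono mult_mono Basis_le_norm)
    also have "\<dots> = F s * (norm x)\<^sup>2" by (simp add: F_def sum_distrib_left mult.commute)
    also have "\<dots> \<le> e * (norm x)\<^sup>2"
      using d(2)[OF s(1)] s(2) \<open>F t = 0\<close> by (intro mult_right_mono) (auto simp: dist_real_def)
    finally show ?thesis .
  qed
  then show ?thesis using d(1) by blast
qed

lemma positive_index_local:
  fixes B :: "real \<Rightarrow> 'a::euclidean_space \<Rightarrow> 'a \<Rightarrow> real"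
  assumes B: "\<And>t. t \<in> I \<Longrightarrow> bilinear (B t)" and sym: "\<And>t x y. t \<in> I \<Longrightarrow> B t x y = B t y x"
    and cont: "\<And>x y. continuous_on I (\<lambda>t. B t x y)" and t: "t \<in> I"
  shows "\<exists>d>0. \<forall>s\<in>I. \<bar>s - t\<bar> < d \<longrightarrow> positive_index (B t) \<le> positive_index (B s) \<and>
           positive_index (B s) \<le> positive_index (B t) + dim (form_kernel (B t))"
proof -
  obtain W where W: "positive_on (B t) W" "dim W = positive_index (B t)"
    using positive_index_attained by blast
  have "bilinear (\<lambda>x y. - B t x y)" using B[OF t] by (simp add: bilinear_def linear_compose_neg)
  from negative_definite_margin[OF this, of W] W(1)
  obtain c where c: "c > 0" "\<And>x. x \<in> W \<Longrightarrow> - B t x x \<le> - c * (norm x)\<^sup>2"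
    by (auto simp: positive_on_def)
  obtain N where N: "subspace N" "\<And>x. x \<in> N \<Longrightarrow> x \<noteq> 0 \<Longrightarrow> B t x x < 0"
    "DIM('a) \<le> dim N + positive_index (B t) + dim (form_kernel (B t))"
    using negative_complement[OF B[OF t] sym[OF t]] by blast
  from negative_definite_margin[OF B[OF t] N(1,2)]
  obtain c' where c': "c' > 0" "\<And>x. x \<in> N \<Longrightarrow> B t x x \<le> - c' * (norm x)\<^sup>2" by auto
  obtain d where d: "d > 0" "\<And>s x. s \<in> I \<Longrightarrow> \<bar>s - t\<bar> < d \<Longrightarrow> \<bar>B s x x - B t x x\<bar> \<le> (min c c' / 2) * (norm x)\<^sup>2"
    using form_close[OF B cont t, of "min c c' / 2"] c(1) c'(1) by auto
  have "positive_index (B t) \<le> positive_index (B s) \<and>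
           positive_index (B s) \<le> positive_index (B t) + dim (form_kernel (B t))"
    if s: "s \<in> I" "\<bar>s - t\<bar> < d" for s
  proof
    have half: "(min c c' / 2) * (norm x)\<^sup>2 < c * (norm x)\<^sup>2" "(min c c' / 2) * (norm x)\<^sup>2 < c' * (norm x)\<^sup>2"
      if "x \<noteq> 0" for x :: 'a
      using that c(1) c'(1) by (auto intro!: mult_strict_right_mono)
    have "positive_on (B s) W"
      unfolding positive_on_def
    proof safe
      show "subspace W" using W(1) by (simp add: positive_on_def)
      fix x assume x: "x \<in> W" "x \<noteq> 0"
      show "0 < B s x x" using c(2)[OF x(1)] d(2)[OF s, of x] half(1)[OF x(2)] by linarith
    qed
    from positive_index_ge[OF this] show "positive_index (B t) \<le> positive_index (B s)" by (simp add: W(2))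
    obtain X where X: "positive_on (B s) X" "dim X = positive_index (B s)"
      using positive_index_attained by blast
    have sX: "subspace X" using X(1) by (simp add: positive_on_def)
    have "x = 0" if x: "x \<in> X" "x \<in> N" for x
    proof (rule ccontr)
      assume x0: "x \<noteq> 0"
      have "B s x x > 0" using X(1) x x0 by (simp add: positive_on_def)
      then show False using c'(2)[OF x(2)] d(2)[OF s, of x] half(2)[OF x0] by linarith
    qed
    then have XN: "X \<inter> N = {0}" using subspace_0[OF sX] subspace_0[OF N(1)] by auto
    have "dim {x + y |x y. x \<in> X \<and> y \<in> N} + dim (X \<inter> N) = dim X + dim N"
      by (rule dim_sums_Int[OF sX N(1)])
    moreover have "dim {x + y |x y. x \<in> X \<and> y \<in> N} \<le> DIM('a)" by (rule dim_subset_UNIV)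
    ultimately show "positive_index (B s) \<le> positive_index (B t) + dim (form_kernel (B t))"
      using XN X(2) N(3) by simp
  qed
  then show ?thesis using d(1) by blast
qed

text \<open>The step function \<open>t \<mapsto> positive_index (B t) + (\<Sum>z \<le> t. dim (form_kernel (B z)))\<close> is
  nondecreasing near every point, hence nondecreasing.\<close>

lemma kernel_dims_ge_index_drop:
  fixes B :: "real \<Rightarrow> 'a::euclidean_space \<Rightarrow> 'a \<Rightarrow> real"
  assumes ab: "a \<le> b"
    and B: "\<And>t. t \<in> {a..b} \<Longrightarrow> bilinear (B t)" and sym: "\<And>t x y. t \<in> {a..b} \<Longrightarrow> B t x y = B t y x"
    and cont: "\<And>x y. continuous_on {a..b} (\<lambda>t. B t x y)"
    and pos: "positive_on (B a) S"
    and neg: "\<And>x. x \<noteq> 0 \<Longrightarrow> B b x x < 0"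
  shows "\<exists>Z. finite Z \<and> Z \<subseteq> {a..b} \<and> dim S \<le> (\<Sum>z\<in>Z. dim (form_kernel (B z)))"
proof -
  define Z where "Z = {t \<in> {a..b}. dim (form_kernel (B t)) > 0}"
  show ?thesis
  proof (cases "finite Z")
    case False
    then obtain Y where Y: "Y \<subseteq> Z" "finite Y" "card Y = dim S" by (meson infinite_arbitrarily_large)
    have "card Y * 1 \<le> (\<Sum>z\<in>Y. dim (form_kernel (B z)))"
      unfolding card_eq_sum sum_distrib_right using Y by (intro sum_mono) (auto simp: Z_def)
    then show ?thesis using Y by (intro exI[of _ Y]) (auto simp: Z_def)
  next
    case True
    define k where "k t = dim (form_kernel (B t))" for t
    define F where "F t = positive_index (B t) + (\<Sum>z\<in>Z \<inter> {..t}. k z)" for t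
    have finZ: "finite (Z \<inter> X)" for X using True by auto
    have "a \<le> a \<and> b \<le> b \<longrightarrow> F a \<le> F b"
      using ab
    proof (induction a b rule: Bolzano[where P = "\<lambda>u v. a \<le> u \<and> v \<le> b \<longrightarrow> F u \<le> F v"])
      case (trans u v w) then show ?case by auto
    next
      case (local x)
      then have x: "x \<in> {a..b}" by auto
      obtain d where d: "d > 0" "\<And>s. s \<in> {a..b} \<Longrightarrow> \<bar>s - x\<bar> < d \<Longrightarrow>
           positive_index (B x) \<le> positive_index (B s) \<and> positive_index (B s) \<le> positive_index (B x) + k x"
        using positive_index_local[OF B sym cont x] unfolding k_def by blast
      have left: "F s \<le> F x" if s: "a \<le> s" "s \<le> x" "x - s < d" for s
      proof (cases "s = x")
        case False
        have kx: "k x = (\<Sum>z\<in>Z \<inter> {x}. k z)"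
        proof (cases "x \<in> Z")
          case False
          then have "k x = 0" using x by (simp add: Z_def k_def)
          then show ?thesis using False by simp
        qed simp
        have "(\<Sum>z\<in>Z \<inter> {..s}. k z) + k x = (\<Sum>z\<in>(Z \<inter> {..s}) \<union> (Z \<inter> {x}). k z)"
          unfolding kx by (rule sum.union_disjoint[symmetric]) (use False s finZ in auto)
        also have "\<dots> \<le> (\<Sum>z\<in>Z \<inter> {..x}. k z)"
          using s by (intro sum_mono2 finZ) auto
        finally show ?thesis using d(2)[of s] s x by (auto simp: F_def)
      qed simp
      have right: "F x \<le> F s" if s: "s \<le> b" "x \<le> s" "s - x < d" for s
      proof -
        have "(\<Sum>z\<in>Z \<inter> {..x}. k z) \<le> (\<Sum>z\<in>Z \<inter> {..s}. k z)"
          using s by (intro sum_mono2 finZ) auto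
        then show ?thesis using d(2)[of s] s x by (auto simp: F_def)
      qed
      show ?case
      proof (intro exI[of _ d] conjI allI impI d(1))
        fix u v assume "u \<le> x \<and> x \<le> v \<and> v - u < d" "a \<le> u \<and> v \<le> b"
        then show "F u \<le> F v" using left[of u] right[of v] by linarith
      qed
    qed
    then have "F a \<le> F b" by simp
    moreover have "positive_index (B b) = 0"
    proof -
      obtain W where W: "positive_on (B b) W" "dim W = positive_index (B b)"
        using positive_index_attained by blast
      have "W \<subseteq> {0}" using W(1) neg by (force simp: positive_on_def)
      then show ?thesis using W(2) by (metis dim_eq_0)
    qed
    ultimately have "dim S \<le> (\<Sum>z\<in>Z \<inter> {..b}. k z)"
      using positive_index_ge[OF pos] by (simp add: F_def)
    then show ?thesis unfolding k_def using True by (intro exI[of _ "Z \<inter> {..b}"]) (auto simp: Z_def)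
  qed
qed

section \<open>The torus and its translations\<close>

definition lattice_vec :: "int^3 \<Rightarrow> real^3" where
  "lattice_vec n = (\<chi> i. 2 * pi * of_int (n $ i))"

definition wrap :: "real^3 \<Rightarrow> real^3" where
  "wrap x = x - lattice_vec (\<chi> i. \<lceil>(x $ i - pi) / (2 * pi)\<rceil>)"

definition tm :: "(real^3) measure" where
  "tm = density torus_measure (\<lambda>_. ennreal (1 / (2 * pi) ^ 3))"

lemma lattice_vec_nth [simp]: "lattice_vec n $ i = 2 * pi * of_int (n $ i)"
  by (simp add: lattice_vec_def)

lemma lattice_minus: "lattice_vec (- n) = - lattice_vec n"
  by (simp add: vec_eq_iff)

lemma wrap_in: "wrap x \<in> torus3"
proof -
  have "- pi < wrap x $ i \<and> wrap x $ i \<le> pi" for i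
  proof -
    define c where "c = \<lceil>(x $ i - pi) / (2 * pi)\<rceil>"
    have "of_int c - 1 < (x $ i - pi) / (2 * pi)" "(x $ i - pi) / (2 * pi) \<le> of_int c"
      unfolding c_def by linarith+
    then have "(of_int c - 1) * (2 * pi) < x $ i - pi" "x $ i - pi \<le> of_int c * (2 * pi)"
      using pi_gt_zero by (auto simp: field_simps)
    moreover have "wrap x $ i = x $ i - of_int c * (2 * pi)" by (simp add: wrap_def c_def)
    ultimately show ?thesis by (simp add: algebra_simps)
  qed
  then show ?thesis by (simp add: torus3_def)
qed

lemma wrap_unique:
  assumes "x - lattice_vec n \<in> torus3" shows "wrap x = x - lattice_vec n"
proof -
  have "\<lceil>(x $ i - pi) / (2 * pi)\<rceil> = n $ i" for i
  proof -
    have "- pi < x $ i - 2 * pi * of_int (n $ i)" "x $ i - 2 * pi * of_int (n $ i) \<le> pi"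
      using assms by (auto simp: torus3_def)
    then have "of_int (n $ i) - 1 < (x $ i - pi) / (2 * pi)" "(x $ i - pi) / (2 * pi) \<le> of_int (n $ i)"
      using pi_gt_zero by (auto simp: field_simps)
    then show ?thesis by (simp add: ceiling_unique)
  qed
  then show ?thesis by (simp add: wrap_def)
qed

lemma lattice_unique:
  assumes "x - lattice_vec n \<in> torus3" "x - lattice_vec m \<in> torus3" shows "n = m"
proof -
  have "lattice_vec n = lattice_vec m" using wrap_unique[OF assms(1)] wrap_unique[OF assms(2)] by simp
  then have "lattice_vec n $ i = lattice_vec m $ i" for i by simp
  then show ?thesis by (simp add: vec_eq_iff)
qed

lemma wrap_lattice: "\<exists>n. wrap x = x - lattice_vec n"
  by (auto simp: wrap_def)

lemma sets_torus3 [measurable]: "torus3 \<in> sets borel"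
proof -
  have "torus3 = (\<Inter>i. {p. - pi < p $ i} \<inter> {p. p $ i \<le> pi})" by (auto simp: torus3_def)
  moreover have "\<dots> \<in> sets borel"
    by (intro sets.countable_INT'' sets.Int borel_open borel_closed open_Collect_less closed_Collect_le continuous_intros) auto
  ultimately show ?thesis by simp
qed

lemma emeasure_torus3: "emeasure lborel torus3 = ennreal ((2 * pi) ^ 3)"
proof (rule antisym)
  let ?a = "(\<chi> i. - pi) :: real^3" and ?b = "(\<chi> i. pi) :: real^3"
  have B: "?b - ?a = (\<chi> i. 2 * pi)" by (simp add: vec_eq_iff)
  have P: "(\<Prod>b\<in>Basis. (?b - ?a) \<bullet> b) = (2 * pi) ^ 3"
  proof -
    have "(Basis :: (real^3) set) = range (\<lambda>i. axis i 1)" by (auto simp: Basis_vec_def)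
    moreover have "inj (\<lambda>i::3. axis i (1::real))" by (auto simp: inj_on_def axis_eq_axis)
    then have "prod ((\<bullet>) ((\<chi> i. 2 * pi) :: real^3)) (range (\<lambda>i. axis i 1)) = (2 * pi) ^ 3"
      by (subst prod.reindex) (auto simp: inner_axis)
    ultimately show ?thesis unfolding B by simp
  qed
  have le: "?a \<bullet> b \<le> ?b \<bullet> b" if "b \<in> Basis" for b
    using that by (auto simp: Basis_vec_def inner_axis)
  have "torus3 \<subseteq> cbox ?a ?b" by (auto simp: torus3_def mem_box_cart less_imp_le)
  then have "emeasure lborel torus3 \<le> emeasure lborel (cbox ?a ?b)" by (intro emeasure_mono) auto
  also have "\<dots> = ennreal ((2 * pi) ^ 3)" using le P by (subst emeasure_lborel_cbox) auto
  finally show "emeasure lborel torus3 \<le> ennreal ((2 * pi) ^ 3)" .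
  have "box ?a ?b \<subseteq> torus3" by (auto simp: torus3_def mem_box_cart less_imp_le)
  then have "emeasure lborel (box ?a ?b) \<le> emeasure lborel torus3" by (intro emeasure_mono) auto
  moreover have "emeasure lborel (box ?a ?b) = ennreal ((2 * pi) ^ 3)" using le P by (subst emeasure_lborel_box) auto
  ultimately show "ennreal ((2 * pi) ^ 3) \<le> emeasure lborel torus3" by simp
qed

lemma wrap_measurable [measurable]: "wrap \<in> borel_measurable borel"
proof (rule borel_measurable_euclidean_space[THEN iffD2], rule ballI)
  fix b :: "real^3" assume "b \<in> Basis"
  then obtain i where b: "b = axis i 1" by (auto simp: Basis_vec_def)
  have "(\<lambda>x. x $ i - 2 * pi * of_int \<lceil>(x $ i - pi) / (2 * pi)\<rceil>) \<in> borel_measurable (borel :: (real^3) measure)"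
    by measurable
  then show "(\<lambda>x. wrap x \<bullet> b) \<in> borel_measurable borel"
    by (simp add: b inner_axis wrap_def)
qed

lemma emeasure_torus_measure: "A \<in> sets torus_measure \<Longrightarrow> emeasure torus_measure A = emeasure lborel A"
  by (rule emeasure_restrict_space) (auto simp: sets_restrict_space)

lemma sets_torus_measure: "A \<in> sets torus_measure \<longleftrightarrow> A \<in> sets borel \<and> A \<subseteq> torus3"
  by (subst sets_restrict_space_iff) auto

lemma borel_measurable_torus: "f \<in> borel_measurable borel \<Longrightarrow> f \<in> borel_measurable torus_measure"
  by (rule measurable_restrict_space1) simp

lemma finite_measure_torus: "finite_measure torus_measure"
proof (rule finite_measureI)
  have "torus3 \<in> sets torus_measure" by (simp add: sets_torus_measure)
  then show "emeasure torus_measure (space torus_measure) \<noteq> \<infinity>"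
    by (simp add: emeasure_torus_measure emeasure_torus3)
qed

lemma space_tm [simp]: "space tm = torus3"
  by (simp add: tm_def)

lemma sets_tm [measurable_cong]: "sets tm = sets torus_measure"
  by (simp add: tm_def)

lemma measurable_tm_eq: "measurable tm N = measurable torus_measure N"
  by (rule measurable_cong_sets[OF sets_tm refl])

lemma borel_measurable_tm: "f \<in> borel_measurable borel \<Longrightarrow> f \<in> borel_measurable tm"
  unfolding measurable_tm_eq by (rule borel_measurable_torus)

lemma emeasure_tm: "A \<in> sets tm \<Longrightarrow> emeasure tm A = ennreal (1 / (2 * pi) ^ 3) * emeasure lborel A"
  unfolding tm_def by (subst emeasure_density_const) (simp_all add: emeasure_torus_measure)

lemma prob_space_tm: "prob_space tm"
proof (rule prob_spaceI)
  have "torus3 \<in> sets tm" by (simp add: sets_tm sets_torus_measure)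
  then show "emeasure tm (space tm) = 1"
    by (simp add: emeasure_tm emeasure_torus3 ennreal_mult[symmetric])
qed

interpretation tm: prob_space tm by (rule prob_space_tm)

interpretation tm2: pair_prob_space tm tm ..

lemma integral_tm:
  fixes f :: "real^3 \<Rightarrow> 'b::{banach, second_countable_topology}"
  assumes "f \<in> borel_measurable torus_measure"
  shows "(\<integral>x. f x \<partial>tm) = (\<integral>x. f x \<partial>torus_measure) /\<^sub>R (2 * pi) ^ 3"
  unfolding tm_def using assms by (subst integral_density) (auto simp: inverse_eq_divide)

lemma integrable_tm:
  fixes f :: "real^3 \<Rightarrow> 'b::{banach, second_countable_topology}"
  assumes "f \<in> borel_measurable torus_measure"
  shows "integrable tm f \<longleftrightarrow> integrable torus_measure f"
proof -
  define c :: real where "c = 1 / (2 * pi) ^ 3"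
  have c: "c > 0" by (simp add: c_def)
  have "integrable tm f \<longleftrightarrow> integrable torus_measure (\<lambda>x. c *\<^sub>R f x)"
    unfolding tm_def c_def[symmetric] using assms c by (subst integrable_density) auto
  moreover have "integrable torus_measure f" if "integrable torus_measure (\<lambda>x. c *\<^sub>R f x)"
    using integrable_scaleR_right[OF that, of "1 / c"] c by simp
  ultimately show ?thesis by auto
qed

lemma wrap_shift_measurable [measurable]: "(\<lambda>x. wrap (x + s)) \<in> measurable tm tm"
proof (rule measurableI)
  fix A assume "A \<in> sets tm"
  then have A: "A \<in> sets borel" by (simp add: sets_tm sets_torus_measure)
  have "(\<lambda>x. wrap (x + s)) \<in> borel_measurable borel" by measurable
  from measurable_sets[OF this A] have "(\<lambda>x. wrap (x + s)) -` A \<in> sets borel" by simp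
  then show "(\<lambda>x. wrap (x + s)) -` A \<inter> space tm \<in> sets tm"
    by (auto simp: sets_tm sets_torus_measure)
qed (simp add: wrap_in)

lemma distr_wrap_shift: "distr tm tm (\<lambda>x. wrap (x + s)) = tm"
proof (rule measure_eqI)
  fix A assume "A \<in> sets (distr tm tm (\<lambda>x. wrap (x + s)))"
  then have A: "A \<in> sets tm" by simp
  then have Ab [measurable]: "A \<in> sets borel" and AT: "A \<subseteq> torus3" by (auto simp: sets_tm sets_torus_measure)
  define X where "X n = {x \<in> torus3. x + s - lattice_vec n \<in> A}" for n
  define Y where "Y n = {y \<in> A. y - s + lattice_vec n \<in> torus3}" for n
  have X: "X n \<in> sets borel" and Y: "Y n \<in> sets borel" for n
    unfolding X_def Y_def by measurable
  have "{x \<in> torus3. wrap (x + s) \<in> A} = (\<Union>n. X n)"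
  proof (intro set_eqI iffI)
    fix x assume x: "x \<in> {x \<in> torus3. wrap (x + s) \<in> A}"
    obtain n where "wrap (x + s) = x + s - lattice_vec n" using wrap_lattice by blast
    then show "x \<in> (\<Union>n. X n)" using x by (auto simp: X_def)
  next
    fix x assume "x \<in> (\<Union>n. X n)"
    then obtain n where n: "x \<in> torus3" "x + s - lattice_vec n \<in> A" by (auto simp: X_def)
    then have "wrap (x + s) = x + s - lattice_vec n" using AT by (intro wrap_unique) auto
    then show "x \<in> {x \<in> torus3. wrap (x + s) \<in> A}" using n by simp
  qed
  moreover have "disjoint_family X"
    unfolding disjoint_family_on_def X_def using lattice_unique AT by blast
  ultimately have 1: "emeasure lborel {x \<in> torus3. wrap (x + s) \<in> A} = (\<integral>\<^sup>+n. emeasure lborel (X n) \<partial>count_space UNIV)"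
    using X by (simp add: emeasure_UN_countable)
  have "A = (\<Union>n. Y n)"
  proof safe
    fix y assume "y \<in> A"
    obtain n where "wrap (y - s) = y - s - lattice_vec n" using wrap_lattice by blast
    then have "y - s + lattice_vec (- n) \<in> torus3" using wrap_in[of "y - s"]
      by (simp add: lattice_minus)
    then show "y \<in> (\<Union>n. Y n)" using \<open>y \<in> A\<close> unfolding Y_def by blast
  qed (auto simp: Y_def)
  moreover have "disjoint_family Y"
    unfolding disjoint_family_on_def
  proof safe
    fix m n y assume "m \<noteq> n" "y \<in> Y m" "y \<in> Y n"
    then have "(y - s) - lattice_vec (- m) \<in> torus3" "(y - s) - lattice_vec (- n) \<in> torus3"
      by (auto simp: Y_def lattice_minus)
    from lattice_unique[OF this] have "- m = - n" .
    then show "y \<in> {}" using \<open>m \<noteq> n\<close> by simp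
  qed
  ultimately have 2: "emeasure lborel A = (\<integral>\<^sup>+n. emeasure lborel (Y n) \<partial>count_space UNIV)"
    using Y emeasure_UN_countable[of UNIV Y lborel] by simp
  have "emeasure lborel (Y n) = emeasure lborel (X n)" for n
  proof -
    have "emeasure lborel (Y n) = emeasure (distr lborel borel ((+) (s - lattice_vec n))) (Y n)"
      by (simp add: lborel_distr_plus)
    also have "\<dots> = emeasure lborel ((+) (s - lattice_vec n) -` Y n \<inter> space lborel)"
      using Y by (intro emeasure_distr) auto
    also have "(+) (s - lattice_vec n) -` Y n \<inter> space lborel = X n"
      by (auto simp: X_def Y_def algebra_simps)
    finally show ?thesis .
  qed
  with 1 2 have 3: "emeasure lborel {x \<in> torus3. wrap (x + s) \<in> A} = emeasure lborel A" by simp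
  have "emeasure (distr tm tm (\<lambda>x. wrap (x + s))) A = emeasure tm ((\<lambda>x. wrap (x + s)) -` A \<inter> space tm)"
    by (rule emeasure_distr) (use A in auto)
  also have "(\<lambda>x. wrap (x + s)) -` A \<inter> space tm = {x \<in> torus3. wrap (x + s) \<in> A}" by auto
  also have "emeasure tm \<dots> = emeasure tm A"
    using 3 A by (subst (1 2) emeasure_tm) (auto simp: sets_tm sets_torus_measure)
  finally show "emeasure (distr tm tm (\<lambda>x. wrap (x + s))) A = emeasure tm A" .
qed simp

lemma integral_wrap_shift:
  fixes f :: "real^3 \<Rightarrow> 'b::{banach, second_countable_topology}"
  assumes "f \<in> borel_measurable tm"
  shows "(\<integral>x. f (wrap (x + s)) \<partial>tm) = (\<integral>x. f x \<partial>tm)"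
  using integral_distr[OF wrap_shift_measurable assms, of s] by (simp add: distr_wrap_shift)

lemma integrable_wrap_shift:
  fixes f :: "real^3 \<Rightarrow> 'b::{banach, second_countable_topology}"
  assumes "integrable tm f"
  shows "integrable tm (\<lambda>x. f (wrap (x + s)))"
  using integrable_distr_eq[OF wrap_shift_measurable borel_measurable_integrable[OF assms], of s] assms
  unfolding distr_wrap_shift by simp

lemma AE_wrap_shift:
  assumes "AE x in tm. P (wrap (x + s))" and [measurable]: "Measurable.pred tm P"
  shows "AE x in tm. P x"
proof -
  have "{x \<in> space tm. P x} \<in> sets tm" by measurable
  from AE_distr_iff[OF wrap_shift_measurable this, of s] assms(1) show ?thesis
    unfolding distr_wrap_shift by simp
qed

lemma integrable_tm_bounded:
  fixes f :: "real^3 \<Rightarrow> 'b::{banach, second_countable_topology}"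
  assumes "f \<in> borel_measurable tm" "\<And>x. x \<in> torus3 \<Longrightarrow> norm (f x) \<le> C"
  shows "integrable tm f"
  by (rule tm.integrable_const_bound[of _ C]) (use assms in auto)

lemma cos_wrap: "cos (wrap x $ i + c) = cos (x $ i + c)"
  and sin_wrap: "sin (wrap x $ i + c) = sin (x $ i + c)"
proof -
  obtain n where n: "wrap x = x - lattice_vec n" using wrap_lattice by blast
  have 1: "wrap x $ i + c = (x $ i + c) + 2 * pi * of_int (- n $ i)" by (simp add: n)
  show "cos (wrap x $ i + c) = cos (x $ i + c)"
    unfolding 1 cos_add by (simp only: cos_int_2pin sin_int_2pin) simp
  show "sin (wrap x $ i + c) = sin (x $ i + c)"
    unfolding 1 sin_add by (simp only: cos_int_2pin sin_int_2pin) simp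
qed

lemma integral_antiperiodic:
  fixes f :: "real^3 \<Rightarrow> real"
  assumes "f \<in> borel_measurable tm" "\<And>x. f (wrap (x + s)) = - f x"
  shows "(\<integral>x. f x \<partial>tm) = 0"
  using integral_wrap_shift[OF assms(1), of s] assms(2) by simp

lemma integral_cos: "(\<integral>x. cos (x $ i + c) \<partial>tm) = 0"
proof (rule integral_antiperiodic[where s = "axis i pi"])
  show "(\<lambda>x. cos (x $ i + c)) \<in> borel_measurable tm" by (intro borel_measurable_tm) measurable
  fix x show "cos (wrap (x + axis i pi) $ i + c) = - cos (x $ i + c)"
    unfolding cos_wrap by (simp add: axis_def add.commute add.left_commute)
qed

lemma integral_cos_cos:
  "(\<integral>x. cos (x $ i + a) * cos (x $ j + b) \<partial>tm) = (if i = j then cos (a - b) / 2 else 0)"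
proof (cases "i = j")
  case False
  have "(\<integral>x. cos (x $ i + a) * cos (x $ j + b) \<partial>tm) = 0"
  proof (rule integral_antiperiodic[where s = "axis i pi"])
    show "(\<lambda>x. cos (x $ i + a) * cos (x $ j + b)) \<in> borel_measurable tm"
      by (intro borel_measurable_tm) measurable
    fix x show "cos (wrap (x + axis i pi) $ i + a) * cos (wrap (x + axis i pi) $ j + b) = - (cos (x $ i + a) * cos (x $ j + b))"
      unfolding cos_wrap using False by (simp add: axis_def add.commute add.left_commute)
  qed
  then show ?thesis using False by simp
next
  case True
  have m: "(\<lambda>x. cos (2 * x $ i + (a + b))) \<in> borel_measurable tm" by (intro borel_measurable_tm) measurable
  have "(\<integral>x. cos (2 * x $ i + (a + b)) \<partial>tm) = 0"
  proof (rule integral_antiperiodic[where s = "axis i (pi / 2)", OF m])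
    fix x
    obtain n where n: "wrap (x + axis i (pi / 2)) = (x + axis i (pi / 2)) - lattice_vec n" using wrap_lattice by blast
    have 1: "2 * wrap (x + axis i (pi / 2)) $ i + (a + b) = ((2 * x $ i + (a + b)) + pi) + 2 * pi * of_int (- 2 * n $ i)"
      by (subst n) (simp add: axis_def)
    show "cos (2 * wrap (x + axis i (pi / 2)) $ i + (a + b)) = - cos (2 * x $ i + (a + b))"
      unfolding 1 cos_add[of _ "2 * pi * of_int (- 2 * n $ i)"] by (simp only: cos_int_2pin sin_int_2pin) simp
  qed
  moreover have "(\<integral>x. cos (x $ i + a) * cos (x $ i + b) \<partial>tm) = (\<integral>x. cos (a - b) / 2 + cos (2 * x $ i + (a + b)) / 2 \<partial>tm)"
    by (simp add: cos_times_cos add_divide_distrib algebra_simps)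
  moreover have "\<dots> = cos (a - b) / 2 + (\<integral>x. cos (2 * x $ i + (a + b)) \<partial>tm) / 2"
    using tm.prob_space m
    by (subst Bochner_Integration.integral_add) (auto intro!: integrable_tm_bounded[where C = 1] order_trans[OF abs_cos_le_one])
  ultimately show ?thesis using True by simp
qed

section \<open>Integrability of the inverse dispersion\<close>

lemma abs_sin_minus_self: "\<bar>sin x - x\<bar> \<le> \<bar>x\<bar> ^ 3 / 6" for x :: real
  using Maclaurin_sin_bound[of x 3] by (simp add: sin_coeff_def numeral_eq_Suc)

lemma sin_ge_third:
  assumes "0 \<le> x" "x \<le> (2::real)" shows "x / 3 \<le> sin x"
proof -
  have "x * x \<le> 2 * 2" using assms by (intro mult_mono) auto
  then have "x * (x * x) \<le> x * 4" using assms by (intro mult_left_mono) auto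
  moreover have "x - sin x \<le> x * (x * x) / 6"
    using abs_sin_minus_self[of x] abs_ge_minus_self[of "sin x - x"] assms
    by (simp add: power3_eq_cube mult.assoc)
  ultimately show ?thesis by linarith
qed

lemma one_minus_cos_ge:
  assumes "\<bar>v\<bar> \<le> pi" shows "v\<^sup>2 / 18 \<le> 1 - cos v"
proof -
  have "\<bar>v\<bar> / 2 / 3 \<le> sin (\<bar>v\<bar> / 2)" using assms pi_less_4 by (intro sin_ge_third) auto
  then have "(\<bar>v\<bar> / 2 / 3)\<^sup>2 \<le> (sin (\<bar>v\<bar> / 2))\<^sup>2" by (intro power_mono) auto
  moreover have "1 - cos v = 2 * (sin (\<bar>v\<bar> / 2))\<^sup>2"
    using cos_double_sin[of "\<bar>v\<bar> / 2"] by (simp add: cos_abs_real)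
  ultimately show ?thesis by (simp add: power_divide)
qed

lemma dispersion_ge: "x \<in> torus3 \<Longrightarrow> (x $ i)\<^sup>2 / 18 \<le> dispersion x"
proof -
  assume x: "x \<in> torus3"
  then have "(x $ i)\<^sup>2 / 18 \<le> 1 - cos (x $ i)"
    by (intro one_minus_cos_ge) (auto simp: torus3_def abs_le_iff less_imp_le minus_le_iff)
  also have "\<dots> \<le> dispersion x" unfolding dispersion_def by (rule member_le_sum) auto
  finally show ?thesis .
qed

lemma dispersion_nonneg: "0 \<le> dispersion x"
  unfolding dispersion_def by (intro sum_nonneg) simp

lemma dispersion_le: "dispersion x \<le> 6"
proof -
  have "dispersion x \<le> (\<Sum>i\<in>(UNIV::3 set). 2)" unfolding dispersion_def
    using cos_ge_minus_one by (intro sum_mono) (smt (verit))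
  then show ?thesis by simp
qed

lemma dispersion_pos: "x \<in> torus3 \<Longrightarrow> x \<noteq> 0 \<Longrightarrow> 0 < dispersion x"
proof -
  assume x: "x \<in> torus3" "x \<noteq> 0"
  then obtain i where "x $ i \<noteq> 0" by (auto simp: vec_eq_iff)
  then have "0 < (x $ i)\<^sup>2 / 18" by simp
  then show ?thesis using dispersion_ge[OF x(1), of i] by linarith
qed

lemma continuous_dispersion [continuous_intros]:
  fixes f :: "'a::t2_space \<Rightarrow> real^3"
  shows "continuous_on S f \<Longrightarrow> continuous_on S (\<lambda>x. dispersion (f x))"
  unfolding dispersion_def
  by (intro continuous_on_sum continuous_on_diff continuous_on_const continuous_on_cos)
    (rule bounded_linear.continuous_on[OF bounded_linear_vec_nth])

lemma measurable_dispersion [measurable]: "dispersion \<in> borel_measurable borel"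
  by (intro borel_measurable_continuous_onI continuous_intros)

lemma measurable_dispersion_tm [measurable]: "dispersion \<in> borel_measurable tm"
  by (intro borel_measurable_tm) simp

lemma zero_in_torus3: "0 \<in> torus3"
  by (simp add: torus3_def)

lemma AE_tm_nonzero: "AE x in tm. x \<noteq> 0"
proof -
  have "emeasure tm {0} = 0" 
    by (subst emeasure_tm) (auto simp: sets_tm sets_torus_measure zero_in_torus3)
  then show ?thesis
    by (intro AE_I[of _ _ "{0}"]) (auto simp: sets_tm sets_torus_measure zero_in_torus3)
qed

text \<open>Summing over the dyadic cubes \<open>{x. \<bar>x\<^sub>i\<bar> \<le> pi / 2 ^ k}\<close>: on the \<open>k\<close>-th shell \<open>1 / dispersion\<close>
  is of order \<open>4 ^ k\<close>, while the cube has measure \<open>8 ^ - k\<close>.\<close>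

lemma nn_integral_inverse_dispersion: "(\<integral>\<^sup>+x. ennreal (1 / dispersion x) \<partial>tm) < \<infinity>"
proof -
  define S where "S k = {x \<in> torus3. \<forall>i. \<bar>x $ i\<bar> \<le> pi / 2 ^ k}" for k :: nat
  have S: "S k \<in> sets tm" for k
  proof -
    have "S k = torus3 \<inter> (\<Inter>i. {x. \<bar>x $ i\<bar> \<le> pi / 2 ^ k})" by (auto simp: S_def)
    moreover have "\<dots> \<in> sets borel"
      by (intro sets.Int sets_torus3 sets.countable_INT'' borel_closed closed_Collect_le continuous_intros) auto
    ultimately show ?thesis by (auto simp: sets_tm sets_torus_measure)
  qed
  have mS: "emeasure tm (S k) \<le> ennreal (1 / 8 ^ k)" for k
  proof -
    let ?c = "pi / 2 ^ k"
    let ?a = "(\<chi> i. - ?c) :: real^3" and ?b = "(\<chi> i. ?c) :: real^3"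
    have B: "?b - ?a = (\<chi> i. 2 * ?c)" by (simp add: vec_eq_iff)
    have "(Basis :: (real^3) set) = range (\<lambda>i. axis i 1)" by (auto simp: Basis_vec_def)
    moreover have "inj (\<lambda>i::3. axis i (1::real))" by (auto simp: inj_on_def axis_eq_axis)
    then have "prod ((\<bullet>) ((\<chi> i. 2 * ?c) :: real^3)) (range (\<lambda>i. axis i 1)) = (2 * ?c) ^ 3"
      by (subst prod.reindex) (auto simp: inner_axis)
    ultimately have P: "(\<Prod>b\<in>Basis. (?b - ?a) \<bullet> b) = (2 * ?c) ^ 3" unfolding B by simp
    have le: "?a \<bullet> b \<le> ?b \<bullet> b" if "b \<in> Basis" for b
      using that by (auto simp: Basis_vec_def inner_axis)
    have "S k \<subseteq> cbox ?a ?b" by (auto simp: S_def mem_box_cart abs_le_iff minus_le_iff)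
    then have "emeasure lborel (S k) \<le> emeasure lborel (cbox ?a ?b)" by (intro emeasure_mono) auto
    also have "\<dots> = ennreal ((2 * ?c) ^ 3)" using le P by (subst emeasure_lborel_cbox) auto
    finally have "emeasure tm (S k) \<le> ennreal (1 / (2 * pi) ^ 3) * ennreal ((2 * ?c) ^ 3)"
      using S by (simp add: emeasure_tm mult_left_mono)
    also have "\<dots> = ennreal (1 / (2 * pi) ^ 3 * (2 * ?c) ^ 3)" by (rule ennreal_mult[symmetric]) auto
    also have "1 / (2 * pi) ^ 3 * (2 * ?c) ^ 3 = 1 / 8 ^ k"
    proof -
      have "(2 ^ k) ^ 3 = ((2::real) ^ 3) ^ k" by (simp only: power_mult[symmetric] mult.commute)
      then show ?thesis by (simp add: power_mult_distrib power_divide)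
    qed
    finally show ?thesis .
  qed
  have point: "ennreal (1 / dispersion x) \<le> (\<Sum>k. ennreal (72 * 4 ^ k) * indicator (S k) x)" if x: "x \<in> torus3" for x
  proof (cases "x = 0")
    case True
    then show ?thesis by (simp add: dispersion_def)
  next
    case False
    then obtain i0 where i0: "x $ i0 \<noteq> 0" by (auto simp: vec_eq_iff)
    have xpi: "\<bar>x $ i\<bar> \<le> pi" for i using x by (auto simp: torus3_def abs_le_iff less_imp_le minus_le_iff)
    have ex: "\<exists>k. pi / 2 ^ k < \<bar>x $ i0\<bar>"
    proof -
      obtain k where k: "pi / \<bar>x $ i0\<bar> < 2 ^ k" using real_arch_pow[of 2 "pi / \<bar>x $ i0\<bar>"] by auto
      then show ?thesis using i0 by (intro exI[of _ k]) (simp add: field_simps)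
    qed
    define k where "k = (LEAST k. \<exists>i. pi / 2 ^ k < \<bar>x $ i\<bar>)"
    have "\<exists>i. pi / 2 ^ k < \<bar>x $ i\<bar>" unfolding k_def by (rule LeastI_ex) (use ex in blast)
    then obtain i where i: "pi / 2 ^ k < \<bar>x $ i\<bar>" by blast
    have "k \<noteq> 0"
    proof
      assume "k = 0"
      then show False using i xpi[of i] by simp
    qed
    then obtain j where j: "k = Suc j" by (cases k) auto
    have "\<not> (\<exists>i. pi / 2 ^ j < \<bar>x $ i\<bar>)" using not_less_Least[of j "\<lambda>k. \<exists>i. pi / 2 ^ k < \<bar>x $ i\<bar>"] j by (simp add: k_def)
    then have xS: "x \<in> S j" using x by (auto simp: S_def not_less)
    have "(1 / 2 ^ k)\<^sup>2 \<le> \<bar>x $ i\<bar>\<^sup>2"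
      using i pi_gt3 by (intro power_mono) (auto simp: field_simps elim: order_trans[rotated])
    then have "1 / (4 * 4 ^ j) \<le> (x $ i)\<^sup>2"
      using power_mult[of "2::real" j 2] power_mult[of "2::real" 2 j]
      by (simp add: j power_divide power_mult_distrib mult.commute[of j])
    then have "1 / (72 * 4 ^ j) \<le> (x $ i)\<^sup>2 / 18" by (simp add: field_simps)
    then have "1 / (72 * 4 ^ j) \<le> dispersion x" using dispersion_ge[OF x, of i] by linarith
    then have "1 / dispersion x \<le> 72 * 4 ^ j"
      using dispersion_pos[OF x False] by (simp add: field_simps)
    then have "ennreal (1 / dispersion x) \<le> ennreal (72 * 4 ^ j) * indicator (S j) x"
      using xS by (simp add: ennreal_leI)
    also have "\<dots> = (\<Sum>k\<in>{j}. ennreal (72 * 4 ^ k) * indicator (S k) x)"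
      by (simp del: ennreal_mult sum_mult_indicator)
    also have "\<dots> \<le> (\<Sum>k. ennreal (72 * 4 ^ k) * indicator (S k) x)" by (rule sum_le_suminf) auto
    finally show ?thesis .
  qed
  have "(\<integral>\<^sup>+x. ennreal (1 / dispersion x) \<partial>tm) \<le> (\<integral>\<^sup>+x. (\<Sum>k. ennreal (72 * 4 ^ k) * indicator (S k) x) \<partial>tm)"
    by (rule nn_integral_mono) (use point in simp)
  also have "\<dots> = (\<Sum>k. \<integral>\<^sup>+x. ennreal (72 * 4 ^ k) * indicator (S k) x \<partial>tm)"
    using S by (intro nn_integral_suminf) auto
  also have "\<dots> = (\<Sum>k. ennreal (72 * 4 ^ k) * emeasure tm (S k))"
    using S by (simp add: nn_integral_cmult_indicator)
  also have "\<dots> \<le> (\<Sum>k. ennreal (72 * (1 / 2) ^ k))"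
  proof (rule suminf_le)
    fix k
    have "ennreal (72 * 4 ^ k) * emeasure tm (S k) \<le> ennreal (72 * 4 ^ k) * ennreal (1 / 8 ^ k)"
      using mS by (rule mult_left_mono) simp
    also have "\<dots> = ennreal (72 * 4 ^ k * (1 / 8 ^ k))" by (rule ennreal_mult[symmetric]) auto
    also have "72 * 4 ^ k * (1 / 8 ^ k) = 72 * (1 / 2 :: real) ^ k"
    proof -
      have "(8::real) ^ k = 2 ^ k * 4 ^ k" by (simp add: power_mult_distrib[symmetric])
      then show ?thesis by (simp add: field_simps power_divide)
    qed
    finally show "ennreal (72 * 4 ^ k) * emeasure tm (S k) \<le> ennreal (72 * (1 / 2) ^ k)" .
  qed auto
  also have "\<dots> = ennreal (\<Sum>k. 72 * (1 / 2) ^ k)"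
    by (rule suminf_ennreal2) (auto intro!: summable_mult summable_geometric)
  also have "\<dots> < \<infinity>" by simp
  finally show ?thesis .
qed

lemma integrable_mult_bounded_tm:
  fixes f g :: "real^3 \<Rightarrow> real"
  assumes "integrable tm f" "g \<in> borel_measurable tm" "\<And>x. x \<in> torus3 \<Longrightarrow> \<bar>g x\<bar> \<le> C"
  shows "integrable tm (\<lambda>x. g x * f x)"
proof (rule Bochner_Integration.integrable_bound[of tm "\<lambda>x. C * f x"])
  show "AE x in tm. norm (g x * f x) \<le> norm (C * f x)"
  proof (rule AE_I2)
    fix x assume "x \<in> space tm"
    then have "\<bar>g x\<bar> \<le> \<bar>C\<bar>" using assms(3)[of x] by auto
    then show "norm (g x * f x) \<le> norm (C * f x)" by (simp add: abs_mult mult_right_mono)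
  qed
qed (use assms borel_measurable_integrable[OF assms(1)] in auto)

lemma L1_le_dispersion_form:
  "\<exists>I>0. \<forall>w. w \<in> borel_measurable tm \<longrightarrow> integrable tm (\<lambda>x. (w x)\<^sup>2) \<longrightarrow>
     (\<integral>x. \<bar>w x\<bar> \<partial>tm)\<^sup>2 \<le> I * (\<integral>x. dispersion x * (w x)\<^sup>2 \<partial>tm)"
proof -
  have m: "(\<lambda>x. 1 / dispersion x) \<in> borel_measurable tm" by measurable
  have i: "integrable tm (\<lambda>x. 1 / dispersion x)"
    by (rule integrableI_nonneg) (use nn_integral_inverse_dispersion m dispersion_nonneg in auto)
  define I where "I = (\<integral>x. 1 / dispersion x \<partial>tm)"
  have I0: "0 \<le> I" unfolding I_def using dispersion_nonneg by (intro integral_nonneg_AE) auto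
  show ?thesis
  proof (intro exI[of _ "I + 1"] conjI allI impI)
    show "I + 1 > 0" using I0 by simp
    fix w :: "real^3 \<Rightarrow> real" assume w [measurable]: "w \<in> borel_measurable tm" and w2: "integrable tm (\<lambda>x. (w x)\<^sup>2)"
    have w1: "integrable tm w" by (rule tm.square_integrable_imp_integrable[OF w w2])
    have iX: "integrable tm (\<lambda>x. dispersion x * (w x)\<^sup>2)"
      by (rule integrable_mult_bounded_tm[where C = 6, OF w2]) (use dispersion_nonneg dispersion_le in \<open>auto simp: abs_le_iff intro: order_trans[of _ 0]\<close>)
    define X a where "X = (\<integral>x. dispersion x * (w x)\<^sup>2 \<partial>tm)" and "a = (\<integral>x. \<bar>w x\<bar> \<partial>tm)"
    have X0: "0 \<le> X" unfolding X_def using dispersion_nonneg by (intro integral_nonneg_AE) auto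
    have a0: "0 \<le> a" unfolding a_def by (intro integral_nonneg_AE) auto
    have key: "2 * a \<le> t * X + I / t" if t: "t > 0" for t
    proof -
      have "(\<integral>x. 2 * \<bar>w x\<bar> \<partial>tm) \<le> (\<integral>x. t * (dispersion x * (w x)\<^sup>2) + (1 / dispersion x) / t \<partial>tm)"
      proof (rule integral_mono_AE)
        show "AE x in tm. 2 * \<bar>w x\<bar> \<le> t * (dispersion x * (w x)\<^sup>2) + (1 / dispersion x) / t"
          using AE_tm_nonzero AE_space
        proof eventually_elim
          case (elim x)
          then have d: "dispersion x > 0" by (intro dispersion_pos) auto
          have "0 \<le> (t * dispersion x * \<bar>w x\<bar> - 1)\<^sup>2" by simp
          then have "2 * \<bar>w x\<bar> * (t * dispersion x) \<le> (t * dispersion x * \<bar>w x\<bar>)\<^sup>2 + 1"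
            by (simp add: power2_eq_square algebra_simps)
          then have "2 * \<bar>w x\<bar> \<le> ((t * dispersion x * \<bar>w x\<bar>)\<^sup>2 + 1) / (t * dispersion x)"
            using d t by (simp add: pos_le_divide_eq)
          also have "\<dots> = t * (dispersion x * (w x)\<^sup>2) + (1 / dispersion x) / t"
            using d t by (simp add: power_mult_distrib power2_eq_square field_simps)
          finally show ?case .
        qed
        show "integrable tm (\<lambda>x. t * (dispersion x * (w x)\<^sup>2) + (1 / dispersion x) / t)"
          by (intro Bochner_Integration.integrable_add integrable_mult_right integrable_divide iX i)
      qed (use w1 in auto)
      also have "\<dots> = t * X + I / t"
        using Bochner_Integration.integral_add[OF integrable_mult_right[OF iX, of t] integrable_divide[OF i, of t]]
        by (simp only: X_def I_def integral_mult_right_zero integral_divide_zero)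
      finally show ?thesis using w1 by (simp add: a_def)
    qed
    show "a\<^sup>2 \<le> (I + 1) * X"
    proof (cases "a = 0")
      case True
      then show ?thesis using X0 I0 by simp
    next
      case False
      then have a: "a > 0" using a0 by simp
      have "X > 0"
      proof (rule ccontr)
        assume "\<not> X > 0"
        then have "X = 0" using X0 by simp
        then have "I * a + a * 2 \<le> 0" using key[of "(I + 1) / a"] a I0 by (simp add: field_simps)
        moreover have "0 \<le> I * a" using a I0 by simp
        ultimately show False using a by linarith
      qed
      then have "2 * a \<le> a + I * X / a" using key[of "a / X"] a by simp
      then have "a * a \<le> I * X" using a by (simp add: field_simps)
      then show ?thesis using X0 by (simp add: power2_eq_square algebra_simps)
    qed
  qed
qed

section \<open>The symbol of the reduced equation\<close>

lemma tm_square_integral: "integrable tm h \<Longrightarrow> integrable tm (\<lambda>x. (h x)\<^sup>2) \<Longrightarrow> (\<integral>x. h x \<partial>tm)\<^sup>2 \<le> (\<integral>x. (h x)\<^sup>2 \<partial>tm)"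
  for h :: "real^3 \<Rightarrow> real"
  using tm.variance_eq[of h] tm.variance_positive[of h] by simp

lemma continuous_on_integral_dominated_tm:
  fixes F :: "'b::{metric_space} \<Rightarrow> real^3 \<Rightarrow> real"
  assumes m: "\<And>t. t \<in> S \<Longrightarrow> F t \<in> borel_measurable tm"
    and c: "\<And>x. x \<in> torus3 \<Longrightarrow> continuous_on S (\<lambda>t. F t x)"
    and b: "\<And>t x. t \<in> S \<Longrightarrow> x \<in> torus3 \<Longrightarrow> \<bar>F t x\<bar> \<le> w x" and w: "integrable tm w"
  shows "continuous_on S (\<lambda>t. \<integral>x. F t x \<partial>tm)"
  unfolding continuous_on_sequentially
proof (intro allI ballI impI, unfold comp_def)
  fix X a assume a: "a \<in> S" and X: "(\<forall>n. X n \<in> S) \<and> X \<longlonglongrightarrow> a"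
  show "(\<lambda>n. \<integral>x. F (X n) x \<partial>tm) \<longlonglongrightarrow> (\<integral>x. F a x \<partial>tm)"
  proof (rule integral_dominated_convergence[where w = w])
    show "AE x in tm. (\<lambda>n. F (X n) x) \<longlonglongrightarrow> F a x"
    proof (rule AE_I2)
      fix x assume "x \<in> space tm"
      then show "(\<lambda>n. F (X n) x) \<longlonglongrightarrow> F a x"
        using c[of x] X a unfolding continuous_on_sequentially comp_def by auto
    qed
  qed (use m b a X w in auto)
qed

lemma continuous_on_integral_tm:
  fixes F :: "'b::{metric_space} \<Rightarrow> real^3 \<Rightarrow> real"
  assumes "\<And>t. t \<in> S \<Longrightarrow> F t \<in> borel_measurable tm"
    and "\<And>x. x \<in> torus3 \<Longrightarrow> continuous_on S (\<lambda>t. F t x)"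
    and "\<And>t x. t \<in> S \<Longrightarrow> x \<in> torus3 \<Longrightarrow> \<bar>F t x\<bar> \<le> C"
  shows "continuous_on S (\<lambda>t. \<integral>x. F t x \<partial>tm)"
  using assms by (intro continuous_on_integral_dominated_tm[where w = "\<lambda>_. C"]) auto

abbreviation emax :: "real \<Rightarrow> real" where
  "emax \<gamma> \<equiv> 12 + 6 * \<gamma>"

text \<open>A function \<open>u\<close> is the partial mean of an eigenfunction for \<open>- \<zeta>\<close> iff
  \<open>Dsym * u\<close> is the integral of \<open>kern\<close> against \<open>u\<close>. The remainder \<open>rem\<close> is of order \<open>1 / \<zeta>\<close> and
  \<open>kern = \<zeta> - total_energy + rem\<close>.\<close>

definition kern :: "real \<Rightarrow> real^3 \<Rightarrow> real \<Rightarrow> real^3 \<Rightarrow> real^3 \<Rightarrow> real" where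
  "kern \<gamma> K \<zeta> p q = \<zeta>\<^sup>2 / (total_energy \<gamma> K p q + \<zeta>)"

definition rem :: "real \<Rightarrow> real^3 \<Rightarrow> real \<Rightarrow> real^3 \<Rightarrow> real^3 \<Rightarrow> real" where
  "rem \<gamma> K \<zeta> p q = (total_energy \<gamma> K p q)\<^sup>2 / (total_energy \<gamma> K p q + \<zeta>)"

definition Dsym :: "real \<Rightarrow> real^3 \<Rightarrow> real \<Rightarrow> real \<Rightarrow> real^3 \<Rightarrow> real" where
  "Dsym \<gamma> K lam \<zeta> q = (\<integral>p. kern \<gamma> K \<zeta> p q \<partial>tm) - \<zeta>\<^sup>2 / lam"

lemma dispersion_minus: "dispersion (- x) = dispersion x"
  by (simp add: dispersion_def)

lemma dispersion_diff_lattice: "dispersion (x - lattice_vec n) = dispersion x"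
proof -
  have "cos (x $ i - 2 * pi * of_int (n $ i)) = cos (x $ i)" for i
    unfolding cos_diff by (simp only: cos_int_2pin sin_int_2pin)
  then show ?thesis by (simp add: dispersion_def)
qed

lemma dispersion_wrap: "dispersion (wrap x) = dispersion x"
  using wrap_lattice[of x] dispersion_diff_lattice by metis

lemma total_energy_sym: "total_energy \<gamma> K p q = total_energy \<gamma> K q p"
  by (simp add: total_energy_def algebra_simps)

lemma total_energy_wrap: "total_energy \<gamma> K p (wrap q) = total_energy \<gamma> K p q"
proof -
  obtain n where n: "wrap q = q - lattice_vec n" using wrap_lattice by blast
  have "dispersion (K - p - wrap q) = dispersion ((K - p - q) - lattice_vec (- n))"
    by (simp add: n lattice_minus algebra_simps)
  then show ?thesis by (simp add: total_energy_def dispersion_wrap dispersion_diff_lattice)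
qed

lemma total_energy_nonneg: "0 \<le> \<gamma> \<Longrightarrow> 0 \<le> total_energy \<gamma> K p q"
  by (simp add: total_energy_def dispersion_nonneg)

lemma total_energy_le: "0 \<le> \<gamma> \<Longrightarrow> total_energy \<gamma> K p q \<le> emax \<gamma>"
  using dispersion_le[of p] dispersion_le[of q] mult_left_mono[OF dispersion_le[of "K - p - q"], of \<gamma>]
  by (simp add: total_energy_def mult.commute)

lemma continuous_total_energy [continuous_intros]:
  fixes f g :: "'a::t2_space \<Rightarrow> real^3"
  shows "continuous_on S f \<Longrightarrow> continuous_on S g \<Longrightarrow> continuous_on S (\<lambda>x. total_energy \<gamma> K (f x) (g x))"
  unfolding total_energy_def by (intro continuous_intros)

lemma kern_decomp:
  assumes "0 \<le> \<gamma>" "0 < \<zeta>"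
  shows "kern \<gamma> K \<zeta> p q = \<zeta> - total_energy \<gamma> K p q + rem \<gamma> K \<zeta> p q"
proof -
  have "total_energy \<gamma> K p q + \<zeta> > 0" using total_energy_nonneg[OF assms(1), of K p q] assms(2) by linarith
  then show ?thesis unfolding kern_def rem_def by (simp add: field_simps power2_eq_square)
qed

lemma kern_sym: "kern \<gamma> K \<zeta> p q = kern \<gamma> K \<zeta> q p"
  by (simp add: kern_def total_energy_sym)

lemma rem_sym: "rem \<gamma> K \<zeta> p q = rem \<gamma> K \<zeta> q p"
  by (simp add: rem_def total_energy_sym)

lemma kern_nonneg: "0 \<le> \<gamma> \<Longrightarrow> 0 < \<zeta> \<Longrightarrow> 0 \<le> kern \<gamma> K \<zeta> p q"
  using total_energy_nonneg[of \<gamma> K p q] by (simp add: kern_def)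

lemma kern_le: "0 \<le> \<gamma> \<Longrightarrow> 0 < \<zeta> \<Longrightarrow> kern \<gamma> K \<zeta> p q \<le> \<zeta>"
  using total_energy_nonneg[of \<gamma> K p q] by (simp add: kern_def power2_eq_square divide_le_eq)

lemma kern_ge: "0 \<le> \<gamma> \<Longrightarrow> 0 < \<zeta> \<Longrightarrow> \<zeta>\<^sup>2 / (emax \<gamma> + \<zeta>) \<le> kern \<gamma> K \<zeta> p q"
  unfolding kern_def using total_energy_nonneg[of \<gamma> K p q] total_energy_le[of \<gamma> K p q]
  by (intro divide_left_mono mult_pos_pos) auto

lemma rem_nonneg: "0 \<le> \<gamma> \<Longrightarrow> 0 < \<zeta> \<Longrightarrow> 0 \<le> rem \<gamma> K \<zeta> p q"
  using total_energy_nonneg[of \<gamma> K p q] by (simp add: rem_def)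

lemma rem_le: "0 \<le> \<gamma> \<Longrightarrow> 0 < \<zeta> \<Longrightarrow> rem \<gamma> K \<zeta> p q \<le> (emax \<gamma>)\<^sup>2 / \<zeta>"
  unfolding rem_def using total_energy_nonneg[of \<gamma> K p q] total_energy_le[of \<gamma> K p q]
  by (intro frac_le power_mono) auto

lemma kern_abs_le: "0 \<le> \<gamma> \<Longrightarrow> 0 < \<zeta> \<Longrightarrow> \<bar>kern \<gamma> K \<zeta> p q\<bar> \<le> \<zeta>"
  using kern_nonneg[of \<gamma> \<zeta> K p q] kern_le[of \<gamma> \<zeta> K p q] by simp

lemma rem_abs_le: "0 \<le> \<gamma> \<Longrightarrow> 0 < \<zeta> \<Longrightarrow> \<bar>rem \<gamma> K \<zeta> p q\<bar> \<le> (emax \<gamma>)\<^sup>2 / \<zeta>"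
  using rem_nonneg[of \<gamma> \<zeta> K p q] rem_le[of \<gamma> \<zeta> K p q] by simp

lemma continuous_kern:
  fixes f g :: "'a::t2_space \<Rightarrow> real^3"
  assumes "0 \<le> \<gamma>" "0 < \<zeta>" "continuous_on S f" "continuous_on S g"
  shows "continuous_on S (\<lambda>x. kern \<gamma> K \<zeta> (f x) (g x))"
  unfolding kern_def using total_energy_nonneg[OF assms(1)] assms
  by (intro continuous_intros) (auto simp: add_nonneg_pos less_imp_neq[symmetric] intro!: less_imp_neq[symmetric] add_nonneg_pos)

lemma continuous_rem:
  fixes f g :: "'a::t2_space \<Rightarrow> real^3"
  assumes "0 \<le> \<gamma>" "0 < \<zeta>" "continuous_on S f" "continuous_on S g"
  shows "continuous_on S (\<lambda>x. rem \<gamma> K \<zeta> (f x) (g x))"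
  unfolding rem_def using total_energy_nonneg[OF assms(1)] assms
  by (intro continuous_intros) (auto intro!: less_imp_neq[symmetric] add_nonneg_pos)

lemma measurable_continuous_tm: "continuous_on UNIV f \<Longrightarrow> f \<in> borel_measurable tm"
  for f :: "real^3 \<Rightarrow> real"
  by (intro borel_measurable_tm borel_measurable_continuous_onI)

lemma measurable_kern: "0 \<le> \<gamma> \<Longrightarrow> 0 < \<zeta> \<Longrightarrow> (\<lambda>p. kern \<gamma> K \<zeta> p q) \<in> borel_measurable tm"
  by (intro measurable_continuous_tm continuous_kern continuous_intros)

lemma measurable_rem: "0 \<le> \<gamma> \<Longrightarrow> 0 < \<zeta> \<Longrightarrow> (\<lambda>p. rem \<gamma> K \<zeta> p q) \<in> borel_measurable tm"
  by (intro measurable_continuous_tm continuous_rem continuous_intros)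

lemma measurable_energy: "(\<lambda>p. total_energy \<gamma> K p q) \<in> borel_measurable tm"
  by (intro measurable_continuous_tm continuous_intros)

lemma integrable_kern: "0 \<le> \<gamma> \<Longrightarrow> 0 < \<zeta> \<Longrightarrow> integrable tm (\<lambda>p. kern \<gamma> K \<zeta> p q)"
  by (rule integrable_tm_bounded[OF measurable_kern, where C = \<zeta>]) (auto simp: kern_abs_le)

lemma integrable_rem: "0 \<le> \<gamma> \<Longrightarrow> 0 < \<zeta> \<Longrightarrow> integrable tm (\<lambda>p. rem \<gamma> K \<zeta> p q)"
  by (rule integrable_tm_bounded[OF measurable_rem, where C = "(emax \<gamma>)\<^sup>2 / \<zeta>"]) (auto simp: rem_abs_le)

lemma integral_dispersion: "(\<integral>p. dispersion (c - p) \<partial>tm) = 3"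
proof -
  have cc: "cos (c $ i - p $ i) = cos (p $ i + - c $ i)" for i and p :: "real^3"
    using cos_minus[of "c $ i - p $ i"] by (simp add: algebra_simps)
  have i: "integrable tm (\<lambda>p. cos (p $ i + - c $ i))" for i
    by (rule integrable_tm_bounded[where C = 1]) (auto intro!: borel_measurable_tm)
  have "(\<integral>p. dispersion (c - p) \<partial>tm) = (\<integral>p. (\<Sum>i\<in>UNIV. 1 - cos (p $ i + - c $ i)) \<partial>tm)"
    unfolding dispersion_def by (simp add: cc)
  also have "\<dots> = (\<Sum>i\<in>UNIV. (\<integral>p. 1 - cos (p $ i + - c $ i) \<partial>tm))"
    by (rule Bochner_Integration.integral_sum) (intro Bochner_Integration.integrable_diff i tm.integrable_const)
  also have "\<dots> = (\<Sum>i\<in>(UNIV::3 set). 1)"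
  proof (intro sum.cong refl)
    fix i :: 3
    show "(\<integral>p. 1 - cos (p $ i + - c $ i) \<partial>tm) = 1"
      using i[of i] integral_cos[of i "- c $ i"] tm.prob_space by (subst Bochner_Integration.integral_diff) auto
  qed
  finally show ?thesis by simp
qed

lemma integral_energy: "(\<integral>p. total_energy \<gamma> K p q \<partial>tm) = 3 + 3 * \<gamma> + dispersion q"
proof -
  have i: "integrable tm (\<lambda>p. dispersion (c - p))" for c
    by (rule integrable_tm_bounded[where C = 6])
      (auto intro!: measurable_continuous_tm continuous_intros simp: dispersion_nonneg dispersion_le abs_le_iff intro: order_trans[of _ 0])
  have e: "total_energy \<gamma> K p q = (dispersion (0 - p) + dispersion q) + \<gamma> * dispersion ((K - q) - p)" for p
    by (simp add: total_energy_def dispersion_minus algebra_simps)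
  have "(\<integral>p. total_energy \<gamma> K p q \<partial>tm) = (\<integral>p. dispersion (0 - p) + dispersion q \<partial>tm) + (\<integral>p. \<gamma> * dispersion ((K - q) - p) \<partial>tm)"
    unfolding e by (rule Bochner_Integration.integral_add) (intro Bochner_Integration.integrable_add integrable_mult_right i tm.integrable_const)+
  also have "(\<integral>p. dispersion (0 - p) + dispersion q \<partial>tm) = (\<integral>p. dispersion (0 - p) \<partial>tm) + (\<integral>p. dispersion q \<partial>tm)"
    by (rule Bochner_Integration.integral_add) (intro i tm.integrable_const)+
  finally show ?thesis unfolding integral_mult_right_zero integral_dispersion using tm.prob_space by simp
qed

lemma integrable_energy: "0 \<le> \<gamma> \<Longrightarrow> integrable tm (\<lambda>p. total_energy \<gamma> K p q)"
  by (rule integrable_tm_bounded[OF measurable_energy, where C = "emax \<gamma>"])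
    (simp add: total_energy_nonneg total_energy_le)

lemma Dsym_eq:
  assumes "0 \<le> \<gamma>" "0 < \<zeta>"
  shows "Dsym \<gamma> K lam \<zeta> q = \<zeta> - \<zeta>\<^sup>2 / lam - (3 + 3 * \<gamma> + dispersion q) + (\<integral>p. rem \<gamma> K \<zeta> p q \<partial>tm)"
proof -
  have "(\<integral>p. kern \<gamma> K \<zeta> p q \<partial>tm) = (\<integral>p. (\<zeta> - total_energy \<gamma> K p q) + rem \<gamma> K \<zeta> p q \<partial>tm)"
    by (simp add: kern_decomp assms)
  also have "\<dots> = (\<integral>p. \<zeta> - total_energy \<gamma> K p q \<partial>tm) + (\<integral>p. rem \<gamma> K \<zeta> p q \<partial>tm)"
    by (rule Bochner_Integration.integral_add)
      (intro Bochner_Integration.integrable_diff integrable_energy integrable_rem tm.integrable_const assms)+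
  also have "(\<integral>p. \<zeta> - total_energy \<gamma> K p q \<partial>tm) = \<zeta> - (3 + 3 * \<gamma> + dispersion q)"
    using tm.prob_space assms(1)
    by (subst Bochner_Integration.integral_diff) (auto simp: integral_energy intro!: integrable_energy)
  finally show ?thesis by (simp add: Dsym_def)
qed

lemma integral_rem_nonneg: "0 \<le> \<gamma> \<Longrightarrow> 0 < \<zeta> \<Longrightarrow> 0 \<le> (\<integral>p. rem \<gamma> K \<zeta> p q \<partial>tm)"
  by (rule integral_nonneg_AE) (simp add: rem_nonneg)

lemma integral_rem_le:
  assumes "0 \<le> \<gamma>" "0 < \<zeta>" shows "(\<integral>p. rem \<gamma> K \<zeta> p q \<partial>tm) \<le> (emax \<gamma>)\<^sup>2 / \<zeta>"
  by (rule tm.integral_le_const) (use integrable_rem rem_le assms in auto)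

lemma Dsym_wrap: "Dsym \<gamma> K lam \<zeta> (wrap q) = Dsym \<gamma> K lam \<zeta> q"
  by (simp add: Dsym_def kern_def total_energy_wrap)

lemma continuous_Dsym:
  assumes "0 \<le> \<gamma>" "0 < \<zeta>" shows "continuous_on UNIV (Dsym \<gamma> K lam \<zeta>)"
  unfolding Dsym_def
  by (intro continuous_on_diff continuous_on_const continuous_on_integral_tm[where C = \<zeta>] measurable_kern
      continuous_kern continuous_on_id kern_abs_le assms)

lemma continuous_Dsym_param:
  assumes "0 \<le> \<gamma>" "0 < a" "0 < lam" shows "continuous_on {a..b} (\<lambda>\<zeta>. Dsym \<gamma> K lam \<zeta> q)"
  unfolding Dsym_def
proof (intro continuous_on_diff continuous_on_integral_tm[where C = b] continuous_intros)
  fix p assume "p \<in> torus3"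
  show "continuous_on {a..b} (\<lambda>\<zeta>. kern \<gamma> K \<zeta> p q)"
    unfolding kern_def using assms total_energy_nonneg[OF assms(1), of K p q]
    by (intro continuous_intros) auto
next
  fix t p assume "t \<in> {a..b}"
  then show "\<bar>kern \<gamma> K t p q\<bar> \<le> b" using kern_abs_le[of \<gamma> t K p q] assms by auto
qed (use assms measurable_kern in auto)

text \<open>The function \<open>\<zeta> \<mapsto> Dsym \<gamma> K lam \<zeta> q / \<zeta>\<^sup>2\<close> is decreasing, since up to a constant it is the integral of
  \<open>1 / (total_energy \<gamma> K p q + \<zeta>)\<close>.\<close>

lemma Dsym_shift:
  assumes g: "0 \<le> \<gamma>" and z: "0 < \<zeta>" "\<zeta> \<le> \<zeta>'"
  shows "(\<zeta> / \<zeta>')\<^sup>2 * Dsym \<gamma> K lam \<zeta>' q + (\<zeta>' - \<zeta>) * \<zeta>\<^sup>2 / ((emax \<gamma> + \<zeta>) * (emax \<gamma> + \<zeta>')) \<le> Dsym \<gamma> K lam \<zeta> q"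
    and "Dsym \<gamma> K lam \<zeta> q \<le> (\<zeta> / \<zeta>')\<^sup>2 * Dsym \<gamma> K lam \<zeta>' q + (\<zeta>' - \<zeta>)"
proof -
  define J where "J p = kern \<gamma> K \<zeta> p q - (\<zeta> / \<zeta>')\<^sup>2 * kern \<gamma> K \<zeta>' p q" for p
  have z': "0 < \<zeta>'" using z by simp
  have J: "J p = (\<zeta>' - \<zeta>) * \<zeta>\<^sup>2 / ((total_energy \<gamma> K p q + \<zeta>) * (total_energy \<gamma> K p q + \<zeta>'))" for p
  proof -
    have "total_energy \<gamma> K p q + \<zeta> > 0" "total_energy \<gamma> K p q + \<zeta>' > 0"
      using total_energy_nonneg[OF g, of K p q] z z' by linarith+
    then show ?thesis unfolding J_def kern_def using z' by (simp add: field_simps power2_eq_square)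
  qed
  have iJ: "integrable tm J" unfolding J_def
    by (intro Bochner_Integration.integrable_diff integrable_mult_right integrable_kern g z z')
  have eq: "Dsym \<gamma> K lam \<zeta> q = (\<zeta> / \<zeta>')\<^sup>2 * Dsym \<gamma> K lam \<zeta>' q + (\<integral>p. J p \<partial>tm)"
  proof -
    have "(\<integral>p. J p \<partial>tm) = (\<integral>p. kern \<gamma> K \<zeta> p q \<partial>tm) - (\<zeta> / \<zeta>')\<^sup>2 * (\<integral>p. kern \<gamma> K \<zeta>' p q \<partial>tm)"
      unfolding J_def using integrable_kern[OF g z(1)] integrable_kern[OF g z'] by simp
    then show ?thesis using z' by (simp add: Dsym_def algebra_simps power_divide)
  qed
  have lo: "(\<zeta>' - \<zeta>) * \<zeta>\<^sup>2 / ((emax \<gamma> + \<zeta>) * (emax \<gamma> + \<zeta>')) \<le> J p" for p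
    unfolding J using total_energy_nonneg[OF g, of K p q] total_energy_le[OF g, of K p q] z
    by (intro divide_left_mono mult_mono mult_pos_pos mult_nonneg_nonneg) auto
  have hi: "J p \<le> \<zeta>' - \<zeta>" for p
  proof -
    have "\<zeta> * \<zeta> \<le> (total_energy \<gamma> K p q + \<zeta>) * (total_energy \<gamma> K p q + \<zeta>')"
      using total_energy_nonneg[OF g, of K p q] z by (intro mult_mono) auto
    then have "(\<zeta>' - \<zeta>) * \<zeta>\<^sup>2 \<le> (\<zeta>' - \<zeta>) * ((total_energy \<gamma> K p q + \<zeta>) * (total_energy \<gamma> K p q + \<zeta>'))"
      using z by (intro mult_left_mono) (auto simp: power2_eq_square)
    moreover have "(total_energy \<gamma> K p q + \<zeta>) * (total_energy \<gamma> K p q + \<zeta>') > 0"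
      using total_energy_nonneg[OF g, of K p q] z by (intro mult_pos_pos) auto
    ultimately show ?thesis unfolding J by (simp add: pos_divide_le_eq)
  qed
  show "(\<zeta> / \<zeta>')\<^sup>2 * Dsym \<gamma> K lam \<zeta>' q + (\<zeta>' - \<zeta>) * \<zeta>\<^sup>2 / ((emax \<gamma> + \<zeta>) * (emax \<gamma> + \<zeta>')) \<le> Dsym \<gamma> K lam \<zeta> q"
    unfolding eq using tm.integral_ge_const[OF iJ] lo by simp
  show "Dsym \<gamma> K lam \<zeta> q \<le> (\<zeta> / \<zeta>')\<^sup>2 * Dsym \<gamma> K lam \<zeta>' q + (\<zeta>' - \<zeta>)"
    unfolding eq using tm.integral_le_const[OF iJ] hi by simp
qed

lemma Dsym_root_exists:
  assumes g: "0 \<le> \<gamma>" and l: "emax \<gamma> < lam"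
  shows "\<exists>\<zeta>\<in>{lam - emax \<gamma>..lam}. Dsym \<gamma> K lam \<zeta> q = 0"
proof -
  let ?M = "emax \<gamma>"
  have "Dsym \<gamma> K lam lam q \<le> 0"
  proof -
    have "(\<integral>p. kern \<gamma> K lam p q \<partial>tm) \<le> lam"
      by (rule tm.integral_le_const) (use integrable_kern kern_le g l in auto)
    then show ?thesis using l g by (simp add: Dsym_def power2_eq_square)
  qed
  moreover have "0 \<le> Dsym \<gamma> K lam (lam - ?M) q"
  proof -
    have "(lam - ?M)\<^sup>2 / lam \<le> (\<integral>p. kern \<gamma> K (lam - ?M) p q \<partial>tm)"
      by (rule tm.integral_ge_const) (use integrable_kern kern_ge[OF g, of "lam - ?M"] g l in auto)
    then show ?thesis by (simp add: Dsym_def)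
  qed
  moreover have "continuous_on {lam - ?M..lam} (\<lambda>\<zeta>. Dsym \<gamma> K lam \<zeta> q)"
    using g l by (intro continuous_Dsym_param) auto
  ultimately show ?thesis
    using IVT2'[of "\<lambda>\<zeta>. Dsym \<gamma> K lam \<zeta> q" lam 0 "lam - ?M"] g by auto
qed

section \<open>The bottom of the two-particle spectrum\<close>

lemma L2_torusD:
  assumes "f \<in> L2 torus_measure"
  shows "f \<in> borel_measurable tm" "integrable tm (\<lambda>x. (cmod (f x))\<^sup>2)" "integrable tm f"
proof -
  have m: "f \<in> borel_measurable torus_measure" and i: "integrable torus_measure (\<lambda>x. (cmod (f x))\<^sup>2)"
    using assms by (auto simp: L2_def)
  show m': "f \<in> borel_measurable tm" using m by (simp add: measurable_tm_eq)
  have "(\<lambda>x. (cmod (f x))\<^sup>2) \<in> borel_measurable torus_measure" using m by measurable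
  then show i': "integrable tm (\<lambda>x. (cmod (f x))\<^sup>2)" using i by (simp add: integrable_tm)
  have "integrable tm (\<lambda>x. cmod (f x))"
    by (rule tm.square_integrable_imp_integrable) (use m' i' in auto)
  then show "integrable tm f" using m' by (simp add: integrable_norm_iff)
qed

lemma L2_torusI:
  assumes "f \<in> borel_measurable tm" "integrable tm (\<lambda>x. (cmod (f x))\<^sup>2)"
  shows "f \<in> L2 torus_measure"
proof -
  have m: "f \<in> borel_measurable torus_measure" using assms(1) by (simp add: measurable_tm_eq)
  then have "(\<lambda>x. (cmod (f x))\<^sup>2) \<in> borel_measurable torus_measure" by measurable
  then show ?thesis using m assms(2) by (simp add: L2_def integrable_tm)
qed

lemma L2_norm_torus:
  assumes "f \<in> borel_measurable tm"
  shows "L2_norm torus_measure f = sqrt ((2 * pi) ^ 3 * (\<integral>x. (cmod (f x))\<^sup>2 \<partial>tm))"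
proof -
  have "f \<in> borel_measurable torus_measure" using assms by (simp add: measurable_tm_eq)
  then have "(\<lambda>x. (cmod (f x))\<^sup>2) \<in> borel_measurable torus_measure" by measurable
  then show ?thesis by (simp add: L2_norm_def integral_tm)
qed

lemma integral_torus_tm:
  fixes f :: "real^3 \<Rightarrow> complex"
  assumes "f \<in> borel_measurable tm"
  shows "of_real (lam / (2 * pi) ^ 3) * (\<integral>x. f x \<partial>torus_measure) = of_real lam * (\<integral>x. f x \<partial>tm)"
proof -
  have "(\<integral>x. f x \<partial>tm) = (\<integral>x. f x \<partial>torus_measure) /\<^sub>R (2 * pi) ^ 3"
    using assms by (intro integral_tm) (simp add: measurable_tm_eq)
  then have "(\<integral>x. f x \<partial>tm) = of_real (1 / (2 * pi) ^ 3) * (\<integral>x. f x \<partial>torus_measure)"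
    by (simp only: scaleR_conv_of_real inverse_eq_divide)
  then have "of_real lam * (\<integral>x. f x \<partial>tm) = of_real (lam * (1 / (2 * pi) ^ 3)) * (\<integral>x. f x \<partial>torus_measure)"
    by (simp only: of_real_mult mult.assoc)
  then show ?thesis by simp
qed

text \<open>The resolvent of a rank one perturbation of a multiplication operator is explicit as long as
  \<open>1 - lam * (\<integral>x. 1 / (e x - z) \<partial>tm)\<close> does not vanish.\<close>

lemma Inf_spectrum_rank_one:
  fixes e :: "real^3 \<Rightarrow> real" and lam :: real
  defines "A \<equiv> \<lambda>f p. of_real (e p) * f p - of_real (lam / (2 * pi) ^ 3) * (\<integral>s. f s \<partial>torus_measure)"
  assumes e [measurable]: "e \<in> borel_measurable tm" and e0: "\<And>p. 0 \<le> e p" and eM: "\<And>p. e p \<le> M"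
    and lam: "lam > 0" and z0: "\<zeta> > 0" and root: "(\<integral>p. lam / (e p + \<zeta>) \<partial>tm) = 1"
  shows "Inf (Re ` spectrum torus_measure (L2 torus_measure) A) = - \<zeta>"
proof -
  let ?S = "L2 torus_measure"
  have Af: "A f = (\<lambda>p. of_real (e p) * f p - of_real lam * (\<integral>s. f s \<partial>tm))" if "f \<in> borel_measurable tm" for f
    unfolding A_def integral_torus_tm[OF that] ..
  have bdd: "integrable tm (\<lambda>p. c / (e p + t))" if "t > 0" for c t
  proof (rule integrable_tm_bounded[where C = "\<bar>c\<bar> / t"])
    fix x show "norm (c / (e x + t)) \<le> \<bar>c\<bar> / t"
      using e0[of x] that by (simp add: abs_divide frac_le)
  qed measurable
  have res: "z \<in> resolvent_set torus_measure ?S A" if z: "Re z < - \<zeta>" for z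
  proof -
    define t where "t = - Re z"
    have t: "t > \<zeta>" using z by (simp add: t_def)
    have nz: "cmod (of_real (e p) - z) \<ge> e p + t" for p
      using complex_Re_le_cmod[of "of_real (e p) - z"] by (simp add: t_def)
    have nz': "cmod (of_real (e p) - z) \<ge> \<zeta>" for p using nz[of p] e0[of p] t by linarith
    have ne: "of_real (e p) - z \<noteq> 0" for p using nz'[of p] z0 by auto
    define b where "b = (\<integral>p. 1 / (of_real (e p) - z) \<partial>tm)"
    have invle: "cmod (1 / (of_real (e p) - z)) \<le> 1 / \<zeta>" for p
      using nz'[of p] z0 by (simp add: norm_divide frac_le)
    have ib: "integrable tm (\<lambda>p. 1 / (of_real (e p) - z))"
      by (rule integrable_tm_bounded[where C = "1 / \<zeta>"]) (use invle in auto)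
    define \<kappa> where "\<kappa> = 1 - (\<integral>p. lam / (e p + t) \<partial>tm)"
    have \<kappa>_eq: "\<kappa> = (\<integral>p. lam / (e p + \<zeta>) - lam / (e p + t) \<partial>tm)"
      unfolding \<kappa>_def root[symmetric] by (rule Bochner_Integration.integral_diff[symmetric]) (use bdd z0 t in auto)
    have diff_ge: "lam * (t - \<zeta>) / ((M + \<zeta>) * (M + t)) \<le> lam / (e p + \<zeta>) - lam / (e p + t)" for p
    proof -
      have "lam / (e p + \<zeta>) - lam / (e p + t) = lam * (t - \<zeta>) / ((e p + \<zeta>) * (e p + t))"
        using e0[of p] z0 t by (simp add: field_simps)
      moreover have "lam * (t - \<zeta>) / ((M + \<zeta>) * (M + t)) \<le> lam * (t - \<zeta>) / ((e p + \<zeta>) * (e p + t))"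
        using e0[of p] eM[of p] z0 t lam by (intro divide_left_mono mult_mono mult_pos_pos mult_nonneg_nonneg) auto
      ultimately show ?thesis by simp
    qed
    have "integrable tm (\<lambda>p. lam / (e p + \<zeta>) - lam / (e p + t))"
      using z0 t by (intro Bochner_Integration.integrable_diff bdd) auto
    then have "lam * (t - \<zeta>) / ((M + \<zeta>) * (M + t)) \<le> \<kappa>"
      unfolding \<kappa>_eq by (rule tm.integral_ge_const) (use diff_ge in auto)
    moreover have "M \<ge> 0" using e0 eM order_trans by blast
    then have "0 < lam * (t - \<zeta>) / ((M + \<zeta>) * (M + t))"
      using lam t z0 by (intro divide_pos_pos mult_pos_pos) auto
    ultimately have \<kappa>: "\<kappa> > 0" by linarith
    have "cmod b \<le> (\<integral>p. cmod (1 / (of_real (e p) - z)) \<partial>tm)" unfolding b_def by simp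
    also have "\<dots> \<le> (\<integral>p. 1 / (e p + t) \<partial>tm)"
    proof (rule integral_mono)
      fix p show "cmod (1 / (of_real (e p) - z)) \<le> 1 / (e p + t)"
        using nz[of p] e0[of p] t z0 by (simp add: norm_divide frac_le)
    qed (use ib bdd t z0 in auto)
    finally have "lam * cmod b \<le> lam * (\<integral>p. 1 / (e p + t) \<partial>tm)" using lam by (intro mult_left_mono) auto
    also have "\<dots> = 1 - \<kappa>" unfolding \<kappa>_def by (simp flip: integral_mult_right_zero)
    finally have lb: "lam * cmod b \<le> 1 - \<kappa>" .
    have nb: "\<kappa> \<le> cmod (1 - of_real lam * b)"
      using norm_triangle_ineq2[of 1 "of_real lam * b"] lb lam by (simp add: norm_mult)
    define C where "C = (2 / \<zeta>\<^sup>2) * (1 + lam\<^sup>2 / (\<kappa> * \<zeta>)\<^sup>2)"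
    have C0: "C \<ge> 0" unfolding C_def by simp
    have bound: "L2_norm torus_measure f \<le> sqrt C * L2_norm torus_measure (\<lambda>x. A f x - z * f x)" if f: "f \<in> ?S" for f
    proof -
      note fm [measurable] = L2_torusD(1)[OF f] and f2 = L2_torusD(2)[OF f] and fi = L2_torusD(3)[OF f]
      define a where "a = (\<integral>s. f s \<partial>tm)"
      define g where "g = (\<lambda>x. A f x - z * f x)"
      have g: "g x = (of_real (e x) - z) * f x - of_real lam * a" for x
        by (simp add: g_def Af[OF fm] a_def algebra_simps)
      have gm [measurable]: "g \<in> borel_measurable tm" unfolding g by measurable
      have gle: "cmod (g x) \<le> (M + cmod z) * cmod (f x) + lam * cmod a" for x
      proof -
        have "cmod (g x) \<le> cmod (of_real (e x) - z) * cmod (f x) + lam * cmod a"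
          unfolding g using norm_triangle_ineq4[of "(of_real (e x) - z) * f x" "of_real lam * a"] lam by (simp add: norm_mult)
        also have "cmod (of_real (e x) - z) \<le> M + cmod z"
          using norm_triangle_ineq4[of "of_real (e x)" z] e0[of x] eM[of x] by simp
        finally show ?thesis by (simp add: mult_right_mono)
      qed
      have g2: "integrable tm (\<lambda>x. (cmod (g x))\<^sup>2)"
      proof (rule Bochner_Integration.integrable_bound)
        show "integrable tm (\<lambda>x. 2 * (M + cmod z)\<^sup>2 * (cmod (f x))\<^sup>2 + 2 * (lam * cmod a)\<^sup>2)"
          using f2 by auto
        show "AE x in tm. norm ((cmod (g x))\<^sup>2) \<le> norm (2 * (M + cmod z)\<^sup>2 * (cmod (f x))\<^sup>2 + 2 * (lam * cmod a)\<^sup>2)"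
        proof (rule AE_I2)
          fix x
          have "(cmod (g x))\<^sup>2 \<le> ((M + cmod z) * cmod (f x) + lam * cmod a)\<^sup>2"
            using gle[of x] by (intro power_mono) auto
          also have "\<dots> \<le> 2 * ((M + cmod z) * cmod (f x))\<^sup>2 + 2 * (lam * cmod a)\<^sup>2"
            using sum_squares_bound[of "(M + cmod z) * cmod (f x)" "lam * cmod a"] by (simp add: power2_sum)
          finally show "norm ((cmod (g x))\<^sup>2) \<le> norm (2 * (M + cmod z)\<^sup>2 * (cmod (f x))\<^sup>2 + 2 * (lam * cmod a)\<^sup>2)"
            by (simp add: power_mult_distrib)
        qed
      qed measurable
      have g1: "integrable tm (\<lambda>x. cmod (g x))"
        by (rule tm.square_integrable_imp_integrable) (use gm g2 in auto)
      have fg: "f x = (g x + of_real lam * a) / (of_real (e x) - z)" for x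
        unfolding g using ne[of x] by simp
      have ig: "integrable tm (\<lambda>x. g x / (of_real (e x) - z))"
      proof (rule Bochner_Integration.integrable_bound)
        show "integrable tm (\<lambda>x. (1 / \<zeta>) * cmod (g x))" using g1 by simp
        show "AE x in tm. norm (g x / (of_real (e x) - z)) \<le> norm ((1 / \<zeta>) * cmod (g x))"
        proof (rule AE_I2)
          fix x show "norm (g x / (of_real (e x) - z)) \<le> norm ((1 / \<zeta>) * cmod (g x))"
            using nz'[of x] z0 by (simp add: norm_divide frac_le)
        qed
      qed measurable
      have "a = (\<integral>x. g x / (of_real (e x) - z) + (of_real lam * a) * (1 / (of_real (e x) - z)) \<partial>tm)"
        unfolding a_def by (rule Bochner_Integration.integral_cong[OF refl]) (simp add: fg[unfolded a_def] add_divide_distrib)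
      also have "\<dots> = (\<integral>x. g x / (of_real (e x) - z) \<partial>tm) + (of_real lam * a) * b"
        unfolding b_def by (simp only: Bochner_Integration.integral_add[OF ig integrable_mult_right[OF ib]] integral_mult_right_zero)
      finally have "a * (1 - of_real lam * b) = (\<integral>x. g x / (of_real (e x) - z) \<partial>tm)" by (simp add: algebra_simps)
      then have "cmod a * cmod (1 - of_real lam * b) \<le> (\<integral>x. cmod (g x / (of_real (e x) - z)) \<partial>tm)"
        using integral_norm_bound[of tm "\<lambda>x. g x / (of_real (e x) - z)"] by (simp add: norm_mult[symmetric])
      also have "\<dots> \<le> (\<integral>x. (1 / \<zeta>) * cmod (g x) \<partial>tm)"
      proof (rule integral_mono)
        fix x show "cmod (g x / (of_real (e x) - z)) \<le> (1 / \<zeta>) * cmod (g x)"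
          using nz'[of x] z0 by (simp add: norm_divide frac_le)
      qed (use ig g1 in auto)
      finally have "cmod a * cmod (1 - of_real lam * b) \<le> (\<integral>x. cmod (g x) \<partial>tm) / \<zeta>" by simp
      moreover have "cmod a * \<kappa> \<le> cmod a * cmod (1 - of_real lam * b)" using nb by (rule mult_left_mono) simp
      ultimately have "cmod a * \<kappa> \<le> (\<integral>x. cmod (g x) \<partial>tm) / \<zeta>" by linarith
      then have "cmod a * (\<kappa> * \<zeta>) \<le> (\<integral>x. cmod (g x) \<partial>tm)" using z0 by (simp add: field_simps)
      then have "(cmod a * (\<kappa> * \<zeta>))\<^sup>2 \<le> (\<integral>x. cmod (g x) \<partial>tm)\<^sup>2" using \<kappa> z0 by (intro power_mono) auto
      also have "\<dots> \<le> (\<integral>x. (cmod (g x))\<^sup>2 \<partial>tm)" by (rule tm_square_integral[OF g1 g2])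
      finally have a2: "(cmod a)\<^sup>2 \<le> (\<integral>x. (cmod (g x))\<^sup>2 \<partial>tm) / (\<kappa> * \<zeta>)\<^sup>2"
        using \<kappa> z0 by (simp add: power_mult_distrib pos_le_divide_eq)
      have pt: "(cmod (f x))\<^sup>2 \<le> (2 / \<zeta>\<^sup>2) * (cmod (g x))\<^sup>2 + (2 / \<zeta>\<^sup>2) * (lam\<^sup>2 * (cmod a)\<^sup>2)" for x
      proof -
        have "cmod (f x) \<le> (cmod (g x) + lam * cmod a) / \<zeta>"
          unfolding fg norm_divide using nz'[of x] z0 lam norm_triangle_ineq[of "g x" "of_real lam * a"]
          by (intro frac_le) (auto simp: norm_mult)
        then have "(cmod (f x))\<^sup>2 \<le> ((cmod (g x) + lam * cmod a) / \<zeta>)\<^sup>2" by (intro power_mono) auto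
        also have "\<dots> \<le> (2 * (cmod (g x))\<^sup>2 + 2 * (lam * cmod a)\<^sup>2) / \<zeta>\<^sup>2"
          unfolding power_divide using sum_squares_bound[of "cmod (g x)" "lam * cmod a"]
          by (intro divide_right_mono) (auto simp: power2_sum)
        finally show ?thesis by (simp add: power_mult_distrib add_divide_distrib)
      qed
      have "(\<integral>x. (cmod (f x))\<^sup>2 \<partial>tm) \<le> (\<integral>x. (2 / \<zeta>\<^sup>2) * (cmod (g x))\<^sup>2 + (2 / \<zeta>\<^sup>2) * (lam\<^sup>2 * (cmod a)\<^sup>2) \<partial>tm)"
        using pt f2 g2 by (intro integral_mono) auto
      also have "\<dots> = (2 / \<zeta>\<^sup>2) * (\<integral>x. (cmod (g x))\<^sup>2 \<partial>tm) + (2 / \<zeta>\<^sup>2) * (lam\<^sup>2 * (cmod a)\<^sup>2)"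
        using g2 tm.prob_space by (subst Bochner_Integration.integral_add) auto
      also have "\<dots> \<le> (2 / \<zeta>\<^sup>2) * (\<integral>x. (cmod (g x))\<^sup>2 \<partial>tm) + (2 / \<zeta>\<^sup>2) * (lam\<^sup>2 * ((\<integral>x. (cmod (g x))\<^sup>2 \<partial>tm) / (\<kappa> * \<zeta>)\<^sup>2))"
        using a2 by (intro add_left_mono mult_left_mono) auto
      also have "\<dots> = C * (\<integral>x. (cmod (g x))\<^sup>2 \<partial>tm)" by (simp add: C_def algebra_simps)
      finally have fin: "(\<integral>x. (cmod (f x))\<^sup>2 \<partial>tm) \<le> C * (\<integral>x. (cmod (g x))\<^sup>2 \<partial>tm)" .
      have "L2_norm torus_measure f \<le> sqrt ((2 * pi) ^ 3 * (C * (\<integral>x. (cmod (g x))\<^sup>2 \<partial>tm)))"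
        unfolding L2_norm_torus[OF fm] using fin by (intro real_sqrt_le_mono mult_left_mono) auto
      also have "\<dots> = sqrt C * L2_norm torus_measure g"
        unfolding L2_norm_torus[OF gm] by (simp add: real_sqrt_mult)
      finally show ?thesis by (simp add: g_def)
    qed
    have onto: "\<exists>f\<in>?S. AE x in torus_measure. A f x - z * f x = g x" if g: "g \<in> ?S" for g
    proof -
      note gm [measurable] = L2_torusD(1)[OF g] and g2 = L2_torusD(2)[OF g] and gi = L2_torusD(3)[OF g]
      have ig: "integrable tm (\<lambda>x. g x / (of_real (e x) - z))"
      proof (rule Bochner_Integration.integrable_bound)
        show "integrable tm (\<lambda>x. (1 / \<zeta>) * cmod (g x))" using gi by simp
        show "AE x in tm. norm (g x / (of_real (e x) - z)) \<le> norm ((1 / \<zeta>) * cmod (g x))"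
        proof (rule AE_I2)
          fix x show "norm (g x / (of_real (e x) - z)) \<le> norm ((1 / \<zeta>) * cmod (g x))"
            using nz'[of x] z0 by (simp add: norm_divide frac_le)
        qed
      qed measurable
      define a where "a = (\<integral>x. g x / (of_real (e x) - z) \<partial>tm) / (1 - of_real lam * b)"
      define f where "f = (\<lambda>x. g x / (of_real (e x) - z) + (of_real lam * a) * (1 / (of_real (e x) - z)))"
      have fm [measurable]: "f \<in> borel_measurable tm" unfolding f_def by measurable
      have d0: "1 - of_real lam * b \<noteq> 0" using nb \<kappa> by auto
      have "(\<integral>x. f x \<partial>tm) = (\<integral>x. g x / (of_real (e x) - z) \<partial>tm) + (of_real lam * a) * b"
        unfolding b_def f_def by (simp only: Bochner_Integration.integral_add[OF ig integrable_mult_right[OF ib]] integral_mult_right_zero)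
      then have fa: "(\<integral>x. f x \<partial>tm) = a" using d0 by (simp add: a_def field_simps)
      have "integrable tm (\<lambda>x. (cmod (f x))\<^sup>2)"
      proof (rule Bochner_Integration.integrable_bound)
        show "integrable tm (\<lambda>x. (2 * (cmod (g x))\<^sup>2 + 2 * (lam * cmod a)\<^sup>2) / \<zeta>\<^sup>2)" using g2 by auto
        show "AE x in tm. norm ((cmod (f x))\<^sup>2) \<le> norm ((2 * (cmod (g x))\<^sup>2 + 2 * (lam * cmod a)\<^sup>2) / \<zeta>\<^sup>2)"
        proof (rule AE_I2)
          fix x
          have "f x = (g x + of_real lam * a) / (of_real (e x) - z)" by (simp add: f_def add_divide_distrib)
          then have "cmod (f x) \<le> (cmod (g x) + lam * cmod a) / \<zeta>"
            unfolding norm_divide using nz'[of x] z0 lam norm_triangle_ineq[of "g x" "of_real lam * a"]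
            by (simp only: norm_divide, intro frac_le) (auto simp: norm_mult)
          then have "(cmod (f x))\<^sup>2 \<le> ((cmod (g x) + lam * cmod a) / \<zeta>)\<^sup>2" by (intro power_mono) auto
          also have "\<dots> \<le> (2 * (cmod (g x))\<^sup>2 + 2 * (lam * cmod a)\<^sup>2) / \<zeta>\<^sup>2"
            unfolding power_divide using sum_squares_bound[of "cmod (g x)" "lam * cmod a"]
            by (intro divide_right_mono) (auto simp: power2_sum)
          finally show "norm ((cmod (f x))\<^sup>2) \<le> norm ((2 * (cmod (g x))\<^sup>2 + 2 * (lam * cmod a)\<^sup>2) / \<zeta>\<^sup>2)"
            by simp
        qed
      qed measurable
      then have "f \<in> ?S" by (intro L2_torusI fm)
      moreover have "A f x - z * f x = g x" for x
      proof -
        have "f x = (g x + of_real lam * a) / (of_real (e x) - z)" by (simp add: f_def add_divide_distrib)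
        then have "(of_real (e x) - z) * f x = g x + of_real lam * a" using ne[of x] by simp
        then show ?thesis by (simp add: Af[OF fm] fa algebra_simps)
      qed
      ultimately show ?thesis by (intro bexI[of _ f]) auto
    qed
    show ?thesis unfolding resolvent_set_def using bound onto by blast
  qed
  have eig: "- of_real \<zeta> \<in> spectrum torus_measure ?S A"
    unfolding spectrum_def
  proof
    assume "- of_real \<zeta> \<in> resolvent_set torus_measure ?S A"
    then obtain C where C: "\<And>f. f \<in> ?S \<Longrightarrow> L2_norm torus_measure f \<le> C * L2_norm torus_measure (\<lambda>x. A f x - (- of_real \<zeta>) * f x)"
      unfolding resolvent_set_def by blast
    define f where "f = (\<lambda>x. complex_of_real (1 / (e x + \<zeta>)))"
    have fm: "f \<in> borel_measurable tm" unfolding f_def by measurable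
    have f2: "integrable tm (\<lambda>x. (cmod (f x))\<^sup>2)"
    proof (rule integrable_tm_bounded[where C = "(1 / \<zeta>)\<^sup>2"])
      show "(\<lambda>x. (cmod (f x))\<^sup>2) \<in> borel_measurable tm" using fm by measurable
      fix x have "cmod (f x) \<le> 1 / \<zeta>" unfolding f_def norm_of_real using e0[of x] z0 by (simp add: frac_le)
      then show "norm ((cmod (f x))\<^sup>2) \<le> (1 / \<zeta>)\<^sup>2" unfolding real_norm_def abs_power2 by (intro power_mono) auto
    qed
    have fS: "f \<in> ?S" by (rule L2_torusI[OF fm f2])
    have "lam * (\<integral>s. 1 / (e s + \<zeta>) \<partial>tm) = 1" using root by (simp flip: integral_mult_right_zero)
    then have "of_real lam * (\<integral>s. f s \<partial>tm) = 1" unfolding f_def integral_complex_of_real by (metis of_real_1 of_real_mult)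
    moreover have "(of_real (e x) + of_real \<zeta>) * f x = 1" for x
      unfolding f_def using e0[of x] z0 by (simp flip: of_real_add of_real_mult of_real_divide)
    ultimately have "A f x - (- of_real \<zeta>) * f x = 0" for x
      unfolding Af[OF fm] by (simp add: algebra_simps)
    then have "L2_norm torus_measure f \<le> 0" using C[OF fS] by (simp add: L2_norm_def)
    then have "(2 * pi) ^ 3 * (\<integral>x. (cmod (f x))\<^sup>2 \<partial>tm) \<le> 0" unfolding L2_norm_torus[OF fm] by simp
    then have "(\<integral>x. (cmod (f x))\<^sup>2 \<partial>tm) \<le> 0" by (metis mult_le_0_iff not_le pi_gt_zero zero_less_mult_iff zero_less_numeral zero_less_power)
    moreover have "(1 / (M + \<zeta>))\<^sup>2 \<le> (\<integral>x. (cmod (f x))\<^sup>2 \<partial>tm)"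
    proof (rule tm.integral_ge_const[OF f2], rule AE_I2)
      fix x have "1 / (M + \<zeta>) \<le> 1 / (e x + \<zeta>)" using e0[of x] eM[of x] z0 by (intro frac_le) auto
      moreover have "cmod (f x) = 1 / (e x + \<zeta>)" unfolding f_def norm_of_real using e0[of x] z0 by simp
      moreover have "0 \<le> 1 / (M + \<zeta>)" using e0[of x] eM[of x] z0 by simp
      ultimately show "(1 / (M + \<zeta>))\<^sup>2 \<le> (cmod (f x))\<^sup>2" by (simp only: power_mono)
    qed
    moreover have "M + \<zeta> > 0" using e0[of 0] eM[of 0] z0 by linarith
    ultimately show False by (smt (verit) zero_less_divide_1_iff zero_less_power)
  qed
  show ?thesis
  proof (rule cInf_eq_minimum)
    show "- \<zeta> \<in> Re ` spectrum torus_measure ?S A" using eig by (force intro: image_eqI[where x = "- of_real \<zeta>"])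
    fix x assume "x \<in> Re ` spectrum torus_measure ?S A"
    then obtain z where "x = Re z" "z \<notin> resolvent_set torus_measure ?S A" by (auto simp: spectrum_def)
    then show "- \<zeta> \<le> x" using res[of z] by force
  qed
qed

lemma z_inf_eq:
  assumes g: "0 \<le> \<gamma>" and l: "0 < lam" and z: "0 < \<zeta>" and D: "Dsym \<gamma> K lam \<zeta> q = 0"
  shows "z_inf \<gamma> lam K q = - \<zeta>"
  unfolding z_inf_def h_op_def
proof (rule Inf_spectrum_rank_one[OF measurable_energy total_energy_nonneg[OF g] total_energy_le[OF g] l z])
  have "(\<integral>p. lam / (total_energy \<gamma> K p q + \<zeta>) \<partial>tm) = (\<integral>p. lam / \<zeta>\<^sup>2 * kern \<gamma> K \<zeta> p q \<partial>tm)"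
    using z by (simp add: kern_def)
  also have "\<dots> = lam / \<zeta>\<^sup>2 * (\<integral>p. kern \<gamma> K \<zeta> p q \<partial>tm)" by simp
  also have "\<dots> = 1" using D z l by (simp add: Dsym_def)
  finally show "(\<integral>p. lam / (total_energy \<gamma> K p q + \<zeta>) \<partial>tm) = 1" .
qed

lemma tau_max_threshold:
  assumes g: "0 \<le> \<gamma>" and l: "emax \<gamma> < lam"
  shows "lam - emax \<gamma> \<le> - tau_max \<gamma> K lam" "- tau_max \<gamma> K lam \<le> lam"
    and "0 \<le> Dsym \<gamma> K lam (- tau_max \<gamma> K lam) q"
    and "\<exists>q. Dsym \<gamma> K lam (- tau_max \<gamma> K lam) q = 0"
proof -
  let ?M = "emax \<gamma>"
  define r where "r q = - z_inf \<gamma> lam K q" for q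
  have l0: "lam > 0" and lM: "lam - ?M > 0" using g l by auto
  have r: "r q \<in> {lam - ?M..lam}" "Dsym \<gamma> K lam (r q) q = 0" for q
  proof -
    obtain \<zeta> where \<zeta>: "\<zeta> \<in> {lam - ?M..lam}" "Dsym \<gamma> K lam \<zeta> q = 0" using Dsym_root_exists[OF g l] by blast
    have "\<zeta> > 0" using \<zeta>(1) lM by auto
    from z_inf_eq[OF g l0 this \<zeta>(2)] show "r q \<in> {lam - ?M..lam}" "Dsym \<gamma> K lam (r q) q = 0"
      using \<zeta> by (auto simp: r_def)
  qed
  have rpos: "r q > 0" for q using r(1)[of q] lM by auto
  have ne: "torus3 \<noteq> {}" using zero_in_torus3 by blast
  have bdd: "bdd_above (z_inf \<gamma> lam K ` torus3)"
  proof (rule bdd_aboveI2)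
    fix q show "z_inf \<gamma> lam K q \<le> - (lam - ?M)" using r(1)[of q] by (simp add: r_def)
  qed
  define t where "t = - tau_max \<gamma> K lam"
  have t_le: "t \<le> r q" if "q \<in> torus3" for q
    using cSUP_upper[OF that bdd] by (simp add: t_def r_def tau_max_def)
  have t_ge: "c \<le> t" if "\<And>q. q \<in> torus3 \<Longrightarrow> c \<le> r q" for c
    using cSUP_least[OF ne, of "z_inf \<gamma> lam K" "- c"] that by (force simp: t_def r_def tau_max_def)
  show t1: "lam - ?M \<le> - tau_max \<gamma> K lam" using t_ge[of "lam - ?M"] r(1) by (auto simp: t_def)
  show "- tau_max \<gamma> K lam \<le> lam" using t_le[OF zero_in_torus3] r(1)[of 0] by (auto simp: t_def)
  have tpos: "t > 0" using t1 lM by (simp add: t_def)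
  have nonneg': "0 \<le> Dsym \<gamma> K lam t q" if q: "q \<in> torus3" for q
  proof -
    have "0 \<le> (r q - t) * t\<^sup>2 / ((?M + t) * (?M + r q))"
      using t_le[OF q] tpos rpos[of q] g by (intro divide_nonneg_nonneg mult_nonneg_nonneg) auto
    then show ?thesis using Dsym_shift(1)[OF g tpos t_le[OF q], of K lam q] r(2)[of q] by simp
  qed
  then show "0 \<le> Dsym \<gamma> K lam (- tau_max \<gamma> K lam) q"
    using Dsym_wrap[of \<gamma> K lam t q] wrap_in[of q] by (metis t_def)
  have "compact (cbox (\<chi> i. - pi) (\<chi> i. pi) :: (real^3) set)" by simp
  moreover have "0 \<in> (cbox (\<chi> i. - pi) (\<chi> i. pi) :: (real^3) set)" by (simp add: mem_box_cart)
  moreover have "continuous_on (cbox (\<chi> i. - pi) (\<chi> i. pi) :: (real^3) set) (Dsym \<gamma> K lam t)"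
    using continuous_Dsym[OF g tpos] continuous_on_subset by blast
  ultimately obtain q0 where q0: "\<And>q. q \<in> cbox (\<chi> i. - pi) (\<chi> i. pi) \<Longrightarrow> Dsym \<gamma> K lam t q0 \<le> Dsym \<gamma> K lam t q"
    using continuous_attains_inf[of "cbox (\<chi> i. - pi) (\<chi> i. pi) :: (real^3) set" "Dsym \<gamma> K lam t"] by blast
  define m where "m = Dsym \<gamma> K lam t q0"
  have m: "m \<le> Dsym \<gamma> K lam t q" if "q \<in> torus3" for q
    using that by (auto simp: m_def torus3_def mem_box_cart less_imp_le intro!: q0)
  have m0: "0 \<le> m" using nonneg'[OF wrap_in[of q0]] Dsym_wrap[of \<gamma> K lam t q0] by (simp add: m_def)
  have "m = 0"
  proof (rule ccontr)
    assume "m \<noteq> 0"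
    then have mp: "m > 0" using m0 by simp
    have "t + m \<le> r q" if q: "q \<in> torus3" for q
    proof (rule ccontr)
      assume c: "\<not> t + m \<le> r q"
      have "Dsym \<gamma> K lam t q \<le> (t / r q)\<^sup>2 * Dsym \<gamma> K lam (r q) q + (r q - t)"
        by (rule Dsym_shift(2)[OF g tpos t_le[OF q]])
      then show False using c m[OF q] r(2)[of q] by simp
    qed
    from t_ge[OF this] mp show False by simp
  qed
  then show "\<exists>q. Dsym \<gamma> K lam (- tau_max \<gamma> K lam) q = 0" by (intro exI[of _ q0]) (simp add: m_def t_def)
qed

section \<open>Absence of solutions below the critical coupling\<close>

text \<open>By the addition theorem, \<open>\<Sum>i. cos (K\<^sub>i - p\<^sub>i - q\<^sub>i)\<close> is the sum over \<open>j\<close> of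
  \<open>sg j * phi K (Some j) p * phi K (Some j) q\<close>; the index \<open>None\<close> stands for the constants, to
  which solutions are orthogonal.\<close>

definition phi :: "real^3 \<Rightarrow> (3 \<times> bool) option \<Rightarrow> real^3 \<Rightarrow> real" where
  "phi K j p = (case j of None \<Rightarrow> 1
     | Some (i, b) \<Rightarrow> if b then cos (p $ i + - K $ i / 2) else sin (p $ i + - K $ i / 2))"

definition sg :: "3 \<times> bool \<Rightarrow> real" where
  "sg j = (if snd j then 1 else - 1)"

definition coef :: "real^3 \<Rightarrow> (real^3 \<Rightarrow> real) \<Rightarrow> 3 \<times> bool \<Rightarrow> real" where
  "coef K w j = (\<integral>p. phi K (Some j) p * w p \<partial>tm)"

definition Vform :: "real^3 \<Rightarrow> (real^3 \<Rightarrow> real) \<Rightarrow> real" where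
  "Vform K w = (\<Sum>j\<in>UNIV. sg j * (coef K w j)\<^sup>2)"

definition L2R :: "(real^3 \<Rightarrow> real) set" where
  "L2R = {w \<in> borel_measurable tm. integrable tm (\<lambda>x. (w x)\<^sup>2)}"

lemma L2R_D: "w \<in> L2R \<Longrightarrow> w \<in> borel_measurable tm" "w \<in> L2R \<Longrightarrow> integrable tm (\<lambda>x. (w x)\<^sup>2)"
  and L2R_integrable: "w \<in> L2R \<Longrightarrow> integrable tm w"
  unfolding L2R_def by (auto intro: tm.square_integrable_imp_integrable)

lemma abs_phi_le: "\<bar>phi K j p\<bar> \<le> 1"
  by (auto simp: phi_def split: option.split)

lemma continuous_phi: "continuous_on UNIV (phi K j)"
proof (cases j)
  case None
  then have "phi K j = (\<lambda>_. 1)" by (auto simp: phi_def)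
  then show ?thesis by simp
next
  case (Some x)
  obtain i b where x: "x = (i, b)" by (cases x)
  have "phi K j = (if b then (\<lambda>p. cos (p $ i + - K $ i / 2)) else (\<lambda>p. sin (p $ i + - K $ i / 2)))"
    using Some x by (auto simp: phi_def)
  then show ?thesis by (auto intro!: continuous_intros)
qed

lemma measurable_phi: "phi K j \<in> borel_measurable tm"
  by (rule measurable_continuous_tm[OF continuous_phi])

lemma sum_3_bool: "(\<Sum>j\<in>UNIV. f j) = (\<Sum>i\<in>(UNIV::3 set). f (i, True) + f (i, False))" for f :: "3 \<times> bool \<Rightarrow> real"
proof -
  have "(\<Sum>j\<in>UNIV. f j) = (\<Sum>(i,b)\<in>UNIV \<times> UNIV. f (i, b))" by (simp add: UNIV_Times_UNIV)
  also have "\<dots> = (\<Sum>i\<in>UNIV. \<Sum>b\<in>UNIV. f (i, b))" by (rule sum.cartesian_product[symmetric])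
  finally show ?thesis by (simp add: UNIV_bool add.commute)
qed

lemma total_energy_phi:
  "total_energy \<gamma> K p q = dispersion p + dispersion q + 3 * \<gamma>
     - \<gamma> * (\<Sum>j\<in>UNIV. sg j * phi K (Some j) p * phi K (Some j) q)"
proof -
  have "cos (K $ i - p $ i - q $ i) = cos (p $ i + - K $ i / 2) * cos (q $ i + - K $ i / 2)
      - sin (p $ i + - K $ i / 2) * sin (q $ i + - K $ i / 2)" for i
  proof -
    have "cos (K $ i - p $ i - q $ i) = cos ((p $ i + - K $ i / 2) + (q $ i + - K $ i / 2))"
      by (subst cos_minus[symmetric]) (simp add: algebra_simps)
    then show ?thesis by (simp only: cos_add)
  qed
  then have "dispersion (K - p - q) = 3 - (\<Sum>j\<in>UNIV. sg j * phi K (Some j) p * phi K (Some j) q)"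
    unfolding sum_3_bool by (simp add: dispersion_def sg_def phi_def sum_subtractf)
  then show ?thesis unfolding total_energy_def by (simp only: right_diff_distrib)
qed

lemma integrable_phi_mult: "integrable tm w \<Longrightarrow> integrable tm (\<lambda>p. phi K j p * w p)"
  by (rule integrable_mult_bounded_tm[OF _ measurable_phi abs_phi_le])

lemma integrable_dispersion_mult: "integrable tm w \<Longrightarrow> integrable tm (\<lambda>p. dispersion p * w p)"
  by (rule integrable_mult_bounded_tm[where C = 6])
    (auto simp: dispersion_nonneg dispersion_le abs_le_iff intro: order_trans[of _ 0])

lemma integrable_rem_mult: "0 \<le> \<gamma> \<Longrightarrow> 0 < \<zeta> \<Longrightarrow> integrable tm w \<Longrightarrow> integrable tm (\<lambda>p. rem \<gamma> K \<zeta> p q * w p)"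
  by (rule integrable_mult_bounded_tm[OF _ measurable_rem rem_abs_le])

lemma integrable_kern_mult: "0 \<le> \<gamma> \<Longrightarrow> 0 < \<zeta> \<Longrightarrow> integrable tm w \<Longrightarrow> integrable tm (\<lambda>p. kern \<gamma> K \<zeta> p q * w p)"
  by (rule integrable_mult_bounded_tm[OF _ measurable_kern kern_abs_le])

definition Rop :: "real \<Rightarrow> real^3 \<Rightarrow> real \<Rightarrow> (real^3 \<Rightarrow> real) \<Rightarrow> real^3 \<Rightarrow> real" where
  "Rop \<gamma> K \<zeta> w q = (\<integral>p. rem \<gamma> K \<zeta> p q * w p \<partial>tm)"

lemma continuous_Rop:
  assumes "0 \<le> \<gamma>" "0 < \<zeta>" "integrable tm w"
  shows "continuous_on UNIV (Rop \<gamma> K \<zeta> w)"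
  unfolding Rop_def
proof (rule continuous_on_integral_dominated_tm[where w = "\<lambda>p. (emax \<gamma>)\<^sup>2 / \<zeta> * \<bar>w p\<bar>"])
  show "continuous_on UNIV (\<lambda>q. rem \<gamma> K \<zeta> p q * w p)" for p
    by (intro continuous_intros continuous_rem assms)
  show "\<bar>rem \<gamma> K \<zeta> p q * w p\<bar> \<le> (emax \<gamma>)\<^sup>2 / \<zeta> * \<bar>w p\<bar>" for p q
    unfolding abs_mult by (intro mult_right_mono rem_abs_le assms) simp
qed (use assms integrable_rem_mult[OF assms] in auto)

lemma abs_Rop_le:
  assumes "0 \<le> \<gamma>" "0 < \<zeta>" "integrable tm w"
  shows "\<bar>Rop \<gamma> K \<zeta> w q\<bar> \<le> (emax \<gamma>)\<^sup>2 / \<zeta> * (\<integral>p. \<bar>w p\<bar> \<partial>tm)"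
proof -
  have "\<bar>Rop \<gamma> K \<zeta> w q\<bar> \<le> (\<integral>p. \<bar>rem \<gamma> K \<zeta> p q * w p\<bar> \<partial>tm)"
    unfolding Rop_def by (rule integral_abs_bound)
  also have "\<dots> \<le> (\<integral>p. (emax \<gamma>)\<^sup>2 / \<zeta> * \<bar>w p\<bar> \<partial>tm)"
  proof (rule integral_mono)
    show "\<bar>rem \<gamma> K \<zeta> p q * w p\<bar> \<le> (emax \<gamma>)\<^sup>2 / \<zeta> * \<bar>w p\<bar>" for p
      unfolding abs_mult by (intro mult_right_mono rem_abs_le assms) simp
  qed (use assms integrable_rem_mult[OF assms] in auto)
  finally show ?thesis by simp
qed

lemma integral_kern_mult:
  assumes "0 \<le> \<gamma>" "0 < \<zeta>" "integrable tm w" "(\<integral>p. w p \<partial>tm) = 0"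
  shows "(\<integral>p. kern \<gamma> K \<zeta> p q * w p \<partial>tm) = - (\<integral>p. dispersion p * w p \<partial>tm)
     + \<gamma> * (\<Sum>j\<in>UNIV. sg j * coef K w j * phi K (Some j) q) + Rop \<gamma> K \<zeta> w q"
proof -
  let ?F = "\<lambda>p. (\<Sum>j\<in>UNIV. (sg j * phi K (Some j) q) * (phi K (Some j) p * w p))"
  have eq: "kern \<gamma> K \<zeta> p q * w p = ((\<zeta> - dispersion q - 3 * \<gamma>) * w p - dispersion p * w p)
      + \<gamma> * ?F p + rem \<gamma> K \<zeta> p q * w p" for p
    by (simp add: kern_decomp[OF assms(1,2)] total_energy_phi algebra_simps sum_distrib_left)
  have i1: "integrable tm (\<lambda>p. (\<zeta> - dispersion q - 3 * \<gamma>) * w p)" using assms by simp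
  have i2: "integrable tm ?F" by (intro Bochner_Integration.integrable_sum integrable_mult_right integrable_phi_mult assms)
  have F: "(\<integral>p. ?F p \<partial>tm) = (\<Sum>j\<in>UNIV. sg j * coef K w j * phi K (Some j) q)"
  proof -
    have "(\<integral>p. ?F p \<partial>tm) = (\<Sum>j\<in>UNIV. (\<integral>p. (sg j * phi K (Some j) q) * (phi K (Some j) p * w p) \<partial>tm))"
      by (intro Bochner_Integration.integral_sum integrable_mult_right integrable_phi_mult assms)
    also have "\<dots> = (\<Sum>j\<in>UNIV. sg j * coef K w j * phi K (Some j) q)"
      by (simp only: integral_mult_right_zero) (simp only: coef_def mult_ac)
    finally show ?thesis .
  qed
  show ?thesis unfolding eq Rop_def
    by (simp only: Bochner_Integration.integral_add Bochner_Integration.integral_diff Bochner_Integration.integrable_add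
        Bochner_Integration.integrable_diff integrable_mult_right i1 i2 integrable_dispersion_mult[OF assms(3)]
        integrable_rem_mult[OF assms(1-3)] integral_mult_right_zero F assms(4) mult_zero_right diff_0)
qed

lemma integrable_pair_tm:
  fixes k :: "real^3 \<Rightarrow> real^3 \<Rightarrow> real"
  assumes k: "continuous_on UNIV (\<lambda>x. k (fst x) (snd x))" "\<And>p q. \<bar>k p q\<bar> \<le> C"
    and U: "integrable tm U" and V: "integrable tm V"
  shows "integrable (tm \<Otimes>\<^sub>M tm) (\<lambda>x. k (fst x) (snd x) * (U (fst x) * V (snd x)))"
proof -
  have [measurable]: "U \<in> borel_measurable tm" "V \<in> borel_measurable tm" using U V by auto
  have id: "(\<lambda>x. x) \<in> borel_measurable tm" by (rule borel_measurable_tm) simp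
  have km [measurable]: "(\<lambda>x. k (fst x) (snd x)) \<in> borel_measurable (tm \<Otimes>\<^sub>M tm)"
    by (rule borel_measurable_continuous_Pair[OF _ _ k(1)])
      (rule measurable_compose[OF measurable_fst id] measurable_compose[OF measurable_snd id])+
  have UV: "integrable (tm \<Otimes>\<^sub>M tm) (\<lambda>x. U (fst x) * V (snd x))"
  proof (rule tm2.Fubini_integrable)
    show "integrable tm (\<lambda>x. \<integral>y. norm (U (fst (x, y)) * V (snd (x, y))) \<partial>tm)"
      using U by (simp add: abs_mult)
    show "AE x in tm. integrable tm (\<lambda>y. U (fst (x, y)) * V (snd (x, y)))"
      using V by simp
  qed measurable
  show ?thesis
  proof (rule Bochner_Integration.integrable_bound)
    show "integrable (tm \<Otimes>\<^sub>M tm) (\<lambda>x. C * (U (fst x) * V (snd x)))" using UV by simp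
    show "AE x in tm \<Otimes>\<^sub>M tm. norm (k (fst x) (snd x) * (U (fst x) * V (snd x))) \<le> norm (C * (U (fst x) * V (snd x)))"
    proof (rule AE_I2)
      fix x
      have "\<bar>k (fst x) (snd x)\<bar> \<le> \<bar>C\<bar>" using k(2)[of "fst x" "snd x"] by simp
      then show "norm (k (fst x) (snd x) * (U (fst x) * V (snd x))) \<le> norm (C * (U (fst x) * V (snd x)))"
        by (simp add: abs_mult mult_right_mono)
    qed
  qed measurable
qed

lemma Fubini_tm:
  fixes k :: "real^3 \<Rightarrow> real^3 \<Rightarrow> real"
  assumes k: "continuous_on UNIV (\<lambda>x. k (fst x) (snd x))" "\<And>p q. \<bar>k p q\<bar> \<le> C"
    and U: "integrable tm U" and V: "integrable tm V"
  shows "(\<integral>q. V q * (\<integral>p. k p q * U p \<partial>tm) \<partial>tm) = (\<integral>p. U p * (\<integral>q. k p q * V q \<partial>tm) \<partial>tm)"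
proof -
  have "integrable (tm \<Otimes>\<^sub>M tm) (\<lambda>(p, q). k p q * (U p * V q))"
    using integrable_pair_tm[OF assms] by (simp only: case_prod_unfold)
  from tm2.Fubini_integral[OF this]
  have "(\<integral>q. \<integral>p. k p q * (U p * V q) \<partial>tm \<partial>tm) = (\<integral>p. \<integral>q. k p q * (U p * V q) \<partial>tm \<partial>tm)" .
  moreover have "(\<integral>p. k p q * (U p * V q) \<partial>tm) = V q * (\<integral>p. k p q * U p \<partial>tm)" for q
    by (simp flip: integral_mult_right_zero add: mult_ac)
  moreover have "(\<integral>q. k p q * (U p * V q) \<partial>tm) = U p * (\<integral>q. k p q * V q \<partial>tm)" for p
    by (simp flip: integral_mult_right_zero add: mult_ac)
  ultimately show ?thesis by simp
qed

lemma continuous_kern_pair: "0 \<le> \<gamma> \<Longrightarrow> 0 < \<zeta> \<Longrightarrow> continuous_on UNIV (\<lambda>x. kern \<gamma> K \<zeta> (fst x) (snd x))"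
  by (intro continuous_kern continuous_intros)

lemma continuous_rem_pair: "0 \<le> \<gamma> \<Longrightarrow> 0 < \<zeta> \<Longrightarrow> continuous_on UNIV (\<lambda>x. rem \<gamma> K \<zeta> (fst x) (snd x))"
  by (intro continuous_rem continuous_intros)

lemma abs_Dsym_le:
  assumes "0 \<le> \<gamma>" "0 < \<zeta>" "0 < lam" shows "\<bar>Dsym \<gamma> K lam \<zeta> q\<bar> \<le> \<zeta> + \<zeta>\<^sup>2 / lam"
proof -
  have "0 \<le> (\<integral>p. kern \<gamma> K \<zeta> p q \<partial>tm)" by (rule integral_nonneg_AE) (simp add: kern_nonneg assms)
  moreover have "(\<integral>p. kern \<gamma> K \<zeta> p q \<partial>tm) \<le> \<zeta>"
    by (rule tm.integral_le_const) (use integrable_kern kern_le assms in auto)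
  moreover have "0 \<le> \<zeta>\<^sup>2 / lam" using assms by simp
  ultimately show ?thesis unfolding Dsym_def by linarith
qed

lemma measurable_Dsym: "0 \<le> \<gamma> \<Longrightarrow> 0 < \<zeta> \<Longrightarrow> Dsym \<gamma> K lam \<zeta> \<in> borel_measurable tm"
  by (intro measurable_continuous_tm continuous_Dsym)

lemma integrable_Dsym_mult:
  "0 \<le> \<gamma> \<Longrightarrow> 0 < \<zeta> \<Longrightarrow> 0 < lam \<Longrightarrow> integrable tm w \<Longrightarrow> integrable tm (\<lambda>q. Dsym \<gamma> K lam \<zeta> q * w q)"
  by (rule integrable_mult_bounded_tm[OF _ measurable_Dsym abs_Dsym_le])

lemma mean_of_Dsym_mult:
  assumes "0 \<le> \<gamma>" "0 < \<zeta>" "0 < lam" "integrable tm U"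
  shows "(\<integral>q. Dsym \<gamma> K lam \<zeta> q * U q \<partial>tm) = (\<integral>q. \<integral>p. kern \<gamma> K \<zeta> p q * U p \<partial>tm \<partial>tm) - \<zeta>\<^sup>2 / lam * (\<integral>q. U q \<partial>tm)"
proof -
  have "(\<integral>q. 1 * (\<integral>p. kern \<gamma> K \<zeta> p q * U p \<partial>tm) \<partial>tm) = (\<integral>p. U p * (\<integral>q. kern \<gamma> K \<zeta> p q * 1 \<partial>tm) \<partial>tm)"
    by (rule Fubini_tm[OF continuous_kern_pair kern_abs_le]) (use assms in auto)
  also have "\<dots> = (\<integral>q. Dsym \<gamma> K lam \<zeta> q * U q + \<zeta>\<^sup>2 / lam * U q \<partial>tm)"
    unfolding Dsym_def by (simp add: kern_sym[of \<gamma> K \<zeta>] algebra_simps)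
  also have "\<dots> = (\<integral>q. Dsym \<gamma> K lam \<zeta> q * U q \<partial>tm) + \<zeta>\<^sup>2 / lam * (\<integral>q. U q \<partial>tm)"
    by (simp only: Bochner_Integration.integral_add integrable_Dsym_mult[OF assms] integrable_mult_right[OF assms(4)] integral_mult_right_zero)
  finally show ?thesis by simp
qed

lemma mean_zero:
  assumes "0 \<le> \<gamma>" "0 < \<zeta>" "0 < lam" "integrable tm U"
    and eq: "AE q in tm. Dsym \<gamma> K lam \<zeta> q * U q = (\<integral>p. kern \<gamma> K \<zeta> p q * U p \<partial>tm)"
  shows "(\<integral>q. U q \<partial>tm) = 0"
proof -
  have "(\<integral>q. Dsym \<gamma> K lam \<zeta> q * U q \<partial>tm) = (\<integral>q. \<integral>p. kern \<gamma> K \<zeta> p q * U p \<partial>tm \<partial>tm)"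
  proof (rule integral_cong_AE)
    show "(\<lambda>q. Dsym \<gamma> K lam \<zeta> q * U q) \<in> borel_measurable tm"
      using integrable_Dsym_mult[OF assms(1-4)] by auto
    have "continuous_on UNIV (\<lambda>q. \<integral>p. kern \<gamma> K \<zeta> p q * U p \<partial>tm)"
    proof (rule continuous_on_integral_dominated_tm[where w = "\<lambda>p. \<zeta> * \<bar>U p\<bar>"])
      show "continuous_on UNIV (\<lambda>q. kern \<gamma> K \<zeta> p q * U p)" for p
        by (intro continuous_intros continuous_kern assms)
      show "\<bar>kern \<gamma> K \<zeta> p q * U p\<bar> \<le> \<zeta> * \<bar>U p\<bar>" for p q
        unfolding abs_mult by (intro mult_right_mono kern_abs_le assms) simp
    qed (use assms integrable_kern_mult in auto)
    then show "(\<lambda>q. \<integral>p. kern \<gamma> K \<zeta> p q * U p \<partial>tm) \<in> borel_measurable tm" by (rule measurable_continuous_tm)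
  qed (rule eq)
  then show ?thesis using mean_of_Dsym_mult[OF assms(1-4), of K] assms by simp
qed

lemma Dsym_quadratic_le:
  assumes "0 \<le> \<gamma>" "0 < \<zeta>" "0 < lam" "U \<in> L2R"
    and eq: "AE q in tm. Dsym \<gamma> K lam \<zeta> q * U q = (\<integral>p. kern \<gamma> K \<zeta> p q * U p \<partial>tm)"
  shows "(\<integral>q. Dsym \<gamma> K lam \<zeta> q * (U q)\<^sup>2 \<partial>tm) \<le> \<gamma> * Vform K U + (emax \<gamma>)\<^sup>2 / \<zeta> * (\<integral>p. \<bar>U p\<bar> \<partial>tm)\<^sup>2"
proof -
  let ?B = "(emax \<gamma>)\<^sup>2 / \<zeta> * (\<integral>p. \<bar>U p\<bar> \<partial>tm)"
  have [measurable]: "U \<in> borel_measurable tm" and U2: "integrable tm (\<lambda>x. (U x)\<^sup>2)" and U1: "integrable tm U"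
    using L2R_D[OF assms(4)] L2R_integrable[OF assms(4)] by auto
  have z: "(\<integral>q. U q \<partial>tm) = 0" by (rule mean_zero[OF assms(1-3) U1 eq])
  define a where "a = (\<integral>p. dispersion p * U p \<partial>tm)"
  define G where "G q = (\<Sum>j\<in>UNIV. (\<gamma> * (sg j * coef K U j)) * (phi K (Some j) q * U q)) + (- a) * U q + ?B * \<bar>U q\<bar>" for q
  have iG: "integrable tm (\<lambda>q. \<Sum>j\<in>UNIV. (\<gamma> * (sg j * coef K U j)) * (phi K (Some j) q * U q))"
    by (intro Bochner_Integration.integrable_sum integrable_mult_right integrable_phi_mult U1)
  have i2: "integrable tm (\<lambda>q. (- a) * U q)" and i3: "integrable tm (\<lambda>q. ?B * \<bar>U q\<bar>)" using U1 by auto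
  have "(\<integral>q. Dsym \<gamma> K lam \<zeta> q * (U q)\<^sup>2 \<partial>tm) \<le> (\<integral>q. G q \<partial>tm)"
  proof (rule integral_mono_AE)
    show "integrable tm (\<lambda>q. Dsym \<gamma> K lam \<zeta> q * (U q)\<^sup>2)" by (rule integrable_Dsym_mult[OF assms(1-3) U2])
    show "integrable tm G" unfolding G_def by (intro Bochner_Integration.integrable_add iG i2 i3)
    show "AE q in tm. Dsym \<gamma> K lam \<zeta> q * (U q)\<^sup>2 \<le> G q"
      using eq
    proof eventually_elim
      case (elim q)
      have "Dsym \<gamma> K lam \<zeta> q * (U q)\<^sup>2 = (\<integral>p. kern \<gamma> K \<zeta> p q * U p \<partial>tm) * U q"
        using elim by (simp add: power2_eq_square flip: mult.assoc)
      also have "\<dots> = (\<Sum>j\<in>UNIV. (\<gamma> * (sg j * coef K U j)) * (phi K (Some j) q * U q)) + (- a) * U q + Rop \<gamma> K \<zeta> U q * U q"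
        unfolding integral_kern_mult[OF assms(1,2) U1 z] a_def
        by (simp add: algebra_simps sum_distrib_left sum_distrib_right)
      also have "Rop \<gamma> K \<zeta> U q * U q \<le> ?B * \<bar>U q\<bar>"
      proof -
        have "Rop \<gamma> K \<zeta> U q * U q \<le> \<bar>Rop \<gamma> K \<zeta> U q\<bar> * \<bar>U q\<bar>" by (simp flip: abs_mult)
        also have "\<dots> \<le> ?B * \<bar>U q\<bar>" by (intro mult_right_mono abs_Rop_le assms(1,2) U1) simp
        finally show ?thesis .
      qed
      finally show ?case unfolding G_def by simp
    qed
  qed
  also have "(\<integral>q. G q \<partial>tm) = (\<Sum>j\<in>UNIV. (\<gamma> * (sg j * coef K U j)) * coef K U j) + ?B * (\<integral>p. \<bar>U p\<bar> \<partial>tm)"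
  proof -
    have "(\<integral>q. (\<Sum>j\<in>UNIV. (\<gamma> * (sg j * coef K U j)) * (phi K (Some j) q * U q)) \<partial>tm)
        = (\<Sum>j\<in>UNIV. (\<integral>q. (\<gamma> * (sg j * coef K U j)) * (phi K (Some j) q * U q) \<partial>tm))"
      by (intro Bochner_Integration.integral_sum integrable_mult_right integrable_phi_mult U1)
    also have "\<dots> = (\<Sum>j\<in>UNIV. (\<gamma> * (sg j * coef K U j)) * coef K U j)"
      by (simp only: integral_mult_right_zero coef_def)
    finally show ?thesis unfolding G_def
      by (simp only: Bochner_Integration.integral_add[OF Bochner_Integration.integrable_add[OF iG i2] i3]
          Bochner_Integration.integral_add[OF iG i2] integral_mult_right_zero z mult_zero_right add_0_right)
  qed
  also have "\<dots> = \<gamma> * Vform K U + (emax \<gamma>)\<^sup>2 / \<zeta> * (\<integral>p. \<bar>U p\<bar> \<partial>tm)\<^sup>2"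
    by (simp add: Vform_def power2_eq_square sum_distrib_left mult_ac)
  finally show ?thesis .
qed

lemma abs_coef_le:
  assumes "integrable tm w" shows "\<bar>coef K w j\<bar> \<le> (\<integral>p. \<bar>w p\<bar> \<partial>tm)"
proof -
  have "\<bar>coef K w j\<bar> \<le> (\<integral>p. \<bar>phi K (Some j) p * w p\<bar> \<partial>tm)" unfolding coef_def by (rule integral_abs_bound)
  also have "\<dots> \<le> (\<integral>p. \<bar>w p\<bar> \<partial>tm)"
  proof (rule integral_mono)
    show "\<bar>phi K (Some j) p * w p\<bar> \<le> \<bar>w p\<bar>" for p
      unfolding abs_mult using mult_right_mono[OF abs_phi_le[of K "Some j" p], of "\<bar>w p\<bar>"] by simp
  qed (use assms integrable_phi_mult in auto)
  finally show ?thesis .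
qed

lemma coef_shift:
  assumes U: "integrable tm U" and w: "w = (\<lambda>v. U (wrap (v + a)))"
  shows "coef K U (i, True) = cos (a $ i) * coef K w (i, True) - sin (a $ i) * coef K w (i, False)"
    and "coef K U (i, False) = sin (a $ i) * coef K w (i, True) + cos (a $ i) * coef K w (i, False)"
proof -
  have wi: "integrable tm w" unfolding w by (rule integrable_wrap_shift[OF U])
  have t: "phi K (Some (i, True)) (wrap (v + a)) = cos (a $ i) * phi K (Some (i, True)) v - sin (a $ i) * phi K (Some (i, False)) v"
    and f: "phi K (Some (i, False)) (wrap (v + a)) = sin (a $ i) * phi K (Some (i, True)) v + cos (a $ i) * phi K (Some (i, False)) v" for v
  proof -
    have e: "(v + a) $ i + - K $ i / 2 = a $ i + (v $ i + - K $ i / 2)" by simp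
    note add = cos_add[of "a $ i" "v $ i + - K $ i / 2"] sin_add[of "a $ i" "v $ i + - K $ i / 2"]
    show "phi K (Some (i, True)) (wrap (v + a)) = cos (a $ i) * phi K (Some (i, True)) v - sin (a $ i) * phi K (Some (i, False)) v"
      unfolding phi_def by (simp only: option.case prod.case if_True if_False cos_wrap e add)
    show "phi K (Some (i, False)) (wrap (v + a)) = sin (a $ i) * phi K (Some (i, True)) v + cos (a $ i) * phi K (Some (i, False)) v"
      unfolding phi_def by (simp only: option.case prod.case if_True if_False sin_wrap e add)
  qed
  have m: "(\<lambda>p. phi K j p * U p) \<in> borel_measurable tm" for j
    using integrable_phi_mult[OF U] by auto
  have "coef K U (i, True) = (\<integral>v. phi K (Some (i, True)) (wrap (v + a)) * w v \<partial>tm)"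
    unfolding coef_def w by (rule integral_wrap_shift[OF m, symmetric])
  also have "\<dots> = (\<integral>v. cos (a $ i) * (phi K (Some (i, True)) v * w v) - sin (a $ i) * (phi K (Some (i, False)) v * w v) \<partial>tm)"
    unfolding t by (simp add: algebra_simps)
  finally show "coef K U (i, True) = cos (a $ i) * coef K w (i, True) - sin (a $ i) * coef K w (i, False)"
    unfolding coef_def by (simp only: Bochner_Integration.integral_diff integrable_mult_right integrable_phi_mult[OF wi] integral_mult_right_zero)
  have "coef K U (i, False) = (\<integral>v. phi K (Some (i, False)) (wrap (v + a)) * w v \<partial>tm)"
    unfolding coef_def w by (rule integral_wrap_shift[OF m, symmetric])
  also have "\<dots> = (\<integral>v. sin (a $ i) * (phi K (Some (i, True)) v * w v) + cos (a $ i) * (phi K (Some (i, False)) v * w v) \<partial>tm)"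
    unfolding f by (simp add: algebra_simps)
  finally show "coef K U (i, False) = sin (a $ i) * coef K w (i, True) + cos (a $ i) * coef K w (i, False)"
    unfolding coef_def by (simp only: Bochner_Integration.integral_add integrable_mult_right integrable_phi_mult[OF wi] integral_mult_right_zero)
qed

lemma rotation_difference_le:
  fixes x y c s A :: real
  assumes cs: "c\<^sup>2 + s\<^sup>2 = 1" and x: "\<bar>x\<bar> \<le> A" and y: "\<bar>y\<bar> \<le> A"
  shows "\<bar>((c * x - s * y)\<^sup>2 - (s * x + c * y)\<^sup>2) - (x\<^sup>2 - y\<^sup>2)\<bar> \<le> 6 * \<bar>s\<bar> * A\<^sup>2"
proof -
  have c2: "c\<^sup>2 = 1 - s\<^sup>2" using cs by simp
  have s1: "\<bar>s\<bar> \<le> 1" and c1: "\<bar>c\<bar> \<le> 1"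
    using cs zero_le_power2[of s] zero_le_power2[of c] unfolding abs_square_le_1[symmetric] by linarith+
  have "((c * x - s * y)\<^sup>2 - (s * x + c * y)\<^sup>2) - (x\<^sup>2 - y\<^sup>2) = (c\<^sup>2 - s\<^sup>2 - 1) * (x\<^sup>2 - y\<^sup>2) - 4 * s * c * (x * y)"
    by (simp add: power2_eq_square algebra_simps)
  also have "\<dots> = s * (- 2 * s * (x\<^sup>2 - y\<^sup>2) - 4 * c * (x * y))" unfolding c2 by (simp add: power2_eq_square algebra_simps)
  finally have e: "\<bar>((c * x - s * y)\<^sup>2 - (s * x + c * y)\<^sup>2) - (x\<^sup>2 - y\<^sup>2)\<bar> = \<bar>s\<bar> * \<bar>- 2 * s * (x\<^sup>2 - y\<^sup>2) - 4 * c * (x * y)\<bar>"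
    by (simp add: abs_mult)
  have x2: "x\<^sup>2 \<le> A\<^sup>2" "y\<^sup>2 \<le> A\<^sup>2" using x y by (auto simp: abs_le_square_iff[symmetric])
  have "\<bar>x\<^sup>2 - y\<^sup>2\<bar> \<le> A\<^sup>2" using x2 zero_le_power2[of x] zero_le_power2[of y] by linarith
  then have 1: "\<bar>s * (x\<^sup>2 - y\<^sup>2)\<bar> \<le> 1 * A\<^sup>2" unfolding abs_mult by (intro mult_mono s1) auto
  have "\<bar>x * y\<bar> \<le> A * A" unfolding abs_mult using x y by (intro mult_mono) auto
  then have 2: "\<bar>c * (x * y)\<bar> \<le> 1 * A\<^sup>2" unfolding abs_mult[of c] power2_eq_square using c1 by (intro mult_mono) auto
  have "\<bar>- 2 * s * (x\<^sup>2 - y\<^sup>2) - 4 * c * (x * y)\<bar> \<le> 6 * A\<^sup>2" using 1 2 by (simp add: mult.assoc)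
  then have "\<bar>s\<bar> * \<bar>- 2 * s * (x\<^sup>2 - y\<^sup>2) - 4 * c * (x * y)\<bar> \<le> \<bar>s\<bar> * (6 * A\<^sup>2)" by (rule mult_left_mono) simp
  then show ?thesis unfolding e by simp
qed

lemma Vform_shift:
  assumes U: "integrable tm U" and w: "w = (\<lambda>v. U (wrap (v + a)))" and s: "\<And>i. \<bar>sin (a $ i)\<bar> \<le> \<sigma>"
  shows "\<bar>Vform K U - Vform K w\<bar> \<le> 18 * \<sigma> * (\<integral>v. \<bar>w v\<bar> \<partial>tm)\<^sup>2"
proof -
  have wi: "integrable tm w" unfolding w by (rule integrable_wrap_shift[OF U])
  let ?A = "(\<integral>v. \<bar>w v\<bar> \<partial>tm)"
  have "Vform K U - Vform K w = (\<Sum>i\<in>UNIV. ((coef K U (i, True))\<^sup>2 - (coef K U (i, False))\<^sup>2) - ((coef K w (i, True))\<^sup>2 - (coef K w (i, False))\<^sup>2))"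
    unfolding Vform_def sum_3_bool by (simp add: sg_def sum_subtractf)
  also have "\<bar>\<dots>\<bar> \<le> (\<Sum>i\<in>(UNIV::3 set). 6 * \<sigma> * ?A\<^sup>2)"
  proof (rule order_trans[OF sum_abs sum_mono])
    fix i :: 3
    have "\<bar>((coef K U (i, True))\<^sup>2 - (coef K U (i, False))\<^sup>2) - ((coef K w (i, True))\<^sup>2 - (coef K w (i, False))\<^sup>2)\<bar> \<le> 6 * \<bar>sin (a $ i)\<bar> * ?A\<^sup>2"
      unfolding coef_shift[OF U w] by (rule rotation_difference_le) (auto simp: abs_coef_le[OF wi])
    also have "\<dots> \<le> 6 * \<sigma> * ?A\<^sup>2" using s[of i] by (intro mult_right_mono) auto
    finally show "\<bar>((coef K U (i, True))\<^sup>2 - (coef K U (i, False))\<^sup>2) - ((coef K w (i, True))\<^sup>2 - (coef K w (i, False))\<^sup>2)\<bar> \<le> 6 * \<sigma> * ?A\<^sup>2" .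
  qed
  finally show ?thesis by simp
qed

lemma Vform_le:
  assumes wi: "integrable tm w" shows "Vform K w \<le> 3 * (\<integral>v. \<bar>w v\<bar> \<partial>tm)\<^sup>2"
proof -
  have "Vform K w \<le> (\<Sum>i\<in>(UNIV::3 set). (\<integral>v. \<bar>w v\<bar> \<partial>tm)\<^sup>2)"
    unfolding Vform_def sum_3_bool
  proof (rule sum_mono)
    fix i :: 3
    have "(coef K w (i, True))\<^sup>2 \<le> (\<integral>v. \<bar>w v\<bar> \<partial>tm)\<^sup>2"
      using abs_coef_le[OF wi, of K "(i, True)"] by (simp add: abs_le_square_iff[symmetric])
    then have "(coef K w (i, True))\<^sup>2 - (coef K w (i, False))\<^sup>2 \<le> (\<integral>v. \<bar>w v\<bar> \<partial>tm)\<^sup>2"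
      using zero_le_power2[of "coef K w (i, False)"] by linarith
    then show "sg (i, True) * (coef K w (i, True))\<^sup>2 + sg (i, False) * (coef K w (i, False))\<^sup>2 \<le> (\<integral>v. \<bar>w v\<bar> \<partial>tm)\<^sup>2"
      by (simp add: sg_def)
  qed
  then show ?thesis by simp
qed

lemma linear_coefficient_zero:
  fixes a C :: real
  assumes "\<And>\<tau>. \<bar>\<tau>\<bar> \<le> 1 \<Longrightarrow> 0 \<le> \<tau> * a + C * \<tau>\<^sup>2"
  shows "a = 0"
proof (rule ccontr)
  assume "a \<noteq> 0"
  define d where "d = \<bar>a\<bar> / (\<bar>a\<bar> + \<bar>C\<bar> + 1)"
  have d: "0 < d" "d \<le> 1" "C * d < \<bar>a\<bar>"
  proof -
    show "0 < d" "d \<le> 1" using \<open>a \<noteq> 0\<close> by (auto simp: d_def field_simps)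
    have "C * d = \<bar>a\<bar> * (C / (\<bar>a\<bar> + \<bar>C\<bar> + 1))" by (simp add: d_def)
    also have "\<dots> < \<bar>a\<bar> * 1"
      using \<open>a \<noteq> 0\<close> by (intro mult_strict_left_mono) (auto simp: divide_less_eq)
    finally show "C * d < \<bar>a\<bar>" by simp
  qed
  have "0 \<le> (- sgn a * d) * a + C * (- sgn a * d)\<^sup>2" using d by (intro assms) (auto simp: abs_mult abs_sgn_eq)
  also have "(- sgn a * d) * a = - d * \<bar>a\<bar>" by (simp add: abs_sgn mult_ac)
  also have "(- sgn a * d)\<^sup>2 = d * d" using \<open>a \<noteq> 0\<close> by (simp add: power_mult_distrib power2_eq_square sgn_if)
  finally have "0 \<le> d * (C * d - \<bar>a\<bar>)" by (simp add: algebra_simps)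
  then show False using d by (simp add: zero_le_mult_iff)
qed

lemma abs_sin_minus_self': "\<bar>h\<bar> \<le> 4 \<Longrightarrow> \<bar>sin h - h\<bar> \<le> 2 / 3 * h\<^sup>2" for h :: real
proof -
  assume h: "\<bar>h\<bar> \<le> 4"
  have "\<bar>h\<bar> ^ 3 = \<bar>h\<bar> * h\<^sup>2" by (simp add: power3_eq_cube power2_eq_square)
  also have "\<dots> \<le> 4 * h\<^sup>2" using h by (rule mult_right_mono) simp
  finally show ?thesis using abs_sin_minus_self[of h] by simp
qed

lemma one_minus_cos_le: "1 - cos h \<le> h\<^sup>2 / 2" for h :: real
proof -
  have "\<bar>sin (h / 2)\<bar> \<le> \<bar>h / 2\<bar>" by (rule abs_sin_x_le_abs_x)
  then have "(sin (h / 2))\<^sup>2 \<le> (h / 2)\<^sup>2" by (simp add: abs_le_square_iff[symmetric])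
  then show ?thesis using cos_double_sin[of "h / 2"] by (simp add: power_divide)
qed

lemma cos_taylor: "\<bar>h\<bar> \<le> 4 \<Longrightarrow> \<bar>cos (x + h) - cos x + h * sin x\<bar> \<le> 2 * h\<^sup>2" for h x :: real
proof -
  assume h: "\<bar>h\<bar> \<le> 4"
  have "cos (x + h) - cos x + h * sin x = - (cos x * (1 - cos h)) - sin x * (sin h - h)"
    by (simp add: cos_add algebra_simps)
  also have "\<bar>\<dots>\<bar> \<le> \<bar>cos x * (1 - cos h)\<bar> + \<bar>sin x * (sin h - h)\<bar>" by linarith
  also have "\<dots> \<le> 1 * (h\<^sup>2 / 2) + 1 * (2 / 3 * h\<^sup>2)"
    unfolding abs_mult using one_minus_cos_le[of h] abs_sin_minus_self'[OF h]
    by (intro add_mono mult_mono) auto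
  also have "\<dots> \<le> 2 * h\<^sup>2" by simp
  finally show ?thesis .
qed

lemma cos_lipschitz: "\<bar>h\<bar> \<le> 4 \<Longrightarrow> \<bar>cos (x + h) - cos x\<bar> \<le> 9 * \<bar>h\<bar>" for h x :: real
proof -
  assume h: "\<bar>h\<bar> \<le> 4"
  have "\<bar>h * sin x\<bar> \<le> \<bar>h\<bar> * 1" unfolding abs_mult by (intro mult_left_mono) auto
  moreover have "h\<^sup>2 \<le> 4 * \<bar>h\<bar>" unfolding power2_eq_square using mult_right_mono[OF h, of "\<bar>h\<bar>"] by simp
  ultimately show ?thesis using cos_taylor[OF h, of x] by linarith
qed

definition sq :: "real^3 \<Rightarrow> real" where "sq v = (\<Sum>i\<in>UNIV. (v $ i)\<^sup>2)"

lemma sq_scale: "sq (t *\<^sub>R v) = t\<^sup>2 * sq v"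
  by (simp add: sq_def power_mult_distrib sum_distrib_left)

lemma sq_minus: "sq (- v) = sq v" by (simp add: sq_def)

lemma dispersion_taylor:
  assumes "\<And>i. \<bar>h $ i\<bar> \<le> 4"
  shows "\<bar>dispersion (x + h) - dispersion x - (\<Sum>i\<in>UNIV. h $ i * sin (x $ i))\<bar> \<le> 2 * sq h"
proof -
  have "dispersion (x + h) - dispersion x - (\<Sum>i\<in>UNIV. h $ i * sin (x $ i)) =
      - (\<Sum>i\<in>UNIV. cos (x $ i + h $ i) - cos (x $ i) + h $ i * sin (x $ i))"
    by (simp add: dispersion_def sum_subtractf sum.distrib sum_negf)
  also have "\<bar>\<dots>\<bar> \<le> (\<Sum>i\<in>UNIV. \<bar>cos (x $ i + h $ i) - cos (x $ i) + h $ i * sin (x $ i)\<bar>)"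
    by (simp only: abs_minus_cancel sum_abs)
  also have "\<dots> \<le> (\<Sum>i\<in>UNIV. 2 * (h $ i)\<^sup>2)" by (intro sum_mono cos_taylor assms)
  finally show ?thesis by (simp add: sq_def sum_distrib_left)
qed

lemma dispersion_lipschitz_sq:
  assumes "\<And>i. \<bar>h $ i\<bar> \<le> 4"
  shows "(dispersion (x + h) - dispersion x)\<^sup>2 \<le> 243 * sq h"
proof -
  have "\<bar>dispersion (x + h) - dispersion x\<bar> = \<bar>\<Sum>i\<in>UNIV. cos (x $ i + h $ i) - cos (x $ i)\<bar>"
    by (simp add: dispersion_def sum_subtractf abs_minus_commute)
  also have "\<dots> \<le> (\<Sum>i\<in>UNIV. 9 * \<bar>h $ i\<bar>)"
    by (intro order_trans[OF sum_abs sum_mono] cos_lipschitz assms)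
  finally have "(dispersion (x + h) - dispersion x)\<^sup>2 \<le> (\<Sum>i\<in>UNIV. 9 * \<bar>h $ i\<bar>)\<^sup>2"
    by (metis abs_ge_zero power2_abs power_mono)
  also have "\<dots> \<le> (\<Sum>i\<in>(UNIV::3 set). 9\<^sup>2) * (\<Sum>i\<in>UNIV. \<bar>h $ i\<bar>\<^sup>2)" by (rule Cauchy_Schwarz_ineq_sum)
  finally show ?thesis by (simp add: sq_def)
qed

text \<open>Taylor expansion of \<open>x\<^sup>2 / (x + t)\<close> at \<open>x\<close>; its derivative there is \<open>1 - t\<^sup>2 / (x + t)\<^sup>2\<close>.\<close>

lemma rem_function_taylor:
  fixes x y t :: real
  assumes "0 \<le> x" "0 \<le> y" "0 < t"
  shows "\<bar>y\<^sup>2 / (y + t) - x\<^sup>2 / (x + t) - (1 - t\<^sup>2 / (x + t)\<^sup>2) * (y - x)\<bar> \<le> (y - x)\<^sup>2 / t"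
    and "0 \<le> 1 - t\<^sup>2 / (x + t)\<^sup>2" and "1 - t\<^sup>2 / (x + t)\<^sup>2 \<le> 2 * x / t"
proof -
  have p: "x + t > 0" "y + t > 0" using assms by auto
  have id: "u\<^sup>2 / (u + t) = u - t + t\<^sup>2 / (u + t)" if "u + t > 0" for u
    using that by (simp add: field_simps power2_eq_square)
  have "y\<^sup>2 / (y + t) - x\<^sup>2 / (x + t) - (1 - t\<^sup>2 / (x + t)\<^sup>2) * (y - x) = t\<^sup>2 * (y - x)\<^sup>2 / ((x + t)\<^sup>2 * (y + t))"
  proof -
    have "t\<^sup>2 / (y + t) - t\<^sup>2 / (x + t) + t\<^sup>2 / (x + t)\<^sup>2 * (y - x) = t\<^sup>2 * (y - x)\<^sup>2 / ((x + t)\<^sup>2 * (y + t))"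
    proof -
      define a b where "a = x + t" and "b = y + t"
      have ab: "a > 0" "b > 0" and yx: "y - x = b - a" using p by (auto simp: a_def b_def)
      show ?thesis unfolding a_def[symmetric] b_def[symmetric] yx
        using ab by (simp add: field_simps power2_eq_square)
    qed
    then show ?thesis unfolding id[OF p(1)] id[OF p(2)] by (simp add: algebra_simps)
  qed
  moreover have "t\<^sup>2 * (y - x)\<^sup>2 / ((x + t)\<^sup>2 * (y + t)) \<le> t\<^sup>2 * (y - x)\<^sup>2 / (t\<^sup>2 * t)"
    using assms p by (intro divide_left_mono mult_mono power_mono mult_pos_pos) auto
  moreover have "0 \<le> t\<^sup>2 * (y - x)\<^sup>2 / ((x + t)\<^sup>2 * (y + t))" using p by simp
  moreover have "t\<^sup>2 * (y - x)\<^sup>2 / (t\<^sup>2 * t) = (y - x)\<^sup>2 / t" using assms by simp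
  ultimately show "\<bar>y\<^sup>2 / (y + t) - x\<^sup>2 / (x + t) - (1 - t\<^sup>2 / (x + t)\<^sup>2) * (y - x)\<bar> \<le> (y - x)\<^sup>2 / t" by linarith
  have "t\<^sup>2 \<le> (x + t)\<^sup>2" using assms by (intro power_mono) auto
  then show "0 \<le> 1 - t\<^sup>2 / (x + t)\<^sup>2" using p by simp
  define r where "r = t / (x + t)"
  have r: "0 \<le> r" "r \<le> 1" "1 - r = x / (x + t)" using assms p by (auto simp: r_def field_simps)
  have "1 - t\<^sup>2 / (x + t)\<^sup>2 = (1 - r) * (1 + r)" by (simp add: r_def power_divide power2_eq_square algebra_simps)
  also have "\<dots> \<le> (1 - r) * 2" using r by (intro mult_left_mono) auto
  also have "\<dots> \<le> 2 * x / t" unfolding r(3) using assms by (simp add: frac_le)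
  finally show "1 - t\<^sup>2 / (x + t)\<^sup>2 \<le> 2 * x / t" .
qed

definition taylor_const :: "real \<Rightarrow> real" where
  "taylor_const \<gamma> = 486 * (1 + \<gamma>\<^sup>2) + 4 * emax \<gamma> * (1 + \<gamma>)"

definition rem_lin :: "real \<Rightarrow> real^3 \<Rightarrow> real \<Rightarrow> real^3 \<Rightarrow> real^3 \<Rightarrow> real^3 \<Rightarrow> real" where
  "rem_lin \<gamma> K t q h p = (1 - t\<^sup>2 / (total_energy \<gamma> K p q + t)\<^sup>2) *
     ((\<Sum>i\<in>UNIV. h $ i * sin (q $ i)) + \<gamma> * (\<Sum>i\<in>UNIV. (- h) $ i * sin ((K - p - q) $ i)))"

lemma taylor_const_nonneg: "0 \<le> \<gamma> \<Longrightarrow> 0 \<le> taylor_const \<gamma>"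
  by (simp add: taylor_const_def)

lemma rem_lin_scale: "rem_lin \<gamma> K t q (\<tau> *\<^sub>R h) p = \<tau> * rem_lin \<gamma> K t q h p"
proof -
  have s: "(\<Sum>i\<in>UNIV. (\<tau> *\<^sub>R h) $ i * f i) = \<tau> * (\<Sum>i\<in>UNIV. h $ i * f i)" for h :: "real^3" and f
    by (simp add: sum_distrib_left mult.assoc)
  show ?thesis unfolding rem_lin_def scaleR_minus_right[symmetric] s
    by (simp only: distrib_left mult_ac)
qed

lemma rem_taylor:
  assumes g: "0 \<le> \<gamma>" and t: "0 < t" and h: "\<And>i. \<bar>h $ i\<bar> \<le> 4"
  shows "\<bar>rem \<gamma> K t p (q + h) - rem \<gamma> K t p q - rem_lin \<gamma> K t q h p\<bar> \<le> taylor_const \<gamma> / t * sq h"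
proof -
  define x y where "x = total_energy \<gamma> K p q" and "y = total_energy \<gamma> K p (q + h)"
  define e1 where "e1 = (\<Sum>i\<in>UNIV. h $ i * sin (q $ i)) + \<gamma> * (\<Sum>i\<in>UNIV. (- h) $ i * sin ((K - p - q) $ i))"
  define d1 d2 where "d1 = dispersion (q + h) - dispersion q"
    and "d2 = dispersion ((K - p - q) + (- h)) - dispersion (K - p - q)"
  have h': "\<And>i. \<bar>(- h) $ i\<bar> \<le> 4" using h by simp
  have yx: "y - x = d1 + \<gamma> * d2" unfolding x_def y_def total_energy_def d1_def d2_def by (simp add: algebra_simps)
  have xy0: "0 \<le> x" "0 \<le> y" unfolding x_def y_def by (auto intro: total_energy_nonneg g)
  have xM: "x \<le> emax \<gamma>" unfolding x_def by (rule total_energy_le[OF g])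
  have lin: "\<bar>(y - x) - e1\<bar> \<le> 2 * (1 + \<gamma>) * sq h"
  proof -
    have "\<bar>d1 - (\<Sum>i\<in>UNIV. h $ i * sin (q $ i))\<bar> \<le> 2 * sq h"
      unfolding d1_def by (rule dispersion_taylor[OF h])
    moreover have "\<bar>d2 - (\<Sum>i\<in>UNIV. (- h) $ i * sin ((K - p - q) $ i))\<bar> \<le> 2 * sq (- h)"
      unfolding d2_def by (rule dispersion_taylor[OF h'])
    then have "\<gamma> * \<bar>d2 - (\<Sum>i\<in>UNIV. (- h) $ i * sin ((K - p - q) $ i))\<bar> \<le> \<gamma> * (2 * sq h)"
      unfolding sq_minus using g by (rule mult_left_mono)
    then have "\<bar>\<gamma> * d2 - \<gamma> * (\<Sum>i\<in>UNIV. (- h) $ i * sin ((K - p - q) $ i))\<bar> \<le> \<gamma> * (2 * sq h)"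
      using g by (simp only: right_diff_distrib[symmetric] abs_mult abs_of_nonneg)
    ultimately have "\<bar>(y - x) - e1\<bar> \<le> 2 * sq h + \<gamma> * (2 * sq h)" unfolding yx e1_def by linarith
    then show ?thesis by (simp add: algebra_simps)
  qed
  have quad: "(y - x)\<^sup>2 \<le> 486 * (1 + \<gamma>\<^sup>2) * sq h"
  proof -
    have "d1\<^sup>2 \<le> 243 * sq h" unfolding d1_def by (rule dispersion_lipschitz_sq[OF h])
    moreover have d2: "d2\<^sup>2 \<le> 243 * sq h"
      using dispersion_lipschitz_sq[OF h', of "K - p - q"] unfolding d2_def sq_minus .
    then have "\<gamma>\<^sup>2 * d2\<^sup>2 \<le> \<gamma>\<^sup>2 * (243 * sq h)" by (rule mult_left_mono) simp
    moreover have "(d1 + \<gamma> * d2)\<^sup>2 \<le> 2 * d1\<^sup>2 + 2 * (\<gamma>\<^sup>2 * d2\<^sup>2)"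
      using sum_squares_bound[of d1 "\<gamma> * d2"] by (simp add: power2_sum power_mult_distrib)
    ultimately show ?thesis unfolding yx by (simp add: algebra_simps)
  qed
  let ?D = "1 - t\<^sup>2 / (x + t)\<^sup>2"
  have D: "0 \<le> ?D" "?D \<le> 2 * x / t" by (rule rem_function_taylor[OF xy0 t])+
  have "\<bar>y\<^sup>2 / (y + t) - x\<^sup>2 / (x + t) - ?D * (y - x)\<bar> \<le> (y - x)\<^sup>2 / t" by (rule rem_function_taylor[OF xy0 t])
  also have "\<dots> \<le> 486 * (1 + \<gamma>\<^sup>2) * sq h / t" using quad t by (intro divide_right_mono) auto
  finally have 1: "\<bar>y\<^sup>2 / (y + t) - x\<^sup>2 / (x + t) - ?D * (y - x)\<bar> \<le> 486 * (1 + \<gamma>\<^sup>2) * sq h / t" .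
  have "\<bar>?D * ((y - x) - e1)\<bar> = ?D * \<bar>(y - x) - e1\<bar>" using D(1) by (simp add: abs_mult)
  also have "\<dots> \<le> (2 * emax \<gamma> / t) * (2 * (1 + \<gamma>) * sq h)"
  proof (rule mult_mono)
    have "2 * x / t \<le> 2 * emax \<gamma> / t" using xM t by (intro divide_right_mono) auto
    then show "?D \<le> 2 * emax \<gamma> / t" using D(2) by linarith
  qed (use lin g t in auto)
  finally have "\<bar>?D * ((y - x) - e1)\<bar> \<le> (2 * emax \<gamma> / t) * (2 * (1 + \<gamma>) * sq h)" .
  then have 2: "\<bar>?D * ((y - x) - e1)\<bar> \<le> 4 * emax \<gamma> * (1 + \<gamma>) * sq h / t"
  proof -
    have "(2 * m / t) * (2 * (1 + \<gamma>) * s) = 4 * m * (1 + \<gamma>) * s / t" for m s by (simp add: field_simps)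
    then show ?thesis using \<open>\<bar>?D * ((y - x) - e1)\<bar> \<le> (2 * emax \<gamma> / t) * (2 * (1 + \<gamma>) * sq h)\<close> by metis
  qed
  have "y\<^sup>2 / (y + t) - x\<^sup>2 / (x + t) - ?D * e1 = (y\<^sup>2 / (y + t) - x\<^sup>2 / (x + t) - ?D * (y - x)) + ?D * ((y - x) - e1)"
  proof -
    have "a - b - c * e = (a - b - c * d) + c * (d - e)" for a b c d e :: real by (simp add: algebra_simps)
    then show ?thesis .
  qed
  then have "\<bar>y\<^sup>2 / (y + t) - x\<^sup>2 / (x + t) - ?D * e1\<bar> \<le> 486 * (1 + \<gamma>\<^sup>2) * sq h / t + 4 * emax \<gamma> * (1 + \<gamma>) * sq h / t"
    using 1 2 by linarith
  also have "\<dots> = taylor_const \<gamma> / t * sq h" by (simp add: taylor_const_def add_divide_distrib distrib_right)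
  finally show ?thesis unfolding rem_def rem_lin_def x_def[symmetric] y_def[symmetric] e1_def[symmetric] .
qed

lemma integral_rem_taylor:
  assumes g: "0 \<le> \<gamma>" and t: "0 < t" and h: "\<And>i. \<bar>h $ i\<bar> \<le> 4"
  shows "\<bar>(\<integral>p. rem \<gamma> K t p (q + h) \<partial>tm) - (\<integral>p. rem \<gamma> K t p q \<partial>tm) - (\<integral>p. rem_lin \<gamma> K t q h p \<partial>tm)\<bar>
     \<le> taylor_const \<gamma> / t * sq h"
proof -
  have ne: "total_energy \<gamma> K p q + t \<noteq> 0" for p using total_energy_nonneg[OF g, of K p q] t by linarith
  have c: "continuous_on UNIV (rem_lin \<gamma> K t q h)"
    unfolding rem_lin_def using ne by (intro continuous_intros) auto
  have i: "integrable tm (rem_lin \<gamma> K t q h)"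
  proof (rule integrable_tm_bounded[where C = "2 * ((emax \<gamma>)\<^sup>2 / t) + taylor_const \<gamma> / t * sq h"])
    show "rem_lin \<gamma> K t q h \<in> borel_measurable tm" by (rule measurable_continuous_tm[OF c])
    show "norm (rem_lin \<gamma> K t q h p) \<le> 2 * ((emax \<gamma>)\<^sup>2 / t) + taylor_const \<gamma> / t * sq h" for p
      using rem_taylor[OF g t h, of K p q] rem_abs_le[OF g t, of K p q] rem_abs_le[OF g t, of K p "q + h"]
      unfolding real_norm_def by linarith
  qed
  note ir = integrable_rem[OF g t]
  have eq: "(\<integral>p. rem \<gamma> K t p (q + h) \<partial>tm) - (\<integral>p. rem \<gamma> K t p q \<partial>tm) - (\<integral>p. rem_lin \<gamma> K t q h p \<partial>tm)
     = (\<integral>p. rem \<gamma> K t p (q + h) - rem \<gamma> K t p q - rem_lin \<gamma> K t q h p \<partial>tm)"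
    using ir i by simp
  have "(\<integral>p. \<bar>rem \<gamma> K t p (q + h) - rem \<gamma> K t p q - rem_lin \<gamma> K t q h p\<bar> \<partial>tm) \<le> taylor_const \<gamma> / t * sq h"
  proof (rule tm.integral_le_const)
    show "integrable tm (\<lambda>p. \<bar>rem \<gamma> K t p (q + h) - rem \<gamma> K t p q - rem_lin \<gamma> K t q h p\<bar>)"
      by (intro integrable_abs Bochner_Integration.integrable_diff ir i)
    show "AE p in tm. \<bar>rem \<gamma> K t p (q + h) - rem \<gamma> K t p q - rem_lin \<gamma> K t q h p\<bar> \<le> taylor_const \<gamma> / t * sq h"
      by (rule AE_I2) (rule rem_taylor[OF g t h])
  qed
  then show ?thesis unfolding eq by (rule order_trans[OF integral_abs_bound])
qed

lemma Dsym_near_minimum: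
  assumes g: "0 \<le> \<gamma>" and t: "0 < t" and zero: "Dsym \<gamma> K lam t q0 = 0"
    and nonneg: "\<And>q. 0 \<le> Dsym \<gamma> K lam t q" and v: "v \<in> torus3"
  defines "M \<equiv> (emax \<gamma>)\<^sup>2"
  shows "\<bar>sin (q0 $ i)\<bar> \<le> sqrt (2 * M / t)"
    and "(1 - M / t - 12 * sqrt (2 * M / t) - 18 * taylor_const \<gamma> / t) * dispersion v \<le> Dsym \<gamma> K lam t (v + q0)"
proof -
  define \<rho> where "\<rho> q = (\<integral>p. rem \<gamma> K t p q \<partial>tm)" for q
  have D: "Dsym \<gamma> K lam t q = t - t\<^sup>2 / lam - (3 + 3 * \<gamma> + dispersion q) + \<rho> q" for q
    unfolding \<rho>_def by (rule Dsym_eq[OF g t])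
  have \<rho>: "0 \<le> \<rho> q" "\<rho> q \<le> M / t" for q
    unfolding \<rho>_def M_def using integral_rem_nonneg[OF g t] integral_rem_le[OF g t] by auto
  have "dispersion (\<chi> i. pi) = 6" by (simp add: dispersion_def)
  then have "6 - dispersion q0 \<le> M / t"
    using nonneg[of "\<chi> i. pi"] zero \<rho>[of q0] \<rho>[of "\<chi> i. pi"] unfolding D by linarith
  moreover have "6 - dispersion q0 = (\<Sum>i\<in>UNIV. 1 + cos (q0 $ i))"
    by (simp add: dispersion_def sum.distrib sum_subtractf)
  moreover have pos: "0 \<le> 1 + cos (q0 $ i)" for i using cos_ge_minus_one[of "q0 $ i"] by linarith
  then have "1 + cos (q0 $ i) \<le> (\<Sum>i\<in>UNIV. 1 + cos (q0 $ i))" for i by (intro member_le_sum) auto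
  ultimately have cosq: "1 + cos (q0 $ i) \<le> M / t" for i by (metis order_trans)
  have sinq: "\<bar>sin (q0 $ i)\<bar> \<le> sqrt (2 * M / t)" for i
  proof -
    have "(sin (q0 $ i))\<^sup>2 = (1 - cos (q0 $ i)) * (1 + cos (q0 $ i))"
      using sin_cos_squared_add[of "q0 $ i"] by (simp add: power2_eq_square algebra_simps)
    also have "\<dots> \<le> 2 * (1 + cos (q0 $ i))" using pos[of i] cos_ge_minus_one[of "q0 $ i"] by (intro mult_right_mono) linarith+
    also have "\<dots> \<le> 2 * M / t" using cosq[of i] by simp
    finally have "sqrt ((sin (q0 $ i))\<^sup>2) \<le> sqrt (2 * M / t)" by (rule real_sqrt_le_mono)
    then show ?thesis by simp
  qed
  then show "\<bar>sin (q0 $ i)\<bar> \<le> sqrt (2 * M / t)" .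
  have vpi: "\<bar>v $ i\<bar> \<le> pi" for i using v by (auto simp: torus3_def abs_le_iff less_imp_le minus_le_iff)
  then have v4: "\<bar>v $ i\<bar> \<le> 4" for i using pi_less_4 by (meson less_imp_le order_trans)
  define L where "L = (\<integral>p. rem_lin \<gamma> K t q0 v p \<partial>tm)"
  define a where "a = L - (\<Sum>i\<in>UNIV. v $ i * sin (q0 $ i))"
  let ?B = "taylor_const \<gamma> / t"
  have "a = 0"
  proof (rule linear_coefficient_zero)
    fix \<tau> :: real assume \<tau>: "\<bar>\<tau>\<bar> \<le> 1"
    have h: "\<bar>(\<tau> *\<^sub>R v) $ i\<bar> \<le> 4" for i
      using mult_mono[OF \<tau> v4[of i]] by (simp add: abs_mult)
    have "\<bar>\<rho> (q0 + \<tau> *\<^sub>R v) - \<rho> q0 - \<tau> * L\<bar> \<le> ?B * (\<tau>\<^sup>2 * sq v)"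
      using integral_rem_taylor[OF g t h, of K q0] unfolding \<rho>_def L_def rem_lin_scale sq_scale by simp
    moreover have "\<bar>dispersion (q0 + \<tau> *\<^sub>R v) - dispersion q0 - \<tau> * (\<Sum>i\<in>UNIV. v $ i * sin (q0 $ i))\<bar> \<le> 2 * (\<tau>\<^sup>2 * sq v)"
      using dispersion_taylor[OF h, of q0] unfolding sq_scale by (simp add: sum_distrib_left mult.assoc)
    moreover have "0 \<le> (\<rho> (q0 + \<tau> *\<^sub>R v) - \<rho> q0) - (dispersion (q0 + \<tau> *\<^sub>R v) - dispersion q0)"
      using nonneg[of "q0 + \<tau> *\<^sub>R v"] zero unfolding D by linarith
    ultimately have "0 \<le> \<tau> * L - \<tau> * (\<Sum>i\<in>UNIV. v $ i * sin (q0 $ i)) + (?B * (\<tau>\<^sup>2 * sq v) + 2 * (\<tau>\<^sup>2 * sq v))" by linarith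
    then show "0 \<le> \<tau> * a + (?B * sq v + 2 * sq v) * \<tau>\<^sup>2" unfolding a_def by (simp add: algebra_simps)
  qed
  then have L: "L = (\<Sum>i\<in>UNIV. v $ i * sin (q0 $ i))" by (simp add: a_def)
  have "\<rho> (q0 + v) - \<rho> q0 \<ge> L - ?B * sq v"
    using integral_rem_taylor[OF g t v4, of K q0] unfolding \<rho>_def L_def by linarith
  then have "dispersion q0 - dispersion (q0 + v) + (\<Sum>i\<in>UNIV. v $ i * sin (q0 $ i)) - ?B * sq v \<le> Dsym \<gamma> K lam t (q0 + v)"
    using zero unfolding D L by linarith
  moreover have "dispersion q0 - dispersion (q0 + v) + (\<Sum>i\<in>UNIV. v $ i * sin (q0 $ i)) - ?B * sq v =
      (\<Sum>i\<in>UNIV. (cos (q0 $ i + v $ i) - cos (q0 $ i) + v $ i * sin (q0 $ i)) - ?B * (v $ i)\<^sup>2)"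
    by (simp add: dispersion_def sq_def sum.distrib sum_subtractf sum_distrib_left)
  moreover have "(\<Sum>i\<in>UNIV. (1 - M / t - 12 * sqrt (2 * M / t) - 18 * ?B) * (1 - cos (v $ i))) \<le>
     (\<Sum>i\<in>UNIV. (cos (q0 $ i + v $ i) - cos (q0 $ i) + v $ i * sin (q0 $ i)) - ?B * (v $ i)\<^sup>2)"
  proof (rule sum_mono)
    fix i :: 3
    let ?c = "1 - cos (v $ i)"
    have c0: "0 \<le> ?c" by simp
    have v2: "(v $ i)\<^sup>2 \<le> 18 * ?c" using one_minus_cos_ge[OF vpi[of i]] by simp
    have e: "cos (q0 $ i + v $ i) - cos (q0 $ i) + v $ i * sin (q0 $ i) = - cos (q0 $ i) * ?c - sin (q0 $ i) * (sin (v $ i) - v $ i)"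
      by (simp add: cos_add algebra_simps)
    have 1: "(1 - M / t) * ?c \<le> - cos (q0 $ i) * ?c" using cosq[of i] c0 by (intro mult_right_mono) linarith+
    have "sin (q0 $ i) * (sin (v $ i) - v $ i) \<le> \<bar>sin (q0 $ i)\<bar> * \<bar>sin (v $ i) - v $ i\<bar>" by (simp flip: abs_mult)
    also have "\<dots> \<le> sqrt (2 * M / t) * (12 * ?c)"
    proof (rule mult_mono[OF sinq])
      show "\<bar>sin (v $ i) - v $ i\<bar> \<le> 12 * ?c" using abs_sin_minus_self'[OF v4[of i]] v2 by linarith
    qed (use t in \<open>auto simp: M_def\<close>)
    finally have 2: "sin (q0 $ i) * (sin (v $ i) - v $ i) \<le> 12 * sqrt (2 * M / t) * ?c" by (simp only: mult_ac)
    have "?B * (v $ i)\<^sup>2 \<le> ?B * (18 * ?c)" using v2 taylor_const_nonneg[OF g] t by (intro mult_left_mono) auto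
    then have 3: "?B * (v $ i)\<^sup>2 \<le> 18 * ?B * ?c" by (simp only: mult_ac)
    have "(1 - M / t - 12 * sqrt (2 * M / t) - 18 * ?B) * ?c = (1 - M / t) * ?c - 12 * sqrt (2 * M / t) * ?c - 18 * ?B * ?c"
      by (simp only: left_diff_distrib)
    then show "(1 - M / t - 12 * sqrt (2 * M / t) - 18 * ?B) * ?c \<le>
       (cos (q0 $ i + v $ i) - cos (q0 $ i) + v $ i * sin (q0 $ i)) - ?B * (v $ i)\<^sup>2"
      unfolding e using 1 2 3 by linarith
  qed
  ultimately show "(1 - M / t - 12 * sqrt (2 * M / t) - 18 * taylor_const \<gamma> / t) * dispersion v \<le> Dsym \<gamma> K lam t (v + q0)"
    by (simp add: dispersion_def sum_distrib_left[symmetric] add.commute)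
qed

text \<open>Momenta are measured from \<open>(pi, pi, pi)\<close>, where \<open>6 - dispersion\<close> turns into \<open>dispersion\<close>; the form
  \<open>Vform K\<close> is invariant under this shift.\<close>

definition supercritical :: "real^3 \<Rightarrow> real set" where
  "supercritical K = {g. 0 < g \<and> (\<exists>w\<in>L2R. (\<integral>v. w v \<partial>tm) = 0 \<and> (\<integral>v. dispersion v * (w v)\<^sup>2 \<partial>tm) < g * Vform K w)}"

lemma L2R_wrap_shift: "U \<in> L2R \<Longrightarrow> (\<lambda>v. U (wrap (v + a))) \<in> L2R"
proof -
  assume U: "U \<in> L2R"
  then have [measurable]: "U \<in> borel_measurable tm" by (rule L2R_D)
  have "(\<lambda>v. U (wrap (v + a))) \<in> borel_measurable tm" by measurable
  moreover have "integrable tm (\<lambda>v. (U (wrap (v + a)))\<^sup>2)"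
    by (rule integrable_wrap_shift[OF L2R_D(2)[OF U]])
  ultimately show ?thesis by (simp add: L2R_def)
qed

lemma no_solution:
  assumes g: "0 < \<gamma>" and l: "emax \<gamma> < lam" and U: "U \<in> L2R"
    and \<zeta>: "0 < \<zeta>" "\<zeta> \<le> - tau_max \<gamma> K lam"
    and eq: "AE q in tm. Dsym \<gamma> K lam \<zeta> q * U q = (\<integral>p. kern \<gamma> K \<zeta> p q * U p \<partial>tm)"
    and I: "I > 0" "\<And>w. w \<in> L2R \<Longrightarrow> (\<integral>x. \<bar>w x\<bar> \<partial>tm)\<^sup>2 \<le> I * (\<integral>x. dispersion x * (w x)\<^sup>2 \<partial>tm)"
    and g': "0 < \<gamma>'" "\<gamma>' \<notin> supercritical K"
    and \<eta>: "0 < \<eta>" "\<eta> < 1 / 3" "\<gamma> / \<gamma>' + 2 * \<eta> * I < (1 - \<eta>)\<^sup>2 * (1 - 3 * \<eta>)"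
    and t: "t = - tau_max \<gamma> K lam" and M: "M = (emax \<gamma>)\<^sup>2"
    and small: "M / t \<le> \<eta>" "12 * sqrt (2 * M / t) \<le> \<eta>" "18 * taylor_const \<gamma> / t \<le> \<eta>"
      "18 * \<gamma> * sqrt (2 * M / t) \<le> \<eta>" "M / \<zeta> \<le> \<eta>" "1 - \<eta> \<le> \<zeta> / t"
  shows "AE q in tm. U q = 0"
proof -
  have g0: "0 \<le> \<gamma>" using g by simp
  have lam: "0 < lam" using g l by simp
  have tz: "\<zeta> \<le> t" "0 < t" using \<zeta> t by auto
  have nn: "0 \<le> Dsym \<gamma> K lam t q" for q using tau_max_threshold(3)[OF g0 l] t by simp
  obtain q0 where q0: "Dsym \<gamma> K lam t q0 = 0" using tau_max_threshold(4)[OF g0 l] t by auto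
  note near = Dsym_near_minimum[OF g0 tz(2) q0 nn, folded M]
  have Um [measurable]: "U \<in> borel_measurable tm" and U2: "integrable tm (\<lambda>x. (U x)\<^sup>2)" and U1: "integrable tm U"
    using L2R_D[OF U] L2R_integrable[OF U] by auto
  define w where "w = (\<lambda>v. U (wrap (v + q0)))"
  have w: "w \<in> L2R" unfolding w_def by (rule L2R_wrap_shift[OF U])
  have w2: "integrable tm (\<lambda>x. (w x)\<^sup>2)" and w1: "integrable tm w" using L2R_D[OF w] L2R_integrable[OF w] by auto
  have wm [measurable]: "w \<in> borel_measurable tm" by (rule L2R_D(1)[OF w])
  define X a where "X = (\<integral>v. dispersion v * (w v)\<^sup>2 \<partial>tm)" and "a = (\<integral>v. \<bar>w v\<bar> \<partial>tm)"
  have X0: "0 \<le> X" unfolding X_def by (intro integral_nonneg_AE) (simp add: dispersion_nonneg)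
  have aI: "a\<^sup>2 \<le> I * X" unfolding a_def X_def by (rule I(2)[OF w])
  have aU: "(\<integral>p. \<bar>U p\<bar> \<partial>tm) = a"
    unfolding a_def w_def by (rule integral_wrap_shift[symmetric]) measurable
  have "(\<integral>v. w v \<partial>tm) = (\<integral>v. U v \<partial>tm)" unfolding w_def by (rule integral_wrap_shift[OF Um])
  also have "\<dots> = 0" by (rule mean_zero[OF g0 \<zeta>(1) lam U1 eq])
  finally have "\<gamma>' * Vform K w \<le> X" using g' w unfolding supercritical_def X_def by force
  then have Vw: "\<gamma> * Vform K w \<le> \<gamma> / \<gamma>' * X"
    using g g'(1) mult_left_mono[of "\<gamma>' * Vform K w" X "\<gamma> / \<gamma>'"] by simp
  have VU: "Vform K U \<le> Vform K w + 18 * sqrt (2 * M / t) * a\<^sup>2"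
  proof -
    have "\<bar>Vform K U - Vform K w\<bar> \<le> 18 * sqrt (2 * M / t) * (\<integral>v. \<bar>w v\<bar> \<partial>tm)\<^sup>2"
      by (rule Vform_shift[OF U1 w_def near(1)[OF zero_in_torus3]])
    then show ?thesis unfolding a_def by linarith
  qed
  let ?\<theta> = "1 - M / t - 12 * sqrt (2 * M / t) - 18 * taylor_const \<gamma> / t"
  have \<theta>: "1 - 3 * \<eta> \<le> ?\<theta>" using small by linarith
  have c: "(1 - \<eta>)\<^sup>2 * (1 - 3 * \<eta>) \<le> (\<zeta> / t)\<^sup>2 * ?\<theta>"
    using \<eta> \<theta> small(6) by (intro mult_mono power_mono) auto
  have "(1 - \<eta>)\<^sup>2 * (1 - 3 * \<eta>) * X = (\<integral>v. (1 - \<eta>)\<^sup>2 * (1 - 3 * \<eta>) * (dispersion v * (w v)\<^sup>2) \<partial>tm)"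
    by (simp add: X_def)
  also have "\<dots> \<le> (\<integral>v. Dsym \<gamma> K lam \<zeta> (wrap (v + q0)) * (U (wrap (v + q0)))\<^sup>2 \<partial>tm)"
  proof (rule integral_mono)
    show "integrable tm (\<lambda>v. (1 - \<eta>)\<^sup>2 * (1 - 3 * \<eta>) * (dispersion v * (w v)\<^sup>2))"
      by (intro integrable_mult_right integrable_dispersion_mult w2)
    show "integrable tm (\<lambda>v. Dsym \<gamma> K lam \<zeta> (wrap (v + q0)) * (U (wrap (v + q0)))\<^sup>2)"
      by (rule integrable_wrap_shift[OF integrable_Dsym_mult[OF g0 \<zeta>(1) lam U2]])
    fix v assume "v \<in> space tm"
    then have v: "v \<in> torus3" by simp
    have "(1 - \<eta>)\<^sup>2 * (1 - 3 * \<eta>) * dispersion v \<le> (\<zeta> / t)\<^sup>2 * ?\<theta> * dispersion v"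
      using c dispersion_nonneg by (rule mult_right_mono)
    also have "\<dots> = (\<zeta> / t)\<^sup>2 * (?\<theta> * dispersion v)" by simp
    also have "\<dots> \<le> (\<zeta> / t)\<^sup>2 * Dsym \<gamma> K lam t (v + q0)" using near(2)[OF v] by (rule mult_left_mono) simp
    also have "\<dots> \<le> Dsym \<gamma> K lam \<zeta> (v + q0)"
    proof -
      have "0 \<le> (t - \<zeta>) * \<zeta>\<^sup>2 / ((emax \<gamma> + \<zeta>) * (emax \<gamma> + t))"
        using tz \<zeta>(1) g by (intro divide_nonneg_nonneg mult_nonneg_nonneg) auto
      then show ?thesis using Dsym_shift(1)[OF g0 \<zeta>(1) tz(1), of K lam "v + q0"] by linarith
    qed
    finally have "(1 - \<eta>)\<^sup>2 * (1 - 3 * \<eta>) * dispersion v * (w v)\<^sup>2 \<le> Dsym \<gamma> K lam \<zeta> (v + q0) * (w v)\<^sup>2"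
      by (rule mult_right_mono) simp
    then show "(1 - \<eta>)\<^sup>2 * (1 - 3 * \<eta>) * (dispersion v * (w v)\<^sup>2) \<le> Dsym \<gamma> K lam \<zeta> (wrap (v + q0)) * (U (wrap (v + q0)))\<^sup>2"
      by (simp add: Dsym_wrap w_def mult.assoc)
  qed
  also have "\<dots> = (\<integral>q. Dsym \<gamma> K lam \<zeta> q * (U q)\<^sup>2 \<partial>tm)"
    by (rule integral_wrap_shift) (use integrable_Dsym_mult[OF g0 \<zeta>(1) lam U2] in auto)
  also have "\<dots> \<le> \<gamma> * Vform K U + M / \<zeta> * a\<^sup>2"
    using Dsym_quadratic_le[OF g0 \<zeta>(1) lam U eq] unfolding M aU .
  also have "\<gamma> * Vform K U \<le> \<gamma> * (Vform K w + 18 * sqrt (2 * M / t) * a\<^sup>2)"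
    using VU g by (intro mult_left_mono) auto
  also have "\<dots> = \<gamma> * Vform K w + 18 * \<gamma> * sqrt (2 * M / t) * a\<^sup>2" by (simp add: algebra_simps)
  also have "\<dots> \<le> \<gamma> / \<gamma>' * X + \<eta> * a\<^sup>2" using Vw small(4) by (intro add_mono mult_right_mono) auto
  finally have "(1 - \<eta>)\<^sup>2 * (1 - 3 * \<eta>) * X \<le> \<gamma> / \<gamma>' * X + \<eta> * a\<^sup>2 + M / \<zeta> * a\<^sup>2" by simp
  moreover have "M / \<zeta> * a\<^sup>2 \<le> \<eta> * a\<^sup>2" using small(5) by (rule mult_right_mono) simp
  moreover have "\<eta> * a\<^sup>2 \<le> \<eta> * (I * X)" using aI \<eta>(1) by (intro mult_left_mono) auto
  ultimately have "(1 - \<eta>)\<^sup>2 * (1 - 3 * \<eta>) * X \<le> (\<gamma> / \<gamma>' + 2 * \<eta> * I) * X" by (simp add: algebra_simps)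
  then have "X = 0" using \<eta>(3) X0 mult_strict_right_mono[OF \<eta>(3), of X] by (cases "X = 0") auto
  have "AE v in tm. dispersion v * (w v)\<^sup>2 = 0"
    using \<open>X = 0\<close> integral_nonneg_eq_0_iff_AE[of tm "\<lambda>v. dispersion v * (w v)\<^sup>2"] integrable_dispersion_mult[OF w2]
    by (auto simp: X_def dispersion_nonneg)
  with AE_tm_nonzero AE_space have "AE v in tm. w v = 0"
  proof eventually_elim
    case (elim v)
    then have "dispersion v > 0" by (intro dispersion_pos) auto
    then show ?case using elim by simp
  qed
  then show ?thesis unfolding w_def by (rule AE_wrap_shift) measurable
qed

section \<open>Reduction of the eigenvalue equation\<close>

lemma sigma_finite_torus: "sigma_finite_measure torus_measure"
  using finite_measure_torus by (simp add: finite_measure_def)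

lemma tm_pair: "tm \<Otimes>\<^sub>M tm = density torus_measure2 (\<lambda>_. ennreal (1 / (2 * pi) ^ 3) * ennreal (1 / (2 * pi) ^ 3))"
proof -
  have "sigma_finite_measure (density torus_measure (\<lambda>_. ennreal (1 / (2 * pi) ^ 3)))"
    using tm.sigma_finite_measure_axioms by (simp add: tm_def)
  then show ?thesis unfolding tm_def
    by (subst pair_measure_density) (auto simp: sigma_finite_torus case_prod_unfold)
qed

lemma measurable_tm2: "measurable (tm \<Otimes>\<^sub>M tm) N = measurable torus_measure2 N"
  unfolding tm_pair by (rule measurable_cong_sets) simp_all

lemma AE_tm2: "(AE x in tm \<Otimes>\<^sub>M tm. P x) \<longleftrightarrow> (AE x in torus_measure2. P x)"
proof -
  have "ennreal (1 / (2 * pi) ^ 3) * ennreal (1 / (2 * pi) ^ 3) > 0"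
    by (simp add: ennreal_zero_less_mult_iff ennreal_zero_less_divide)
  then show ?thesis unfolding tm_pair by (subst AE_density) auto
qed

lemma integrable_tm2:
  fixes f :: "(real^3) \<times> (real^3) \<Rightarrow> real"
  assumes "f \<in> borel_measurable torus_measure2"
  shows "integrable (tm \<Otimes>\<^sub>M tm) f \<longleftrightarrow> integrable torus_measure2 f"
proof -
  define c :: real where "c = 1 / (2 * pi) ^ 3 * (1 / (2 * pi) ^ 3)"
  have c: "c > 0" by (simp add: c_def)
  have "tm \<Otimes>\<^sub>M tm = density torus_measure2 (\<lambda>_. ennreal c)"
    unfolding tm_pair c_def by (subst ennreal_mult) auto
  then have "integrable (tm \<Otimes>\<^sub>M tm) f \<longleftrightarrow> integrable torus_measure2 (\<lambda>x. c *\<^sub>R f x)"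
    using assms c by (simp add: integrable_density)
  moreover have "integrable torus_measure2 f" if "integrable torus_measure2 (\<lambda>x. c *\<^sub>R f x)"
    using integrable_scaleR_right[OF that, of "1 / c"] c by simp
  ultimately show ?thesis by auto
qed

lemma L2_antisymD:
  assumes "f \<in> L2_antisym"
  shows "f \<in> borel_measurable (tm \<Otimes>\<^sub>M tm)" "integrable (tm \<Otimes>\<^sub>M tm) (\<lambda>x. (cmod (f x))\<^sup>2)"
    and "AE x in tm \<Otimes>\<^sub>M tm. f x = - f (snd x, fst x)"
proof -
  have m: "f \<in> borel_measurable torus_measure2" and i: "integrable torus_measure2 (\<lambda>x. (cmod (f x))\<^sup>2)"
    using assms by (auto simp: L2_antisym_def L2_def)
  show "f \<in> borel_measurable (tm \<Otimes>\<^sub>M tm)" using m by (simp add: measurable_tm2)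
  have "(\<lambda>x. (cmod (f x))\<^sup>2) \<in> borel_measurable torus_measure2" using m by measurable
  then show "integrable (tm \<Otimes>\<^sub>M tm) (\<lambda>x. (cmod (f x))\<^sup>2)" using i by (simp add: integrable_tm2)
  show "AE x in tm \<Otimes>\<^sub>M tm. f x = - f (snd x, fst x)"
    unfolding AE_tm2 using assms by (simp add: L2_antisym_def case_prod_unfold)
qed

lemma L2_antisymI:
  assumes "f \<in> borel_measurable (tm \<Otimes>\<^sub>M tm)" "integrable (tm \<Otimes>\<^sub>M tm) (\<lambda>x. (cmod (f x))\<^sup>2)"
    and "\<And>p q. f (p, q) = - f (q, p)"
  shows "f \<in> L2_antisym"
proof -
  have m: "f \<in> borel_measurable torus_measure2" using assms(1) by (simp add: measurable_tm2)
  then have "(\<lambda>x. (cmod (f x))\<^sup>2) \<in> borel_measurable torus_measure2" by measurable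
  then have "f \<in> L2 torus_measure2" using m assms(2) by (simp add: L2_def integrable_tm2)
  moreover have "AE (p, q) in torus_measure2. f (p, q) = - f (q, p)"
    by (rule AE_I2) (metis (mono_tags, lifting) assms(3) case_prodI2)
  ultimately show ?thesis by (simp add: L2_antisym_def)
qed

lemma section_measurable:
  assumes "f \<in> borel_measurable (tm \<Otimes>\<^sub>M tm)" "q \<in> torus3"
  shows "(\<lambda>s. f (s, q)) \<in> borel_measurable tm" "(\<lambda>s. f (q, s)) \<in> borel_measurable tm"
  using assms by (auto intro!: measurable_compose[OF _ assms(1)] measurable_Pair1' measurable_Pair2')

lemma H_op_tm:
  assumes f: "f \<in> borel_measurable (tm \<Otimes>\<^sub>M tm)" and pq: "p \<in> torus3" "q \<in> torus3"
  shows "H_op \<gamma> lam K f (p, q) = of_real (total_energy \<gamma> K p q) * f (p, q)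
     - of_real lam * (\<integral>s. f (s, q) \<partial>tm) - of_real lam * (\<integral>s. f (p, s) \<partial>tm)"
  unfolding H_op_def
  using integral_torus_tm[OF section_measurable(1)[OF f pq(2)], of lam]
    integral_torus_tm[OF section_measurable(2)[OF f pq(1)], of lam] by simp

lemma eigenfunction_reduction:
  assumes g: "0 \<le> \<gamma>" and lam: "0 < lam" and \<zeta>: "0 < \<zeta>"
    and f: "f \<in> eigenspace torus_measure2 L2_antisym (H_op \<gamma> lam K) (of_real (- \<zeta>))"
    and nz: "\<not> (AE x in torus_measure2. f x = 0)"
  shows "\<exists>U\<in>L2R. (AE q in tm. Dsym \<gamma> K lam \<zeta> q * U q = (\<integral>p. kern \<gamma> K \<zeta> p q * U p \<partial>tm)) \<and>
            \<not> (AE q in tm. U q = 0)"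
proof -
  have fS: "f \<in> L2_antisym" and fe: "AE x in torus_measure2. H_op \<gamma> lam K f x = of_real (- \<zeta>) * f x"
    using f by (auto simp: eigenspace_def)
  note fm [measurable] = L2_antisymD(1)[OF fS] and f2 = L2_antisymD(2)[OF fS] and fa = L2_antisymD(3)[OF fS]
  have fi: "integrable (tm \<Otimes>\<^sub>M tm) f"
  proof -
    have "integrable (tm \<Otimes>\<^sub>M tm) (\<lambda>x. cmod (f x))"
      by (rule tm2.P.square_integrable_imp_integrable) (use f2 in auto)
    then show ?thesis by (simp add: integrable_norm_iff)
  qed
  define u where "u q = (\<integral>s. f (s, q) \<partial>tm)" for q
  have fm': "(\<lambda>(q, s). f (s, q)) \<in> borel_measurable (tm \<Otimes>\<^sub>M tm)" by measurable
  have um [measurable]: "u \<in> borel_measurable tm"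
    unfolding u_def by (rule tm.borel_measurable_lebesgue_integral[OF fm'])
  have sec2: "AE q in tm. integrable tm (\<lambda>s. (cmod (f (s, q)))\<^sup>2)"
    using tm2.AE_integrable_snd[of "\<lambda>p q. (cmod (f (p, q)))\<^sup>2"] f2 by (simp add: case_prod_unfold)
  have int2: "integrable tm (\<lambda>q. \<integral>s. (cmod (f (s, q)))\<^sup>2 \<partial>tm)"
    using tm2.integrable_snd[of "\<lambda>p q. (cmod (f (p, q)))\<^sup>2"] f2 by (simp add: case_prod_unfold)
  have u2: "integrable tm (\<lambda>q. (cmod (u q))\<^sup>2)"
  proof (rule Bochner_Integration.integrable_bound[OF int2])
    show "AE q in tm. norm ((cmod (u q))\<^sup>2) \<le> norm (\<integral>s. (cmod (f (s, q)))\<^sup>2 \<partial>tm)"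
      using sec2 AE_space
    proof eventually_elim
      case (elim q)
      then have m: "(\<lambda>s. f (s, q)) \<in> borel_measurable tm" using section_measurable[OF fm] by simp
      have i1: "integrable tm (\<lambda>s. cmod (f (s, q)))"
        by (rule tm.square_integrable_imp_integrable[where f = "\<lambda>s. cmod (f (s, q))", OF measurable_compose[OF m borel_measurable_norm] elim(1)])
      have "cmod (u q) \<le> (\<integral>s. cmod (f (s, q)) \<partial>tm)" unfolding u_def by (rule integral_norm_bound)
      then have "(cmod (u q))\<^sup>2 \<le> (\<integral>s. cmod (f (s, q)) \<partial>tm)\<^sup>2" by (rule power_mono) simp
      also have "\<dots> \<le> (\<integral>s. (cmod (f (s, q)))\<^sup>2 \<partial>tm)" by (rule tm_square_integral[OF i1 elim(1)])
      finally show ?case by simp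
    qed
  qed measurable
  have u1: "integrable tm u"
  proof -
    have "integrable tm (\<lambda>x. cmod (u x))"
      by (rule tm.square_integrable_imp_integrable) (use u2 in auto)
    then show ?thesis by (simp add: integrable_norm_iff)
  qed
  have anti: "AE p in tm. AE q in tm. f (p, q) = - f (q, p)"
    using tm2.AE_pair[OF fa] by simp
  have pt: "AE p in tm. AE q in tm. f (p, q) = of_real lam * (u q - u p) / of_real (total_energy \<gamma> K p q + \<zeta>)"
  proof -
    have "AE p in tm. AE q in tm. H_op \<gamma> lam K f (p, q) = of_real (- \<zeta>) * f (p, q)"
      using fe unfolding AE_tm2[symmetric] by (rule tm2.AE_pair)
    then show ?thesis using anti AE_space
    proof eventually_elim
      case (elim p)
      then have p: "p \<in> torus3" by simp
      have up: "(\<integral>s. f (p, s) \<partial>tm) = - u p"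
      proof -
        have "(\<integral>s. f (p, s) \<partial>tm) = (\<integral>s. - f (s, p) \<partial>tm)"
          using elim(2) section_measurable[OF fm p] by (intro integral_cong_AE) auto
        then show ?thesis by (simp add: u_def)
      qed
      from elim(1) AE_space show ?case
      proof eventually_elim
        case (elim q)
        then have q: "q \<in> torus3" by simp
        have pos: "total_energy \<gamma> K p q + \<zeta> \<noteq> 0" using total_energy_nonneg[OF g, of K p q] \<zeta> by linarith
        then have "complex_of_real (total_energy \<gamma> K p q + \<zeta>) \<noteq> 0" by (simp only: of_real_eq_0_iff not_False_eq_True)
        moreover have "of_real (total_energy \<gamma> K p q + \<zeta>) * f (p, q) = of_real lam * (u q - u p)"
          using elim(1) unfolding H_op_tm[OF fm p q] up by (simp add: u_def algebra_simps)
        ultimately show ?case by (metis nonzero_mult_div_cancel_left)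
      qed
    qed
  qed
  have pt': "AE q in tm. AE p in tm. f (p, q) = of_real lam * (u q - u p) / of_real (total_energy \<gamma> K p q + \<zeta>)"
    using pt anti
  proof eventually_elim
    case (elim q)
    then show ?case
    proof eventually_elim
      case (elim p)
      have "f (p, q) = - f (q, p)" using elim(2) by simp
      also have "\<dots> = of_real lam * (u q - u p) / of_real (total_energy \<gamma> K q p + \<zeta>)"
        unfolding elim(1) by (simp add: divide_inverse algebra_simps)
      finally show ?case by (simp add: total_energy_sym[of \<gamma> K p q])
    qed
  qed
  have eq: "AE q in tm. of_real (Dsym \<gamma> K lam \<zeta> q) * u q = (\<integral>p. of_real (kern \<gamma> K \<zeta> p q) * u p \<partial>tm)"
    using pt' AE_space
  proof eventually_elim
    case (elim q)
    then have q: "q \<in> torus3" by simp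
    note [measurable] = section_measurable(1)[OF fm q] measurable_energy[of \<gamma> K q] measurable_kern[OF g \<zeta>, of K q]
    have ik: "integrable tm (\<lambda>p. of_real (kern \<gamma> K \<zeta> p q) * u p)"
    proof (rule Bochner_Integration.integrable_bound)
      show "integrable tm (\<lambda>p. of_real \<zeta> * u p)" using u1 by simp
      show "AE p in tm. norm (of_real (kern \<gamma> K \<zeta> p q) * u p) \<le> norm (of_real \<zeta> * u p)"
        using kern_abs_le[OF g \<zeta>, of K _ q] \<zeta> by (intro AE_I2) (simp add: norm_mult mult_right_mono)
    qed measurable
    have ik': "integrable tm (\<lambda>p. u q * of_real (kern \<gamma> K \<zeta> p q))"
      by (intro integrable_mult_right integrable_of_real integrable_kern g \<zeta>)
    have "of_real (\<zeta>\<^sup>2 / lam) * u q = (\<integral>p. of_real (\<zeta>\<^sup>2 / lam) * f (p, q) \<partial>tm)" by (simp add: u_def)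
    also have "\<dots> = (\<integral>p. u q * of_real (kern \<gamma> K \<zeta> p q) - of_real (kern \<gamma> K \<zeta> p q) * u p \<partial>tm)"
    proof (rule integral_cong_AE)
      show "AE p in tm. of_real (\<zeta>\<^sup>2 / lam) * f (p, q) = u q * of_real (kern \<gamma> K \<zeta> p q) - of_real (kern \<gamma> K \<zeta> p q) * u p"
        using elim(1)
      proof eventually_elim
        case (elim p)
        have "of_real (\<zeta>\<^sup>2 / lam) * (of_real lam * (u q - u p) / of_real (total_energy \<gamma> K p q + \<zeta>))
            = of_real (\<zeta>\<^sup>2 / (total_energy \<gamma> K p q + \<zeta>)) * (u q - u p)"
          using lam by simp
        also have "\<dots> = u q * of_real (\<zeta>\<^sup>2 / (total_energy \<gamma> K p q + \<zeta>)) - of_real (\<zeta>\<^sup>2 / (total_energy \<gamma> K p q + \<zeta>)) * u p"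
          by (simp only: right_diff_distrib) (simp only: mult.commute)
        finally show ?case unfolding elim kern_def .
      qed
    qed measurable
    also have "\<dots> = (\<integral>p. u q * of_real (kern \<gamma> K \<zeta> p q) \<partial>tm) - (\<integral>p. of_real (kern \<gamma> K \<zeta> p q) * u p \<partial>tm)"
      by (rule Bochner_Integration.integral_diff[OF ik' ik])
    also have "(\<integral>p. u q * of_real (kern \<gamma> K \<zeta> p q) \<partial>tm) = u q * of_real (\<integral>p. kern \<gamma> K \<zeta> p q \<partial>tm)"
      by (simp only: integral_mult_right_zero integral_complex_of_real)
    finally show ?case unfolding Dsym_def by (simp add: algebra_simps)
  qed
  have part: "(\<lambda>q. h (u q)) \<in> L2R \<and> (AE q in tm. Dsym \<gamma> K lam \<zeta> q * h (u q) = (\<integral>p. kern \<gamma> K \<zeta> p q * h (u p) \<partial>tm))"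
    if h: "bounded_linear h" "\<And>z. \<bar>h z\<bar> \<le> cmod z" "\<And>r z. h (of_real r * z) = r * h z" for h :: "complex \<Rightarrow> real"
  proof
    have hm [measurable]: "h \<in> borel_measurable borel"
      by (intro borel_measurable_continuous_onI linear_continuous_on h)
    have "integrable tm (\<lambda>q. (h (u q))\<^sup>2)"
    proof (rule Bochner_Integration.integrable_bound[OF u2])
      show "AE q in tm. norm ((h (u q))\<^sup>2) \<le> norm ((cmod (u q))\<^sup>2)"
      proof (rule AE_I2)
        fix q
        have "\<bar>h (u q)\<bar>\<^sup>2 \<le> (cmod (u q))\<^sup>2" using h(2) by (intro power_mono) auto
        then show "norm ((h (u q))\<^sup>2) \<le> norm ((cmod (u q))\<^sup>2)" by simp
      qed
    qed measurable
    then show "(\<lambda>q. h (u q)) \<in> L2R" unfolding L2R_def by (auto intro: measurable_compose[OF um hm])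
    show "AE q in tm. Dsym \<gamma> K lam \<zeta> q * h (u q) = (\<integral>p. kern \<gamma> K \<zeta> p q * h (u p) \<partial>tm)"
      using eq AE_space
    proof eventually_elim
      case (elim q)
      note [measurable] = measurable_kern[OF g \<zeta>, of K q]
      have ik: "integrable tm (\<lambda>p. of_real (kern \<gamma> K \<zeta> p q) * u p)"
      proof (rule Bochner_Integration.integrable_bound)
        show "integrable tm (\<lambda>p. of_real \<zeta> * u p)" using u1 by simp
        show "AE p in tm. norm (of_real (kern \<gamma> K \<zeta> p q) * u p) \<le> norm (of_real \<zeta> * u p)"
          using kern_abs_le[OF g \<zeta>, of K _ q] \<zeta> by (intro AE_I2) (simp add: norm_mult mult_right_mono)
      qed measurable
      have "h (of_real (Dsym \<gamma> K lam \<zeta> q) * u q) = h (\<integral>p. of_real (kern \<gamma> K \<zeta> p q) * u p \<partial>tm)" using elim by simp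
      also have "\<dots> = (\<integral>p. h (of_real (kern \<gamma> K \<zeta> p q) * u p) \<partial>tm)"
        by (rule integral_bounded_linear[OF h(1) ik, symmetric])
      finally show ?case by (simp only: h(3))
    qed
  qed
  have re: "(\<lambda>q. Re (u q)) \<in> L2R \<and> (AE q in tm. Dsym \<gamma> K lam \<zeta> q * Re (u q) = (\<integral>p. kern \<gamma> K \<zeta> p q * Re (u p) \<partial>tm))"
    by (rule part) (auto intro: bounded_linear_Re abs_Re_le_cmod)
  have im: "(\<lambda>q. Im (u q)) \<in> L2R \<and> (AE q in tm. Dsym \<gamma> K lam \<zeta> q * Im (u q) = (\<integral>p. kern \<gamma> K \<zeta> p q * Im (u p) \<partial>tm))"
    by (rule part) (auto intro: bounded_linear_Im abs_Im_le_cmod)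
  have "\<not> ((AE q in tm. Re (u q) = 0) \<and> (AE q in tm. Im (u q) = 0))"
  proof
    assume "(AE q in tm. Re (u q) = 0) \<and> (AE q in tm. Im (u q) = 0)"
    then have r0: "AE q in tm. Re (u q) = 0" and i0: "AE q in tm. Im (u q) = 0" by auto
    have u0: "AE q in tm. u q = 0" using r0 i0 by eventually_elim (simp add: complex_eq_iff)
    have "AE p in tm. AE q in tm. f (p, q) = 0"
      using pt u0
    proof eventually_elim
      case (elim p)
      note up = elim(2)
      from elim(1) u0 show ?case by eventually_elim (simp add: up)
    qed
    moreover have "{x \<in> space (tm \<Otimes>\<^sub>M tm). f x = 0} \<in> sets (tm \<Otimes>\<^sub>M tm)" by measurable
    ultimately have "AE x in tm \<Otimes>\<^sub>M tm. f x = 0" by (intro tm2.AE_pair_measure) auto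
    then show False using nz by (simp add: AE_tm2)
  qed
  then show ?thesis using conjunct1[OF re] conjunct2[OF re] conjunct1[OF im] conjunct2[OF im]
    by (cases "AE q in tm. Re (u q) = 0") (auto intro: bexI[of _ "\<lambda>q. Re (u q)"] bexI[of _ "\<lambda>q. Im (u q)"])
qed

lemma phi_as_cos: "phi K (Some (i, b)) p = cos (p $ i + (- K $ i / 2 - (if b then 0 else pi / 2)))"
proof (cases b)
  case False
  have e: "p $ i + (- K $ i / 2 - pi / 2) = (p $ i + - K $ i / 2) - pi / 2" by simp
  have "cos (p $ i + (- K $ i / 2 - pi / 2)) = sin (p $ i + - K $ i / 2)"
    unfolding e cos_diff by (simp only: cos_pi_half sin_pi_half mult_zero_right mult_1_right add_0)
  then show ?thesis using False by (simp only: phi_def option.case prod.case if_False)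
qed (simp add: phi_def)

lemma phi_mean: "(\<integral>p. phi K (Some j) p \<partial>tm) = 0"
proof (cases j)
  case (Pair i b)
  show ?thesis unfolding Pair phi_as_cos by (rule integral_cos)
qed

lemma phi_orthogonal: "(\<integral>p. phi K (Some j) p * phi K (Some k) p \<partial>tm) = (if j = k then 1 / 2 else 0)"
proof (cases j, cases k)
  fix i b i' b' assume jk: "j = (i, b)" "k = (i', b')"
  show ?thesis unfolding jk phi_as_cos integral_cos_cos by (cases b; cases b') auto
qed

lemma phi_None: "phi K None p = 1" by (simp add: phi_def)

lemma L2R_bounded:
  assumes "w \<in> borel_measurable tm" "\<And>x. \<bar>w x\<bar> \<le> C" shows "w \<in> L2R"
proof -
  have "integrable tm (\<lambda>x. (w x)\<^sup>2)"
  proof (rule integrable_tm_bounded[where C = "C\<^sup>2"])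
    fix x have "\<bar>w x\<bar>\<^sup>2 \<le> C\<^sup>2" using assms(2) by (intro power_mono) auto
    then show "norm ((w x)\<^sup>2) \<le> C\<^sup>2" by simp
  qed (use assms in measurable)
  then show ?thesis using assms by (simp add: L2R_def)
qed

lemma supercritical_nonempty: "13 \<in> supercritical K"
proof -
  define w where "w = phi K (Some (1, True))"
  have w: "w \<in> L2R" unfolding w_def by (rule L2R_bounded[OF measurable_phi abs_phi_le])
  have w2: "(\<integral>v. (w v)\<^sup>2 \<partial>tm) = 1 / 2" unfolding w_def power2_eq_square phi_orthogonal by simp
  have "Vform K w = (\<Sum>j\<in>(UNIV :: (3 \<times> bool) set). if j = (1, True) then 1 / 4 else 0)"
    unfolding Vform_def coef_def w_def phi_orthogonal by (intro sum.cong) (auto simp: sg_def power2_eq_square)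
  also have "\<dots> = 1 / 4" by simp
  finally have V: "Vform K w = 1 / 4" .
  have "(\<integral>v. dispersion v * (w v)\<^sup>2 \<partial>tm) \<le> (\<integral>v. 6 * (w v)\<^sup>2 \<partial>tm)"
    using L2R_D(2)[OF w] by (intro integral_mono integrable_dispersion_mult mult_right_mono dispersion_le) auto
  then have "(\<integral>v. dispersion v * (w v)\<^sup>2 \<partial>tm) < 13 * Vform K w" using w2 V by simp
  moreover have "(\<integral>v. w v \<partial>tm) = 0" unfolding w_def by (rule phi_mean)
  ultimately show ?thesis using w unfolding supercritical_def by auto
qed

lemma supercritical_lower_bound: "\<exists>c>0. \<forall>g\<in>supercritical K. c \<le> g"
proof -
  obtain I where I: "I > 0" "\<And>w. w \<in> L2R \<Longrightarrow> (\<integral>x. \<bar>w x\<bar> \<partial>tm)\<^sup>2 \<le> I * (\<integral>x. dispersion x * (w x)\<^sup>2 \<partial>tm)"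
    using L1_le_dispersion_form unfolding L2R_def by blast
  have "1 / (3 * I) \<le> g" if g: "g \<in> supercritical K" for g
  proof -
    obtain w where w: "w \<in> L2R" and lt: "(\<integral>v. dispersion v * (w v)\<^sup>2 \<partial>tm) < g * Vform K w" and g0: "0 < g"
      using g by (auto simp: supercritical_def)
    define X where "X = (\<integral>v. dispersion v * (w v)\<^sup>2 \<partial>tm)"
    have X0: "0 \<le> X" unfolding X_def by (intro integral_nonneg_AE) (simp add: dispersion_nonneg)
    have "Vform K w \<le> 3 * (I * X)"
      using Vform_le[OF L2R_integrable[OF w], of K] I(2)[OF w] unfolding X_def by linarith
    then have "g * Vform K w \<le> g * (3 * (I * X))" using g0 by (intro mult_left_mono) auto
    then have lt': "X < g * (3 * I) * X" using lt unfolding X_def by (simp add: mult_ac)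
    then have "X > 0" using X0 by (cases "X = 0") auto
    then have "1 < g * (3 * I)" using lt' by simp
    then show ?thesis using I(1) by (simp add: field_simps)
  qed
  then show ?thesis using I(1) by (intro exI[of _ "1 / (3 * I)"]) auto
qed

lemma eventually_divide_le: "d > 0 \<Longrightarrow> eventually (\<lambda>x::real. c / x \<le> d) at_top"
  using eventually_ge_at_top[of "\<bar>c\<bar> / d + 1"]
proof eventually_elim
  case (elim x)
  then have "\<bar>c\<bar> / d \<ge> 0" by simp
  then have x: "x > 0" using elim by linarith
  have "\<bar>c\<bar> / d \<le> x" using elim by linarith
  then have "\<bar>c\<bar> \<le> d * x" using \<open>d > 0\<close> by (simp add: divide_le_eq mult.commute)
  then show ?case using x by (simp add: divide_le_eq)
qed

lemma eventually_o_lam: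
  fixes T :: "real \<Rightarrow> real"
  assumes "filterlim (\<lambda>lam. lam / T lam) at_top at_top" "d > 0"
  shows "eventually (\<lambda>lam. 0 < T lam \<and> T lam \<le> d * lam) at_top"
proof -
  have "eventually (\<lambda>lam. lam / T lam \<ge> 1 / d) at_top"
    using assms(1) unfolding filterlim_at_top by blast
  then show ?thesis using eventually_gt_at_top[of 0]
  proof eventually_elim
    case (elim lam)
    have T: "T lam > 0"
    proof (rule ccontr)
      assume "\<not> T lam > 0"
      then have "lam / T lam \<le> 0" using elim by (simp add: divide_nonneg_nonpos)
      then show False using elim assms(2) by (smt (verit) zero_less_divide_1_iff)
    qed
    then show ?case using elim assms(2) by (simp add: field_simps)
  qed
qed

lemma no_eigenvalue_subcritical:
  fixes T :: "real \<Rightarrow> real"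
  assumes g: "0 < \<gamma>" "\<gamma> < \<gamma>'" "\<gamma>' \<notin> supercritical K"
    and T: "filterlim (\<lambda>lam. lam / T lam) at_top at_top"
  shows "\<exists>lam4>0. \<forall>lam>lam4. \<not> (\<exists>z\<in>{tau_max \<gamma> K lam..tau_max \<gamma> K lam + T lam}. H_eigenvalue \<gamma> lam K z)"
proof -
  obtain I where I: "I > 0" "\<And>w. w \<in> L2R \<Longrightarrow> (\<integral>x. \<bar>w x\<bar> \<partial>tm)\<^sup>2 \<le> I * (\<integral>x. dispersion x * (w x)\<^sup>2 \<partial>tm)"
    using L1_le_dispersion_form unfolding L2R_def by blast
  define M where "M = (emax \<gamma>)\<^sup>2"
  have M0: "M \<ge> 0" by (simp add: M_def)
  define \<eta> where "\<eta> = (1 - \<gamma> / \<gamma>') / (4 * I + 10)"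
  have gg: "0 < \<gamma> / \<gamma>'" "\<gamma> / \<gamma>' < 1" using g by auto
  have \<eta>0: "0 < \<eta>" using gg I(1) by (simp add: \<eta>_def)
  have \<eta>eq: "\<eta> * (4 * I + 10) = 1 - \<gamma> / \<gamma>'" using I(1) by (simp add: \<eta>_def)
  have "\<eta> * 10 \<le> \<eta> * (4 * I + 10)" using \<eta>0 I(1) by (intro mult_left_mono) auto
  then have \<eta>1: "\<eta> < 1 / 3" using \<eta>eq gg by linarith
  have \<eta>2: "\<gamma> / \<gamma>' + 2 * \<eta> * I < (1 - \<eta>)\<^sup>2 * (1 - 3 * \<eta>)"
  proof -
    have "(1 - \<eta>)\<^sup>2 * (1 - 3 * \<eta>) - (1 - 5 * \<eta>) = \<eta> * \<eta> * (7 - 3 * \<eta>)"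
      by (simp add: power2_eq_square algebra_simps)
    moreover have "0 \<le> \<eta> * \<eta> * (7 - 3 * \<eta>)" using \<eta>0 \<eta>1 by (intro mult_nonneg_nonneg) auto
    moreover have "\<gamma> / \<gamma>' + 2 * \<eta> * I < 1 - 5 * \<eta>"
    proof -
      have "2 * \<eta> * I + 5 * \<eta> = (\<eta> * (4 * I + 10)) / 2" by (simp add: algebra_simps)
      then show ?thesis unfolding \<eta>eq using gg by argo
    qed
    ultimately show ?thesis by linarith
  qed
  define e where "e = min (\<eta>\<^sup>2 / 144) ((\<eta> / (18 * \<gamma>))\<^sup>2)"
  have e0: "e > 0" using \<eta>0 g by (simp add: e_def)
  have half: "eventually (\<lambda>lam. emax \<gamma> \<le> lam / 2) at_top"
    using eventually_ge_at_top[of "2 * emax \<gamma>"] by eventually_elim simp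
  have T_small: "eventually (\<lambda>lam. 0 < T lam \<and> T lam \<le> min (1/4) (\<eta> / 2) * lam) at_top"
    by (rule eventually_o_lam[OF T]) (use \<eta>0 in auto)
  have "eventually (\<lambda>lam. emax \<gamma> < lam \<and> emax \<gamma> \<le> lam / 2 \<and> 4 * M / lam \<le> \<eta> \<and> 4 * M / lam \<le> e
      \<and> 36 * taylor_const \<gamma> / lam \<le> \<eta> \<and> 0 < T lam \<and> T lam \<le> min (1/4) (\<eta> / 2) * lam) at_top"
    using eventually_gt_at_top[of "emax \<gamma>"] half
      eventually_divide_le[OF \<eta>0, of "4 * M"] eventually_divide_le[OF e0, of "4 * M"]
      eventually_divide_le[OF \<eta>0, of "36 * taylor_const \<gamma>"] T_small
    by eventually_elim blast
  then obtain L where L: "\<And>lam. L \<le> lam \<Longrightarrow> emax \<gamma> < lam \<and> emax \<gamma> \<le> lam / 2 \<and> 4 * M / lam \<le> \<eta> \<and> 4 * M / lam \<le> e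
      \<and> 36 * taylor_const \<gamma> / lam \<le> \<eta> \<and> 0 < T lam \<and> T lam \<le> min (1/4) (\<eta> / 2) * lam"
    unfolding eventually_at_top_linorder by blast
  show ?thesis
  proof (intro exI[of _ "max L 1"] conjI allI impI notI)
    fix lam assume "lam > max L 1"
    then have "L \<le> lam" by simp
    from L[OF this] have l: "emax \<gamma> < lam" "emax \<gamma> \<le> lam / 2" "4 * M / lam \<le> \<eta>" "4 * M / lam \<le> e"
      "36 * taylor_const \<gamma> / lam \<le> \<eta>" "0 < T lam" "T lam \<le> min (1/4) (\<eta> / 2) * lam" by auto
    have lam0: "lam > 0" using l(1) g by linarith
    have Tl: "T lam \<le> lam / 4" "T lam \<le> \<eta> / 2 * lam"
    proof -
      have "min (1/4) (\<eta> / 2) * lam \<le> 1 / 4 * lam" using lam0 by (intro mult_right_mono) auto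
      then show "T lam \<le> lam / 4" using l(7) by linarith
      have "min (1/4) (\<eta> / 2) * lam \<le> \<eta> / 2 * lam" using lam0 by (intro mult_right_mono) auto
      then show "T lam \<le> \<eta> / 2 * lam" using l(7) by linarith
    qed
    assume "\<exists>z\<in>{tau_max \<gamma> K lam..tau_max \<gamma> K lam + T lam}. H_eigenvalue \<gamma> lam K z"
    then obtain z f where z: "tau_max \<gamma> K lam \<le> z" "z \<le> tau_max \<gamma> K lam + T lam"
      and f: "f \<in> eigenspace torus_measure2 L2_antisym (H_op \<gamma> lam K) (of_real z)" "\<not> (AE x in torus_measure2. f x = 0)"
      by (auto simp: is_eigenvalue_def)
    define t \<zeta> where "t = - tau_max \<gamma> K lam" and "\<zeta> = - z"
    have t: "lam / 2 \<le> t" using tau_max_threshold(1)[of \<gamma> lam K] g l by (simp add: t_def)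
    have \<zeta>t: "t - T lam \<le> \<zeta>" "\<zeta> \<le> t" using z by (auto simp: t_def \<zeta>_def)
    then have \<zeta>: "lam / 4 \<le> \<zeta>" using t Tl(1) by linarith
    have t0: "t > 0" and \<zeta>0: "\<zeta> > 0" using t \<zeta> lam0 by auto
    have Mt: "2 * M / t \<le> 4 * M / lam" "M / t \<le> 4 * M / lam" "M / \<zeta> \<le> 4 * M / lam"
    proof -
      have "2 * M / t \<le> 2 * M / (lam / 2)" using t lam0 M0 by (intro divide_left_mono) auto
      then show 1: "2 * M / t \<le> 4 * M / lam" by simp
      have "0 \<le> M / t" using M0 t0 by simp
      then show "M / t \<le> 4 * M / lam" using 1 by simp
      have "M / \<zeta> \<le> M / (lam / 4)" using \<zeta> lam0 M0 by (intro divide_left_mono) auto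
      then show "M / \<zeta> \<le> 4 * M / lam" by (simp add: mult.commute)
    qed
    have sq: "c * sqrt (2 * M / t) \<le> \<eta>" if "c > 0" "(\<eta> / c)\<^sup>2 \<ge> e" for c
    proof -
      have "sqrt (2 * M / t) \<le> sqrt ((\<eta> / c)\<^sup>2)" using Mt(1) l(4) that by (intro real_sqrt_le_mono) linarith
      also have "sqrt ((\<eta> / c)\<^sup>2) = \<eta> / c" using that \<eta>0 by simp
      finally show ?thesis using that by (simp add: pos_le_divide_eq mult.commute)
    qed
    obtain U where U: "U \<in> L2R" "AE q in tm. Dsym \<gamma> K lam \<zeta> q * U q = (\<integral>p. kern \<gamma> K \<zeta> p q * U p \<partial>tm)"
      "\<not> (AE q in tm. U q = 0)"
      using eigenfunction_reduction[of \<gamma> lam \<zeta> f K] g lam0 \<zeta>0 f by (auto simp: \<zeta>_def)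
    have "AE q in tm. U q = 0"
    proof (rule no_solution[OF g(1) l(1) U(1) \<zeta>0 _ U(2) I _ g(3) \<eta>0 \<eta>1 \<eta>2 t_def M_def])
      show "\<zeta> \<le> - tau_max \<gamma> K lam" using \<zeta>t by (simp add: t_def)
      show "0 < \<gamma>'" using g by simp
      show "M / t \<le> \<eta>" "M / \<zeta> \<le> \<eta>" using Mt l(3) by linarith+
      show "12 * sqrt (2 * M / t) \<le> \<eta>" by (rule sq) (auto simp: e_def power_divide)
      show "18 * \<gamma> * sqrt (2 * M / t) \<le> \<eta>" by (rule sq) (use g in \<open>auto simp: e_def\<close>)
      have "18 * taylor_const \<gamma> / t \<le> 18 * taylor_const \<gamma> / (lam / 2)"
        using t lam0 taylor_const_nonneg[of \<gamma>] g by (intro divide_left_mono) auto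
      then show "18 * taylor_const \<gamma> / t \<le> \<eta>" using l(5) by simp
      have "T lam / t \<le> (\<eta> / 2 * lam) / (lam / 2)" using Tl(2) t lam0 \<eta>0 by (intro frac_le) auto
      also have "\<dots> = \<eta>" using lam0 by simp
      finally have "1 - \<eta> \<le> (t - T lam) / t" using t0 by (simp add: diff_divide_distrib)
      also have "\<dots> \<le> \<zeta> / t" using \<zeta>t t0 by (intro divide_right_mono) auto
      finally show "1 - \<eta> \<le> \<zeta> / t" .
    qed
    then show False using U(3) by simp
  qed auto
qed

section \<open>The finite-dimensional form of a point in the gap\<close>

lemma L2R_mult_integrable:
  assumes "f \<in> L2R" "g \<in> L2R" shows "integrable tm (\<lambda>x. f x * g x)"
proof (rule Bochner_Integration.integrable_bound)
  show "integrable tm (\<lambda>x. (f x)\<^sup>2 + (g x)\<^sup>2)" using assms L2R_D(2) by auto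
  show "(\<lambda>x. f x * g x) \<in> borel_measurable tm" using L2R_D(1)[OF assms(1)] L2R_D(1)[OF assms(2)] by measurable
  show "AE x in tm. norm (f x * g x) \<le> norm ((f x)\<^sup>2 + (g x)\<^sup>2)"
  proof (rule AE_I2)
    fix x
    have "2 * \<bar>f x\<bar> * \<bar>g x\<bar> \<le> \<bar>f x\<bar>\<^sup>2 + \<bar>g x\<bar>\<^sup>2" by (rule sum_squares_bound)
    moreover have "0 \<le> \<bar>f x\<bar> * \<bar>g x\<bar>" by simp
    ultimately have "\<bar>f x\<bar> * \<bar>g x\<bar> \<le> (f x)\<^sup>2 + (g x)\<^sup>2" unfolding power2_abs by linarith
    then show "norm (f x * g x) \<le> norm ((f x)\<^sup>2 + (g x)\<^sup>2)" by (simp add: abs_mult)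
  qed
qed

lemma L2R_add: assumes "f \<in> L2R" "g \<in> L2R" shows "(\<lambda>x. f x + g x) \<in> L2R"
proof -
  have "integrable tm (\<lambda>x. (f x)\<^sup>2 + 2 * (f x * g x) + (g x)\<^sup>2)"
    by (intro Bochner_Integration.integrable_add integrable_mult_right L2R_mult_integrable L2R_D(2) assms)
  moreover have "(\<lambda>x. f x + g x) \<in> borel_measurable tm" using L2R_D(1)[OF assms(1)] L2R_D(1)[OF assms(2)] by measurable
  ultimately show ?thesis by (simp add: L2R_def power2_sum algebra_simps)
qed

lemma L2R_scale: assumes "f \<in> L2R" shows "(\<lambda>x. c * f x) \<in> L2R"
  using L2R_D[OF assms] by (auto simp: L2R_def power_mult_distrib)

lemma L2R_zero: "(\<lambda>x. 0) \<in> L2R" by (simp add: L2R_def)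

lemma L2R_sum: "finite A \<Longrightarrow> (\<And>i. i \<in> A \<Longrightarrow> f i \<in> L2R) \<Longrightarrow> (\<lambda>x. \<Sum>i\<in>A. c i * f i x) \<in> L2R"
  by (induction A rule: finite_induct) (auto intro!: L2R_add L2R_scale L2R_zero)

lemma L2R_phi: "phi K j \<in> L2R" by (rule L2R_bounded[OF measurable_phi abs_phi_le])

lemma integral_sum_scaled:
  fixes f :: "'i \<Rightarrow> real^3 \<Rightarrow> real"
  assumes "\<And>i. i \<in> A \<Longrightarrow> integrable tm (\<lambda>x. h x * f i x)"
  shows "(\<integral>x. h x * (\<Sum>i\<in>A. c i * f i x) \<partial>tm) = (\<Sum>i\<in>A. c i * (\<integral>x. h x * f i x \<partial>tm))"
proof -
  have "(\<integral>x. h x * (\<Sum>i\<in>A. c i * f i x) \<partial>tm) = (\<integral>x. (\<Sum>i\<in>A. c i * (h x * f i x)) \<partial>tm)"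
    by (simp add: sum_distrib_left mult_ac)
  also have "\<dots> = (\<Sum>i\<in>A. (\<integral>x. c i * (h x * f i x) \<partial>tm))"
    by (intro Bochner_Integration.integral_sum integrable_mult_right assms)
  finally show ?thesis by simp
qed

lemma coef_sum:
  assumes "\<And>i. i \<in> A \<Longrightarrow> f i \<in> L2R"
  shows "coef K (\<lambda>x. \<Sum>i\<in>A. c i * f i x) j = (\<Sum>i\<in>A. c i * coef K (f i) j)"
  unfolding coef_def by (intro integral_sum_scaled L2R_mult_integrable L2R_phi assms)

text \<open>At a point \<open>- \<zeta>\<close> of the gap away from \<open>tau_max\<close>, the operator \<open>D - R\<close> is positive definite. Minimising its
  form under prescribed values of the coefficients \<open>coef K w j\<close> and of the mean leads to the functions \<open>wv b\<close>,
  on which \<open>Vform\<close> has to be compared with \<open>Aform\<close>.\<close>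

locale gap_point =
  fixes \<gamma> :: real and K :: "real^3" and lam \<zeta> \<delta> :: real
  assumes g: "0 < \<gamma>" and lam: "0 < lam" and zeta: "0 < \<zeta>" and delta: "0 < \<delta>"
    and D_ge: "\<And>q. \<delta> \<le> Dsym \<gamma> K lam \<zeta> q" and R_small: "(emax \<gamma>)\<^sup>2 / \<zeta> \<le> \<delta> / 2"
begin

abbreviation "D \<equiv> Dsym \<gamma> K lam \<zeta>"
abbreviation "R \<equiv> Rop \<gamma> K \<zeta>"

lemma g0: "0 \<le> \<gamma>" using g by simp

lemma D_pos: "0 < D q" using D_ge[of q] delta by linarith

lemma continuous_D: "continuous_on UNIV D" by (rule continuous_Dsym[OF g0 zeta])

lemma abs_R_le: "integrable tm w \<Longrightarrow> \<bar>R w q\<bar> \<le> \<delta> / 2 * (\<integral>p. \<bar>w p\<bar> \<partial>tm)"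
  using abs_Rop_le[OF g0 zeta, of w K q] mult_right_mono[OF R_small, of "\<integral>p. \<bar>w p\<bar> \<partial>tm"]
  by (smt (verit) integral_nonneg_AE AE_I2 abs_ge_zero)

lemma R_sum:
  assumes "\<And>i. i \<in> A \<Longrightarrow> integrable tm (f i)"
  shows "R (\<lambda>x. \<Sum>i\<in>A. c i * f i x) q = (\<Sum>i\<in>A. c i * R (f i) q)"
  unfolding Rop_def by (intro integral_sum_scaled integrable_rem_mult[OF g0 zeta] assms)

lemma R_diff:
  assumes "integrable tm f" "integrable tm h"
  shows "R (\<lambda>x. f x - h x) q = R f q - R h q"
  unfolding Rop_def right_diff_distrib
  by (intro Bochner_Integration.integral_diff integrable_rem_mult[OF g0 zeta] assms)

definition Aform :: "(real^3 \<Rightarrow> real) \<Rightarrow> (real^3 \<Rightarrow> real) \<Rightarrow> real" where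
  "Aform f h = (\<integral>q. h q * (D q * f q - R f q) \<partial>tm)"

lemma D_mult_L2R: "f \<in> L2R \<Longrightarrow> (\<lambda>q. D q * f q) \<in> L2R"
proof -
  assume f: "f \<in> L2R"
  note [measurable] = L2R_D(1)[OF f] measurable_Dsym[OF g0 zeta, of K lam]
  have "integrable tm (\<lambda>q. (D q)\<^sup>2 * (f q)\<^sup>2)"
  proof (rule integrable_mult_bounded_tm[OF L2R_D(2)[OF f]])
    fix x show "\<bar>(D x)\<^sup>2\<bar> \<le> (\<zeta> + \<zeta>\<^sup>2 / lam)\<^sup>2"
      using power_mono[OF abs_Dsym_le[OF g0 zeta lam, of K x], of 2] by simp
  qed measurable
  then show ?thesis by (simp add: L2R_def power_mult_distrib)
qed

lemma R_L2R: "integrable tm f \<Longrightarrow> R f \<in> L2R"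
  by (rule L2R_bounded[OF measurable_continuous_tm[OF continuous_Rop[OF g0 zeta]] abs_R_le])

lemma A_L2R: "f \<in> L2R \<Longrightarrow> (\<lambda>q. D q * f q - R f q) \<in> L2R"
  using L2R_add[OF D_mult_L2R L2R_scale[OF R_L2R[OF L2R_integrable], of f "- 1"], of f] by simp

lemma Aform_split:
  assumes "f \<in> L2R" "h \<in> L2R"
  shows "Aform f h = (\<integral>q. h q * (D q * f q) \<partial>tm) - (\<integral>q. h q * R f q \<partial>tm)"
  unfolding Aform_def right_diff_distrib
  by (intro Bochner_Integration.integral_diff L2R_mult_integrable D_mult_L2R R_L2R L2R_integrable assms)

lemma Aform_sym: "f \<in> L2R \<Longrightarrow> h \<in> L2R \<Longrightarrow> Aform f h = Aform h f"
proof -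
  assume f: "f \<in> L2R" and h: "h \<in> L2R"
  have "(\<integral>q. h q * R f q \<partial>tm) = (\<integral>q. f q * R h q \<partial>tm)"
    unfolding Rop_def
    using Fubini_tm[OF continuous_rem_pair[OF g0 zeta] rem_abs_le[OF g0 zeta] L2R_integrable[OF f] L2R_integrable[OF h], of K]
    by (simp add: rem_sym[of \<gamma> K \<zeta>])
  then show ?thesis unfolding Aform_split[OF f h] Aform_split[OF h f] by (simp add: mult_ac)
qed

lemma Aform_sum_right:
  assumes "f \<in> L2R" "\<And>i. i \<in> A \<Longrightarrow> h i \<in> L2R"
  shows "Aform f (\<lambda>x. \<Sum>i\<in>A. c i * h i x) = (\<Sum>i\<in>A. c i * Aform f (h i))"
proof -
  have "Aform f (\<lambda>x. \<Sum>i\<in>A. c i * h i x) = (\<integral>q. (D q * f q - R f q) * (\<Sum>i\<in>A. c i * h i q) \<partial>tm)"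
    unfolding Aform_def by (simp add: mult.commute)
  also have "\<dots> = (\<Sum>i\<in>A. c i * (\<integral>q. (D q * f q - R f q) * h i q \<partial>tm))"
    by (intro integral_sum_scaled L2R_mult_integrable A_L2R assms)
  finally show ?thesis unfolding Aform_def by (simp add: mult.commute)
qed

lemma Aform_sum_left:
  assumes "f \<in> L2R" "finite A" "\<And>i. i \<in> A \<Longrightarrow> h i \<in> L2R"
  shows "Aform (\<lambda>x. \<Sum>i\<in>A. c i * h i x) f = (\<Sum>i\<in>A. c i * Aform (h i) f)"
  using Aform_sum_right[OF assms(1,3)] Aform_sym[OF L2R_sum[OF assms(2,3)] assms(1)] Aform_sym[OF assms(3) assms(1)]
  by simp

lemma Aform_coercive:
  assumes f: "f \<in> L2R" shows "\<delta> / 2 * (\<integral>q. (f q)\<^sup>2 \<partial>tm) \<le> Aform f f"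
proof -
  have f1: "integrable tm f" by (rule L2R_integrable[OF f])
  have "(\<integral>q. f q * R f q \<partial>tm) \<le> (\<integral>q. \<bar>f q\<bar> * (\<delta> / 2 * (\<integral>p. \<bar>f p\<bar> \<partial>tm)) \<partial>tm)"
  proof (rule integral_mono)
    show "integrable tm (\<lambda>q. f q * R f q)" by (intro L2R_mult_integrable f R_L2R f1)
    fix q
    have "f q * R f q \<le> \<bar>f q\<bar> * \<bar>R f q\<bar>" by (simp flip: abs_mult)
    also have "\<dots> \<le> \<bar>f q\<bar> * (\<delta> / 2 * (\<integral>p. \<bar>f p\<bar> \<partial>tm))" by (intro mult_left_mono abs_R_le f1) simp
    finally show "f q * R f q \<le> \<bar>f q\<bar> * (\<delta> / 2 * (\<integral>p. \<bar>f p\<bar> \<partial>tm))" .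
  qed (use f1 in auto)
  also have "\<dots> = \<delta> / 2 * (\<integral>p. \<bar>f p\<bar> \<partial>tm)\<^sup>2" by (simp add: power2_eq_square)
  also have "\<dots> \<le> \<delta> / 2 * (\<integral>p. (f p)\<^sup>2 \<partial>tm)"
    using tm_square_integral[of "\<lambda>p. \<bar>f p\<bar>"] f1 L2R_D(2)[OF f] delta by (intro mult_left_mono) auto
  finally have 1: "(\<integral>q. f q * R f q \<partial>tm) \<le> \<delta> / 2 * (\<integral>p. (f p)\<^sup>2 \<partial>tm)" .
  have "\<delta> * (\<integral>q. (f q)\<^sup>2 \<partial>tm) = (\<integral>q. \<delta> * (f q)\<^sup>2 \<partial>tm)" by simp
  also have "\<dots> \<le> (\<integral>q. f q * (D q * f q) \<partial>tm)"
  proof (rule integral_mono)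
    show "integrable tm (\<lambda>q. f q * (D q * f q))" by (intro L2R_mult_integrable f D_mult_L2R)
    fix q show "\<delta> * (f q)\<^sup>2 \<le> f q * (D q * f q)"
      using mult_right_mono[OF D_ge[of q], of "(f q)\<^sup>2"] by (simp add: power2_eq_square mult_ac)
  qed (use L2R_D(2)[OF f] in auto)
  finally show ?thesis unfolding Aform_split[OF f f] using 1 by (simp add: algebra_simps)
qed

lemma Aform_diff_self:
  assumes "f \<in> L2R" "h \<in> L2R"
  shows "Aform (\<lambda>x. f x - h x) (\<lambda>x. f x - h x) = Aform f f - 2 * Aform f h + Aform h h"
proof -
  define F where "F b = (if b then f else h)" for b
  define c where "c b = (if b then 1 else - 1 :: real)" for b
  have F: "F b \<in> L2R" for b using assms by (auto simp: F_def)
  have e: "(\<lambda>x. f x - h x) = (\<lambda>x. \<Sum>b\<in>UNIV. c b * F b x)" by (simp add: F_def c_def UNIV_bool)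
  have d: "(\<lambda>x. f x - h x) \<in> L2R" unfolding e by (rule L2R_sum) (auto simp: F)
  have "Aform (\<lambda>x. f x - h x) (\<lambda>x. f x - h x) = (\<Sum>b\<in>UNIV. c b * Aform (F b) (\<lambda>x. f x - h x))"
    by (subst (1) e, rule Aform_sum_left[OF d]) (auto simp: F)
  also have "\<dots> = (\<Sum>b\<in>UNIV. c b * (\<Sum>b'\<in>UNIV. c b' * Aform (F b) (F b')))"
    unfolding e by (subst Aform_sum_right) (auto simp: F)
  finally show ?thesis using Aform_sym[OF assms] by (simp add: UNIV_bool F_def c_def)
qed

lemma solution_exists:
  assumes cont: "continuous_on UNIV \<phi>" and bd: "\<And>q. \<bar>\<phi> q\<bar> \<le> 1"
  shows "\<exists>u. continuous_on UNIV u \<and> (\<forall>q. \<bar>u q\<bar> \<le> 2 / \<delta>) \<and> (\<forall>q. D q * u q - R u q = \<phi> q)"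
proof -
  define N where "N v = (\<lambda>p. apply_bcontfun v p / D p)" for v :: "(real^3) \<Rightarrow>\<^sub>C real"
  have D0: "D p \<noteq> 0" for p using D_pos[of p] by simp
  have Nc: "continuous_on UNIV (N v)" for v
    unfolding N_def using D0 by (intro continuous_on_divide continuous_D) auto
  have Nb: "\<bar>N v p - N w p\<bar> \<le> dist v w / \<delta>" for v w p
  proof -
    have "\<bar>apply_bcontfun v p - apply_bcontfun w p\<bar> \<le> dist v w"
      using dist_bounded[of v p w] by (simp add: dist_real_def)
    then have "\<bar>apply_bcontfun v p - apply_bcontfun w p\<bar> / D p \<le> dist v w / \<delta>"
      using delta D_ge[of p] by (intro frac_le) auto
    then show ?thesis using D_pos[of p] by (simp add: N_def diff_divide_distrib[symmetric])
  qed
  have N0: "N 0 p = 0" for p by (simp add: N_def)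
  have Nb0: "\<bar>N v p\<bar> \<le> norm v / \<delta>" for v p using Nb[of v p 0] N0[of p] by simp
  have Ni: "integrable tm (N v)" for v
    by (rule integrable_tm_bounded[OF measurable_continuous_tm[OF Nc]]) (use Nb0 in auto)
  have RN: "\<bar>R (N v) q - R (N w) q\<bar> \<le> 1 / 2 * dist v w" for v w q
  proof -
    have "\<bar>R (N v) q - R (N w) q\<bar> = \<bar>R (\<lambda>p. N v p - N w p) q\<bar>" by (simp add: R_diff[OF Ni Ni])
    also have "\<dots> \<le> \<delta> / 2 * (\<integral>p. \<bar>N v p - N w p\<bar> \<partial>tm)" by (rule abs_R_le) (use Ni in auto)
    also have "\<dots> \<le> \<delta> / 2 * (dist v w / \<delta>)"
      using delta Nb Ni by (intro mult_left_mono tm.integral_le_const) auto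
    finally show ?thesis using delta by simp
  qed
  have R0: "R (N 0) q = 0" for q by (simp add: Rop_def N0)
  define F where "F v = Bcontfun (\<lambda>q. \<phi> q + R (N v) q)" for v
  have Fapp: "apply_bcontfun (F v) q = \<phi> q + R (N v) q" for v q
  proof -
    have "(\<lambda>q. \<phi> q + R (N v) q) \<in> bcontfun"
    proof (rule bcontfun_normI)
      show "continuous_on UNIV (\<lambda>q. \<phi> q + R (N v) q)"
        by (intro continuous_on_add cont continuous_Rop[OF g0 zeta Ni])
      show "norm (\<phi> q + R (N v) q) \<le> 1 + 1 / 2 * dist v 0" for q
        using bd[of q] RN[of v q 0] R0[of q] by simp
    qed
    then show ?thesis unfolding F_def by (simp add: Bcontfun_inverse)
  qed
  have "\<exists>!v. F v = v"
  proof (rule banach_fix_type[of "1 / 2"])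
    show "\<forall>v w. dist (F v) (F w) \<le> 1 / 2 * dist v w"
    proof (intro allI dist_bound)
      fix v w q show "dist (apply_bcontfun (F v) q) (apply_bcontfun (F w) q) \<le> 1 / 2 * dist v w"
        using RN[of v q w] by (simp add: Fapp dist_real_def)
    qed
  qed auto
  then obtain v where v: "F v = v" by blast
  have "norm v \<le> 1 + 1 / 2 * norm v"
  proof (rule norm_bound)
    fix q show "norm (apply_bcontfun v q) \<le> 1 + 1 / 2 * norm v"
      using Fapp[of v q] v bd[of q] RN[of v q 0] R0[of q] by simp
  qed
  then have "norm v \<le> 2" by simp
  then have "\<bar>N v q\<bar> \<le> 2 / \<delta>" for q using Nb0[of v q] delta by (smt (verit) divide_right_mono)
  moreover have "D q * N v q - R (N v) q = \<phi> q" for q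
    using Fapp[of v q] v D0[of q] by (simp add: N_def)
  ultimately show ?thesis using Nc by blast
qed

definition sol :: "(3 \<times> bool) option \<Rightarrow> real^3 \<Rightarrow> real" where
  "sol j = (SOME u. continuous_on UNIV u \<and> (\<forall>q. \<bar>u q\<bar> \<le> 2 / \<delta>) \<and> (\<forall>q. D q * u q - R u q = phi K j q))"

lemma sol: "continuous_on UNIV (sol j)" "\<bar>sol j q\<bar> \<le> 2 / \<delta>" "D q * sol j q - R (sol j) q = phi K j q"
proof -
  have "continuous_on UNIV (sol j) \<and> (\<forall>q. \<bar>sol j q\<bar> \<le> 2 / \<delta>) \<and> (\<forall>q. D q * sol j q - R (sol j) q = phi K j q)"
    unfolding sol_def by (rule someI_ex[OF solution_exists[OF continuous_phi abs_phi_le]])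
  then show "continuous_on UNIV (sol j)" "\<bar>sol j q\<bar> \<le> 2 / \<delta>" "D q * sol j q - R (sol j) q = phi K j q" by auto
qed

lemma sol_L2R: "sol j \<in> L2R"
  by (rule L2R_bounded[OF measurable_continuous_tm[OF sol(1)] sol(2)])

lemma Aform_sol: "Aform (sol j) h = (\<integral>q. phi K j q * h q \<partial>tm)"
  unfolding Aform_def sol(3) by (simp add: mult.commute)

definition Mat :: "(3 \<times> bool) option \<Rightarrow> (3 \<times> bool) option \<Rightarrow> real" where
  "Mat j k = (\<integral>q. phi K j q * sol k q \<partial>tm)"

lemma Mat_sym: "Mat j k = Mat k j"
  unfolding Mat_def Aform_sol[symmetric] by (rule Aform_sym[OF sol_L2R sol_L2R])

lemma Mat_None_pos: "0 < Mat None None"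
proof -
  have "0 \<le> (\<integral>q. (sol None q)\<^sup>2 \<partial>tm)" by (rule integral_nonneg_AE) simp
  moreover have "(\<integral>q. (sol None q)\<^sup>2 \<partial>tm) \<noteq> 0"
  proof
    assume "(\<integral>q. (sol None q)\<^sup>2 \<partial>tm) = 0"
    then have z: "AE q in tm. (sol None q)\<^sup>2 = 0"
      using integral_nonneg_eq_0_iff_AE[of tm "\<lambda>q. (sol None q)\<^sup>2"] L2R_D(2)[OF sol_L2R[of None]] by simp
    have R0: "R (sol None) q = 0" for q
      unfolding Rop_def by (rule integral_eq_zero_AE) (use z in eventually_elim, simp)
    have "AE q in tm. False" using z
    proof eventually_elim
      case (elim q)
      then show ?case using sol(3)[of q None] R0[of q] by (simp add: phi_None)
    qed
    then show False by simp
  qed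
  ultimately have "0 < (\<integral>q. (sol None q)\<^sup>2 \<partial>tm)" by linarith
  then have "0 < \<delta> / 2 * (\<integral>q. (sol None q)\<^sup>2 \<partial>tm)" using delta by simp
  also have "\<dots> \<le> Aform (sol None) (sol None)" by (rule Aform_coercive[OF sol_L2R])
  finally show ?thesis by (simp add: Aform_sol Mat_def)
qed

definition hs :: "3 \<times> bool \<Rightarrow> real^3 \<Rightarrow> real" where
  "hs k q = sol (Some k) q - Mat None (Some k) / Mat None None * sol None q"

definition Nmat :: "3 \<times> bool \<Rightarrow> 3 \<times> bool \<Rightarrow> real" where
  "Nmat j k = Mat (Some j) (Some k) - Mat None (Some j) * Mat None (Some k) / Mat None None"

lemma Nmat_sym: "Nmat j k = Nmat k j"
  by (simp add: Nmat_def Mat_sym[of "Some j" "Some k"])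

lemma continuous_hs: "continuous_on UNIV (hs k)"
  unfolding hs_def by (intro continuous_intros sol)

lemma hs_L2R: "hs k \<in> L2R"
  unfolding hs_def using L2R_add[OF sol_L2R[of "Some k"] L2R_scale[OF sol_L2R[of None], of "- (Mat None (Some k) / Mat None None)"]]
  by simp

lemma integral_phi_hs: "(\<integral>q. phi K j q * hs k q \<partial>tm) = Mat j (Some k) - Mat None (Some k) / Mat None None * Mat j None"
proof -
  have i: "integrable tm (\<lambda>q. phi K j q * sol l q)" for l by (intro L2R_mult_integrable L2R_phi sol_L2R)
  have "(\<integral>q. phi K j q * hs k q \<partial>tm) = (\<integral>q. phi K j q * sol (Some k) q - Mat None (Some k) / Mat None None * (phi K j q * sol None q) \<partial>tm)"
    unfolding hs_def by (simp add: algebra_simps)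
  also have "\<dots> = Mat j (Some k) - Mat None (Some k) / Mat None None * Mat j None"
    by (simp only: Bochner_Integration.integral_diff[OF i integrable_mult_right[OF i]] integral_mult_right_zero Mat_def)
  finally show ?thesis .
qed

lemma hs_mean: "(\<integral>q. hs k q \<partial>tm) = 0"
  using integral_phi_hs[of None k] Mat_None_pos by (simp add: phi_None)

lemma coef_hs: "coef K (hs k) j = Nmat j k"
  unfolding coef_def integral_phi_hs Nmat_def by (simp add: Mat_sym[of "Some j" None] mult.commute)

definition wv :: "real^(3 \<times> bool) \<Rightarrow> real^3 \<Rightarrow> real" where
  "wv b q = (\<Sum>k\<in>UNIV. b $ k * hs k q)"

definition yv :: "real^(3 \<times> bool) \<Rightarrow> 3 \<times> bool \<Rightarrow> real" where
  "yv b j = (\<Sum>k\<in>UNIV. b $ k * Nmat j k)"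

lemma continuous_wv: "continuous_on UNIV (wv b)"
  unfolding wv_def by (intro continuous_intros continuous_hs)

lemma wv_L2R: "wv b \<in> L2R"
  unfolding wv_def by (rule L2R_sum) (auto simp: hs_L2R)

lemma coef_wv: "coef K (wv b) j = yv b j"
  unfolding wv_def yv_def by (subst coef_sum) (auto simp: hs_L2R coef_hs)

lemma wv_mean: "(\<integral>q. wv b q \<partial>tm) = 0"
  using integral_sum_scaled[of UNIV "\<lambda>_. 1" hs "\<lambda>k. b $ k"] L2R_integrable[OF hs_L2R]
  by (simp add: wv_def hs_mean)

lemma A_hs: "D q * hs k q - R (hs k) q = phi K (Some k) q - Mat None (Some k) / Mat None None"
proof -
  define c where "c = Mat None (Some k) / Mat None None"
  define f where "f b = (if b then sol (Some k) else sol None)" for b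
  define d where "d b = (if b then 1 else - c)" for b
  have e: "hs k = (\<lambda>x. \<Sum>b\<in>UNIV. d b * f b x)" by (auto simp: hs_def d_def f_def UNIV_bool c_def)
  have "R (hs k) q = (\<Sum>b\<in>UNIV. d b * R (f b) q)"
    unfolding e by (rule R_sum) (auto simp: f_def intro: L2R_integrable[OF sol_L2R])
  then have "R (hs k) q = R (sol (Some k)) q - c * R (sol None) q" by (simp add: d_def f_def UNIV_bool)
  then have "D q * hs k q - R (hs k) q = (D q * sol (Some k) q - R (sol (Some k)) q) - c * (D q * sol None q - R (sol None) q)"
    by (simp add: hs_def c_def algebra_simps)
  then show ?thesis unfolding sol(3) phi_None c_def by simp
qed

lemma A_wv: "D q * wv b q - R (wv b) q = (\<Sum>k\<in>UNIV. b $ k * phi K (Some k) q) - (\<Sum>k\<in>UNIV. b $ k * (Mat None (Some k) / Mat None None))"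
proof -
  have "R (wv b) q = (\<Sum>k\<in>UNIV. b $ k * R (hs k) q)"
    unfolding wv_def by (rule R_sum) (auto intro: L2R_integrable[OF hs_L2R])
  then have "D q * wv b q - R (wv b) q = (\<Sum>k\<in>UNIV. b $ k * (D q * hs k q - R (hs k) q))"
    by (simp add: wv_def sum_distrib_left sum_subtractf right_diff_distrib mult_ac)
  then show ?thesis unfolding A_hs by (simp add: sum_subtractf right_diff_distrib)
qed

lemma Aform_wv:
  assumes f: "f \<in> L2R" "(\<integral>q. f q \<partial>tm) = 0"
  shows "Aform (wv b) f = (\<Sum>k\<in>UNIV. b $ k * coef K f k)"
proof -
  let ?c = "(\<Sum>k\<in>UNIV. b $ k * (Mat None (Some k) / Mat None None))"
  have i: "integrable tm (\<lambda>q. f q * (\<Sum>k\<in>UNIV. b $ k * phi K (Some k) q))"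
    by (intro L2R_mult_integrable f L2R_sum L2R_phi) auto
  have i2: "integrable tm (\<lambda>q. ?c * f q)" using L2R_integrable[OF f(1)] by simp
  have "Aform (wv b) f = (\<integral>q. f q * (\<Sum>k\<in>UNIV. b $ k * phi K (Some k) q) - ?c * f q \<partial>tm)"
    unfolding Aform_def A_wv by (simp add: algebra_simps)
  also have "\<dots> = (\<integral>q. f q * (\<Sum>k\<in>UNIV. b $ k * phi K (Some k) q) \<partial>tm)"
    by (simp only: Bochner_Integration.integral_diff[OF i i2] integral_mult_right_zero f(2) mult_zero_right diff_zero)
  also have "\<dots> = (\<Sum>k\<in>UNIV. b $ k * (\<integral>q. f q * phi K (Some k) q \<partial>tm))"
    by (intro integral_sum_scaled L2R_mult_integrable f L2R_phi)
  finally show ?thesis by (simp add: coef_def mult.commute)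
qed

lemma yv_inj: assumes "\<And>j. yv b j = 0" shows "b = 0"
proof -
  have "Aform (wv b) (wv b) = 0"
    unfolding Aform_wv[OF wv_L2R wv_mean] coef_wv by (simp add: assms)
  then have "\<delta> / 2 * (\<integral>q. (wv b q)\<^sup>2 \<partial>tm) \<le> 0" using Aform_coercive[OF wv_L2R[of b]] by simp
  then have "(\<integral>q. (wv b q)\<^sup>2 \<partial>tm) \<le> 0" using delta by (simp add: mult_le_0_iff)
  moreover have "0 \<le> (\<integral>q. (wv b q)\<^sup>2 \<partial>tm)" by (rule integral_nonneg_AE) simp
  ultimately have "(\<integral>q. (wv b q)\<^sup>2 \<partial>tm) = 0" by simp
  then have z: "AE q in tm. (wv b q)\<^sup>2 = 0"
    using integral_nonneg_eq_0_iff_AE[of tm "\<lambda>q. (wv b q)\<^sup>2"] L2R_D(2)[OF wv_L2R[of b]] by simp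
  have "b $ j = 0" for j
  proof -
    have "Aform (wv b) (phi K (Some j)) = (\<Sum>k\<in>UNIV. b $ k * coef K (phi K (Some j)) k)"
      by (rule Aform_wv[OF L2R_phi phi_mean])
    also have "\<dots> = (\<Sum>k\<in>UNIV. if k = j then b $ j / 2 else 0)"
      unfolding coef_def phi_orthogonal by (intro sum.cong) auto
    also have "\<dots> = b $ j / 2" by simp
    finally have "b $ j / 2 = Aform (phi K (Some j)) (wv b)" using Aform_sym[OF wv_L2R L2R_phi] by simp
    also have "\<dots> = 0" unfolding Aform_def by (rule integral_eq_zero_AE) (use z in eventually_elim, simp)
    finally show ?thesis by simp
  qed
  then show ?thesis by (simp add: vec_eq_iff)
qed

text \<open>The form \<open>\<gamma> * Vform - Aform\<close> in the coordinates \<open>b\<close> of \<open>wv b\<close> (see \<open>Bf_self\<close>).\<close>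

definition Bf :: "real^(3 \<times> bool) \<Rightarrow> real^(3 \<times> bool) \<Rightarrow> real" where
  "Bf b b' = \<gamma> * (\<Sum>j\<in>UNIV. sg j * yv b j * yv b' j) - (\<Sum>j\<in>UNIV. b $ j * yv b' j)"

lemma yv_add: "yv (b + b') j = yv b j + yv b' j"
  by (simp add: yv_def sum.distrib algebra_simps)

lemma yv_scale: "yv (c *\<^sub>R b) j = c * yv b j"
  by (simp add: yv_def sum_distrib_left mult_ac)

lemma yv_swap: "(\<Sum>j\<in>UNIV. b $ j * yv b' j) = (\<Sum>j\<in>UNIV. b' $ j * yv b j)"
  unfolding yv_def sum_distrib_left
  by (subst sum.swap) (intro sum.cong refl, simp add: Nmat_sym mult_ac)

lemma Bf_sym: "Bf b b' = Bf b' b"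
  unfolding Bf_def using yv_swap[of b b'] by (simp add: mult_ac)

lemma bilinear_Bf: "bilinear Bf"
proof -
  have l: "linear (\<lambda>b'. Bf b b')" for b
    by (rule linearI)
      (auto simp: Bf_def yv_add yv_scale algebra_simps sum.distrib sum_distrib_left)
  then show ?thesis unfolding bilinear_def using Bf_sym by (metis (no_types, lifting) ext)
qed

lemma Bf_self: "Bf b b = \<gamma> * Vform K (wv b) - Aform (wv b) (wv b)"
  unfolding Bf_def Vform_def Aform_wv[OF wv_L2R wv_mean] coef_wv by (simp add: power2_eq_square mult.assoc)

lemma form_kernel_eq:
  assumes b: "b \<in> form_kernel Bf" shows "\<gamma> * (sg j * yv b j) = b $ j"
proof -
  define d where "d = (\<chi> j. \<gamma> * (sg j * yv b j) - b $ j)"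
  have "Bf b b' = (\<Sum>j\<in>UNIV. d $ j * yv b' j)" for b'
    unfolding Bf_def d_def sum_distrib_left sum_subtractf[symmetric]
    by (intro sum.cong refl) (simp add: algebra_simps)
  then have "(\<Sum>j\<in>UNIV. b' $ j * yv d j) = 0" for b'
    using b yv_swap[of d b'] by (simp add: form_kernel_def)
  from this[of "\<chi> j. yv d j"] have "(\<Sum>j\<in>UNIV. yv d j * yv d j) = 0" by simp
  then have "yv d j = 0" for j by (cases j) (simp add: sum_nonneg_eq_0_iff)
  then have "d = 0" by (rule yv_inj)
  then have "d $ j = 0" by simp
  then show ?thesis by (simp add: d_def)
qed

lemma kernel_solution:
  assumes b: "b \<in> form_kernel Bf"
  shows "D q * wv b q = (\<integral>p. kern \<gamma> K \<zeta> p q * wv b p \<partial>tm)"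
proof -
  define c where "c = (\<Sum>k\<in>UNIV. b $ k * (Mat None (Some k) / Mat None None))"
  define a where "a = (\<integral>p. dispersion p * wv b p \<partial>tm)"
  have w1: "integrable tm (wv b)" by (rule L2R_integrable[OF wv_L2R])
  have eq1: "D q * wv b q = \<gamma> * (\<Sum>j\<in>UNIV. sg j * coef K (wv b) j * phi K (Some j) q) + R (wv b) q - c" for q
  proof -
    have "b $ k * phi K (Some k) q = \<gamma> * (sg k * coef K (wv b) k * phi K (Some k) q)" for k
      unfolding coef_wv form_kernel_eq[OF b, of k, symmetric] by (simp only: mult.assoc)
    then have "(\<Sum>k\<in>UNIV. b $ k * phi K (Some k) q) = \<gamma> * (\<Sum>j\<in>UNIV. sg j * coef K (wv b) j * phi K (Some j) q)"
      unfolding sum_distrib_left by (intro sum.cong refl)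
    then show ?thesis using A_wv[of q b] unfolding c_def by linarith
  qed
  then have eq2: "(\<integral>p. kern \<gamma> K \<zeta> p q * wv b p \<partial>tm) = D q * wv b q + (c - a)" for q
    unfolding integral_kern_mult[OF g0 zeta w1 wv_mean] a_def by simp
  have "(\<integral>q. D q * wv b q \<partial>tm) = (\<integral>q. D q * wv b q + (c - a) \<partial>tm)"
    using mean_of_Dsym_mult[OF g0 zeta lam w1, of K] wv_mean[of b] unfolding eq2 by simp
  also have "\<dots> = (\<integral>q. D q * wv b q \<partial>tm) + (c - a)"
    using integrable_Dsym_mult[OF g0 zeta lam w1, of K] tm.prob_space by simp
  finally show ?thesis using eq2[of q] by simp
qed

lemma positive_subspace:
  fixes n :: nat
  assumes w: "\<And>i. i < n \<Longrightarrow> w i \<in> L2R" "\<And>i. i < n \<Longrightarrow> (\<integral>q. w i q \<partial>tm) = 0"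
    and pos: "\<And>c. \<exists>i<n. c i \<noteq> 0 \<Longrightarrow>
       Aform (\<lambda>x. \<Sum>i<n. c i * w i x) (\<lambda>x. \<Sum>i<n. c i * w i x) < \<gamma> * Vform K (\<lambda>x. \<Sum>i<n. c i * w i x)"
  shows "\<exists>b. \<forall>c. (\<exists>i<n. c i \<noteq> 0) \<longrightarrow> 0 < Bf (\<Sum>i<n. c i *\<^sub>R b i) (\<Sum>i<n. c i *\<^sub>R b i)"
proof -
  define Y :: "real^(3 \<times> bool) \<Rightarrow> real^(3 \<times> bool)" where "Y b = (\<chi> j. yv b j)" for b
  have lY: "linear Y" by (rule linearI) (auto simp: Y_def vec_eq_iff yv_add yv_scale)
  have "inj Y"
    unfolding linear_injective_0[OF lY]
  proof (intro allI impI)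
    fix x assume "Y x = 0"
    then have "Y x $ j = 0" for j by simp
    then show "x = 0" by (intro yv_inj) (simp add: Y_def)
  qed
  then have "surj Y" using linear_injective_imp_surjective[OF lY] by simp
  define b where "b i = inv Y (\<chi> j. coef K (w i) j)" for i
  have b: "Y (b i) = (\<chi> j. coef K (w i) j)" for i
    unfolding b_def using \<open>surj Y\<close> by (rule surj_f_inv_f)
  have "0 < Bf (\<Sum>i<n. c i *\<^sub>R b i) (\<Sum>i<n. c i *\<^sub>R b i)" if c: "\<exists>i<n. c i \<noteq> 0" for c
  proof -
    define f where "f = (\<lambda>x. \<Sum>i<n. c i * w i x)"
    define \<beta> where "\<beta> = (\<Sum>i<n. c i *\<^sub>R b i)"
    have f: "f \<in> L2R" unfolding f_def by (rule L2R_sum) (auto simp: w)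
    have f0: "(\<integral>q. f q \<partial>tm) = 0"
      using integral_sum_scaled[of "{..<n}" "\<lambda>_. 1" w c] w L2R_integrable by (simp add: f_def)
    have cf: "coef K f j = (\<Sum>i<n. c i * coef K (w i) j)" for j
      unfolding f_def by (rule coef_sum) (simp add: w)
    have "Y \<beta> = (\<chi> j. coef K f j)"
      unfolding \<beta>_def linear_sum[OF lY] linear_scale[OF lY] b by (simp add: vec_eq_iff cf)
    then have y: "yv \<beta> j = coef K f j" for j by (cases j) (simp add: Y_def vec_eq_iff)
    have A1: "Aform (wv \<beta>) f = Aform (wv \<beta>) (wv \<beta>)"
      unfolding Aform_wv[OF f f0] Aform_wv[OF wv_L2R wv_mean] coef_wv y ..
    have d: "(\<lambda>x. f x - wv \<beta> x) \<in> L2R"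
      using L2R_add[OF f L2R_scale[OF wv_L2R, of "- 1" \<beta>]] by simp
    have "0 \<le> \<delta> / 2 * (\<integral>q. (f q - wv \<beta> q)\<^sup>2 \<partial>tm)" using delta by (intro mult_nonneg_nonneg integral_nonneg_AE) auto
    also have "\<dots> \<le> Aform f f - 2 * Aform f (wv \<beta>) + Aform (wv \<beta>) (wv \<beta>)"
      using Aform_coercive[OF d] unfolding Aform_diff_self[OF f wv_L2R] .
    finally have "Aform (wv \<beta>) (wv \<beta>) \<le> Aform f f" using A1 Aform_sym[OF f wv_L2R[of \<beta>]] by simp
    moreover have "Vform K (wv \<beta>) = Vform K f" unfolding Vform_def coef_wv y ..
    ultimately show ?thesis
      using pos[OF c] unfolding Bf_self \<beta>_def[symmetric] f_def[symmetric] by simp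
  qed
  then show ?thesis by blast
qed

lemma Bf_negative:
  assumes gp: "gap_point \<gamma> K lam \<zeta> \<delta>'" and big: "3 * \<gamma> < \<delta>' / 2" and b: "b \<noteq> 0" shows "Bf b b < 0"
proof -
  define X where "X = (\<integral>q. (wv b q)\<^sup>2 \<partial>tm)"
  have X0: "0 \<le> X" unfolding X_def by (rule integral_nonneg_AE) simp
  have A: "\<delta>' / 2 * X \<le> Aform (wv b) (wv b)"
    unfolding X_def by (rule gap_point.Aform_coercive[OF gp wv_L2R])
  have "Vform K (wv b) \<le> 3 * (\<integral>p. \<bar>wv b p\<bar> \<partial>tm)\<^sup>2" by (rule Vform_le[OF L2R_integrable[OF wv_L2R]])
  moreover have "(\<integral>p. \<bar>wv b p\<bar> \<partial>tm)\<^sup>2 \<le> X"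
    unfolding X_def using tm_square_integral[of "\<lambda>p. \<bar>wv b p\<bar>"] L2R_integrable[OF wv_L2R[of b]] L2R_D(2)[OF wv_L2R[of b]] by simp
  ultimately have "Vform K (wv b) \<le> 3 * X" by linarith
  then have V: "\<gamma> * Vform K (wv b) \<le> 3 * \<gamma> * X" using g mult_left_mono[of "Vform K (wv b)" "3 * X" \<gamma>] by simp
  show ?thesis
  proof (cases "X = 0")
    case True
    then have z: "AE q in tm. (wv b q)\<^sup>2 = 0"
      using integral_nonneg_eq_0_iff_AE[of tm "\<lambda>q. (wv b q)\<^sup>2"] L2R_D(2)[OF wv_L2R[of b]] by (simp add: X_def)
    have "yv b j = 0" for j
      unfolding coef_wv[symmetric] coef_def by (rule integral_eq_zero_AE) (use z in eventually_elim, simp)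
    then show ?thesis using yv_inj b by blast
  next
    case False
    then have "3 * \<gamma> * X < \<delta>' / 2 * X" using X0 big by (intro mult_strict_right_mono) auto
    then show ?thesis unfolding Bf_self using A V by linarith
  qed
qed

end

lemma positive_on_span:
  fixes B :: "'a::euclidean_space \<Rightarrow> 'a \<Rightarrow> real" and b :: "nat \<Rightarrow> 'a"
  assumes B: "bilinear B"
    and pos: "\<And>c. \<exists>i<n. c i \<noteq> 0 \<Longrightarrow> 0 < B (\<Sum>i<n. c i *\<^sub>R b i) (\<Sum>i<n. c i *\<^sub>R b i)"
  shows "\<exists>S. positive_on B S \<and> dim S = n"
proof -
  let ?X = "b ` {..<n}"
  have inj: "inj_on b {..<n}"
  proof (rule inj_onI, rule ccontr)
    fix i k assume ik: "i \<in> {..<n}" "k \<in> {..<n}" "b i = b k" "i \<noteq> k"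
    define c where "c j = (if j = i then 1 else if j = k then - 1 else 0 :: real)" for j
    have "(\<Sum>j<n. c j *\<^sub>R b j) = (\<Sum>j\<in>{i, k}. c j *\<^sub>R b j)"
      using ik by (intro sum.mono_neutral_right) (auto simp: c_def)
    also have "\<dots> = 0" using ik by (simp add: c_def)
    finally have "(\<Sum>j<n. c j *\<^sub>R b j) = 0" .
    then show False using pos[of c] ik bilinear_lzero[OF B] by (force simp: c_def)
  qed
  have sum: "(\<Sum>v\<in>?X. u v *\<^sub>R v) = (\<Sum>i<n. u (b i) *\<^sub>R b i)" for u
    by (subst sum.reindex[OF inj]) simp
  have ind: "independent ?X"
  proof (rule ccontr)
    assume "\<not> independent ?X"
    then obtain u where u: "\<exists>v\<in>?X. u v \<noteq> 0" "(\<Sum>v\<in>?X. u v *\<^sub>R v) = 0"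
      by (subst (asm) dependent_finite) auto
    then have "0 < B 0 0" using pos[of "\<lambda>i. u (b i)"] unfolding sum by auto
    then show False using bilinear_lzero[OF B] by simp
  qed
  have "positive_on B (span ?X)"
    unfolding positive_on_def
  proof (intro conjI ballI impI subspace_span)
    fix x assume x: "x \<in> span ?X" "x \<noteq> 0"
    then obtain u where u: "x = (\<Sum>v\<in>?X. u v *\<^sub>R v)" by (subst (asm) span_finite) auto
    then have "\<exists>i<n. u (b i) \<noteq> 0" using x(2) unfolding sum by (metis (no_types, lifting) lessThan_iff scaleR_zero_left sum.neutral)
    then show "0 < B x x" using pos[of "\<lambda>i. u (b i)"] unfolding u sum by simp
  qed
  moreover have "dim (span ?X) = n"
    using dim_eq_card_independent[OF ind] card_image[OF inj] by simp
  ultimately show ?thesis by blast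
qed

lemma multiplicity_pos_imp_eigenvalue:
  assumes "0 < multiplicity_ev M S A z" shows "is_eigenvalue M S A z"
proof -
  obtain m f where m: "0 < enat m" "\<forall>i<m. f i \<in> eigenspace M S A z" "independent_ae M m f"
    using assms unfolding multiplicity_ev_def less_Sup_iff by auto
  then have m0: "0 < m" by (simp add: zero_enat_def)
  have "\<not> (AE x in M. f 0 x = 0)"
  proof
    assume a: "AE x in M. f 0 x = 0"
    have "AE x in M. (\<Sum>i<m. (if i = 0 then 1 else 0) * f i x) = 0"
      using a
    proof eventually_elim
      case (elim x)
      have "(\<Sum>i<m. (if i = 0 then 1 else 0) * f i x) = (\<Sum>i\<in>{0}. (if i = 0 then 1 else 0) * f i x)"
        using m0 by (intro sum.mono_neutral_right) auto
      then show ?case using elim by simp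
    qed
    then have "(if (0::nat) = 0 then 1 else 0 :: complex) = 0"
      using m(3) m0 unfolding independent_ae_def by (elim allE[of _ "\<lambda>i. if i = 0 then 1 else 0"]) blast
    then show False by simp
  qed
  then show ?thesis using m m0 unfolding is_eigenvalue_def by blast
qed

lemma eigenvalue_count_ge:
  assumes Z: "finite Z" "Z \<subseteq> I" and d: "\<And>z. z \<in> Z \<Longrightarrow> enat (d z) \<le> multiplicity_ev M S A (of_real z)"
    and n: "n \<le> (\<Sum>z\<in>Z. d z)"
  shows "enat n \<le> eigenvalue_count M S A I"
proof -
  have "enat n \<le> enat (\<Sum>z\<in>Z. d z)" using n by simp
  also have "\<dots> = (\<Sum>z\<in>Z. enat (d z))" using Z(1) by (induction Z rule: finite_induct) (auto simp: zero_enat_def plus_enat_simps(1)[symmetric] simp del: plus_enat_simps(1))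
  also have "\<dots> \<le> (\<Sum>z\<in>Z. multiplicity_ev M S A (of_real z))" by (rule sum_mono) (rule d)
  also have "\<dots> \<le> eigenvalue_count M S A I"
    unfolding eigenvalue_count_def by (rule SUP_upper) (use Z in auto)
  finally show ?thesis .
qed

lemma measurable_continuous_tm2:
  fixes F :: "real^3 \<Rightarrow> real^3 \<Rightarrow> real"
  assumes "continuous_on UNIV (\<lambda>x. F (fst x) (snd x))"
  shows "(\<lambda>x. F (fst x) (snd x)) \<in> borel_measurable (tm \<Otimes>\<^sub>M tm)"
proof -
  have id: "(\<lambda>x. x) \<in> borel_measurable tm" by (rule borel_measurable_tm) simp
  show ?thesis
    by (rule borel_measurable_continuous_Pair[OF _ _ assms])
      (rule measurable_compose[OF measurable_fst id] measurable_compose[OF measurable_snd id])+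
qed

context gap_point
begin

lemma wv_bounded: "\<exists>C. \<forall>q. \<bar>wv b q\<bar> \<le> C"
proof -
  define C where "C k = 2 / \<delta> + \<bar>Mat None (Some k) / Mat None None\<bar> * (2 / \<delta>)" for k
  have "\<bar>hs k q\<bar> \<le> C k" for k q
  proof -
    have "\<bar>hs k q\<bar> \<le> \<bar>sol (Some k) q\<bar> + \<bar>Mat None (Some k) / Mat None None\<bar> * \<bar>sol None q\<bar>"
      unfolding hs_def abs_mult[symmetric] by (rule abs_triangle_ineq4)
    also have "\<dots> \<le> C k" unfolding C_def by (intro add_mono mult_left_mono sol) simp
    finally show ?thesis .
  qed
  then have "\<bar>wv b q\<bar> \<le> (\<Sum>k\<in>UNIV. \<bar>b $ k\<bar> * C k)" for q
    unfolding wv_def by (intro order_trans[OF sum_abs sum_mono]) (simp add: abs_mult mult_left_mono)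
  then show ?thesis by blast
qed

lemma wv_sum: "finite A \<Longrightarrow> wv (\<Sum>i\<in>A. r i *\<^sub>R b i) q = (\<Sum>i\<in>A. r i * wv (b i) q)"
  by (induction A rule: finite_induct)
    (simp_all add: wv_def algebra_simps sum.distrib sum_distrib_left)

lemma wv_AE_zero: assumes "AE q in tm. wv b q = 0" shows "b = 0"
proof (rule yv_inj)
  fix j show "yv b j = 0"
    unfolding coef_wv[symmetric] coef_def by (rule integral_eq_zero_AE) (use assms in eventually_elim, simp)
qed

definition ef :: "real^(3 \<times> bool) \<Rightarrow> (real^3) \<times> (real^3) \<Rightarrow> real" where
  "ef b x = lam * (wv b (snd x) - wv b (fst x)) / (total_energy \<gamma> K (fst x) (snd x) + \<zeta>)"

lemma energy_pos: "0 < total_energy \<gamma> K p q + \<zeta>"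
  using total_energy_nonneg[OF g0, of K p q] zeta by linarith

lemma ef_antisym: "ef b (p, q) = - ef b (q, p)"
  by (simp add: ef_def total_energy_sym[of \<gamma> K p q] divide_inverse algebra_simps)

lemma ef_measurable: "ef b \<in> borel_measurable (tm \<Otimes>\<^sub>M tm)"
proof -
  have ne: "total_energy \<gamma> K p q + \<zeta> \<noteq> 0" for p q using energy_pos[of p q] by simp
  have c: "continuous_on UNIV (\<lambda>x. wv b (h x))" if "continuous_on UNIV h" for h :: "(real^3) \<times> (real^3) \<Rightarrow> real^3"
    by (rule continuous_on_compose2[OF continuous_wv that]) simp
  have "continuous_on UNIV (\<lambda>x. lam * (wv b (snd x) - wv b (fst x)) / (total_energy \<gamma> K (fst x) (snd x) + \<zeta>))"
    using ne by (intro continuous_intros c) auto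
  from measurable_continuous_tm2[of "\<lambda>p q. lam * (wv b q - wv b p) / (total_energy \<gamma> K p q + \<zeta>)", OF this]
  show ?thesis unfolding ef_def .
qed

lemma ef_mean:
  assumes b: "b \<in> form_kernel Bf"
  shows "integrable tm (\<lambda>s. ef b (s, q))" "(\<integral>s. ef b (s, q) \<partial>tm) = wv b q"
proof -
  have w1: "integrable tm (wv b)" by (rule L2R_integrable[OF wv_L2R])
  have e: "ef b (s, q) = lam / \<zeta>\<^sup>2 * (wv b q * kern \<gamma> K \<zeta> s q - kern \<gamma> K \<zeta> s q * wv b s)" for s
  proof -
    have "kern \<gamma> K \<zeta> s q / \<zeta>\<^sup>2 = 1 / (total_energy \<gamma> K s q + \<zeta>)" using zeta by (simp add: kern_def)
    then have "ef b (s, q) = lam * (wv b q - wv b s) * (kern \<gamma> K \<zeta> s q / \<zeta>\<^sup>2)" by (simp add: ef_def)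
    then show ?thesis by (simp add: algebra_simps diff_divide_distrib)
  qed
  have i1: "integrable tm (\<lambda>s. wv b q * kern \<gamma> K \<zeta> s q)" using integrable_kern[OF g0 zeta] by simp
  note i2 = integrable_kern_mult[OF g0 zeta w1, of K q]
  show "integrable tm (\<lambda>s. ef b (s, q))" unfolding e by (intro integrable_mult_right Bochner_Integration.integrable_diff i1 i2)
  have "(\<integral>s. ef b (s, q) \<partial>tm) = lam / \<zeta>\<^sup>2 * (wv b q * (\<integral>s. kern \<gamma> K \<zeta> s q \<partial>tm) - (\<integral>s. kern \<gamma> K \<zeta> s q * wv b s \<partial>tm))"
    unfolding e by (simp only: integral_mult_right_zero Bochner_Integration.integral_diff[OF i1 i2])
  also have "\<dots> = lam / \<zeta>\<^sup>2 * (wv b q * (\<integral>s. kern \<gamma> K \<zeta> s q \<partial>tm) - D q * wv b q)"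
    by (simp only: kernel_solution[OF b])
  also have "\<dots> = wv b q" unfolding Dsym_def using lam zeta by (simp add: algebra_simps)
  finally show "(\<integral>s. ef b (s, q) \<partial>tm) = wv b q" .
qed

lemma ef_eigenspace:
  assumes b: "b \<in> form_kernel Bf"
  shows "(\<lambda>x. complex_of_real (ef b x)) \<in> eigenspace torus_measure2 L2_antisym (H_op \<gamma> lam K) (of_real (- \<zeta>))"
proof -
  let ?f = "\<lambda>x. complex_of_real (ef b x)"
  have fm [measurable]: "?f \<in> borel_measurable (tm \<Otimes>\<^sub>M tm)" using ef_measurable[of b] by measurable
  obtain C where C: "\<And>q. \<bar>wv b q\<bar> \<le> C" using wv_bounded by blast
  have bd: "\<bar>ef b x\<bar> \<le> lam * (2 * C) / \<zeta>" for x
  proof -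
    have "\<bar>lam * (wv b (snd x) - wv b (fst x))\<bar> \<le> lam * (2 * C)"
      using C[of "fst x"] C[of "snd x"] lam by (simp add: abs_mult)
    moreover have "0 \<le> C" using C[of 0] by linarith
    ultimately show ?thesis unfolding ef_def abs_divide
      using energy_pos[of "fst x" "snd x"] total_energy_nonneg[OF g0, of K "fst x" "snd x"] zeta lam
      by (intro frac_le) auto
  qed
  have "integrable (tm \<Otimes>\<^sub>M tm) (\<lambda>x. (cmod (?f x))\<^sup>2)"
  proof (rule tm2.P.integrable_const_bound[of _ "(lam * (2 * C) / \<zeta>)\<^sup>2"])
    show "AE x in tm \<Otimes>\<^sub>M tm. norm ((cmod (?f x))\<^sup>2) \<le> (lam * (2 * C) / \<zeta>)\<^sup>2"
      using power_mono[OF bd abs_ge_zero, where n = 2] by (intro AE_I2) simp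
  qed measurable
  moreover have "?f (p, q) = - ?f (q, p)" for p q by (subst ef_antisym) simp
  ultimately have "?f \<in> L2_antisym" by (intro L2_antisymI fm)
  moreover have "AE x in torus_measure2. H_op \<gamma> lam K ?f x = of_real (- \<zeta>) * ?f x"
    unfolding AE_tm2[symmetric]
  proof (rule AE_I2)
    fix x assume "x \<in> space (tm \<Otimes>\<^sub>M tm)"
    then obtain p q where x: "x = (p, q)" "p \<in> torus3" "q \<in> torus3" by (auto simp: space_pair_measure)
    have 1: "(\<integral>s. ?f (s, q) \<partial>tm) = of_real (wv b q)"
      by (simp add: ef_mean(2)[OF b])
    have 2: "(\<integral>s. ?f (p, s) \<partial>tm) = - of_real (wv b p)"
      by (subst ef_antisym) (simp add: ef_mean(2)[OF b])
    have "ef b (p, q) * (total_energy \<gamma> K p q + \<zeta>) = lam * (wv b q - wv b p)"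
      using energy_pos[of p q] by (simp add: ef_def)
    then have "total_energy \<gamma> K p q * ef b (p, q) - lam * wv b q + lam * wv b p = - \<zeta> * ef b (p, q)"
      by (simp add: algebra_simps)
    then have "complex_of_real (total_energy \<gamma> K p q * ef b (p, q) - lam * wv b q + lam * wv b p) = of_real (- \<zeta> * ef b (p, q))"
      by (rule arg_cong)
    then show "H_op \<gamma> lam K ?f x = of_real (- \<zeta>) * ?f x"
      unfolding x(1) H_op_tm[OF fm x(2,3)] 1 2 by simp
  qed
  ultimately show ?thesis by (simp add: eigenspace_def)
qed

lemma multiplicity_ge_kernel_dim:
  "enat (dim (form_kernel Bf)) \<le> multiplicity_ev torus_measure2 L2_antisym (H_op \<gamma> lam K) (of_real (- \<zeta>))"
proof -
  obtain X where X: "X \<subseteq> form_kernel Bf" "independent X" "card X = dim (form_kernel Bf)"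
    using basis_exists[of "form_kernel Bf"] by metis
  have finX: "finite X" by (rule independent_imp_finite[OF X(2)])
  obtain b where b: "bij_betw b {..<card X} X"
    using ex_bij_betw_nat_finite[OF finX] by (auto simp: atLeast0LessThan)
  let ?d = "card X"
  have bk: "b i \<in> form_kernel Bf" if "i < ?d" for i using that b X(1) by (auto simp: bij_betw_def)
  have lin: "r i = 0" if "(\<Sum>i<?d. r i *\<^sub>R b i) = 0" "i < ?d" for r i
  proof -
    define u where "u v = r (the_inv_into {..<?d} b v)" for v
    have ub: "u (b i) = r i" if "i < ?d" for i
      using that b by (simp add: u_def bij_betw_def the_inv_into_f_f)
    have "(\<Sum>v\<in>X. u v *\<^sub>R v) = (\<Sum>i<?d. u (b i) *\<^sub>R b i)" by (rule sum.reindex_bij_betw[OF b, symmetric])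
    also have "\<dots> = 0" using that(1) ub by simp
    finally have "u (b i) = 0" using independentD[OF X(2) finX subset_refl] b that(2) by (auto simp: bij_betw_def)
    then show ?thesis using ub that(2) by simp
  qed
  have "independent_ae torus_measure2 ?d (\<lambda>i x. complex_of_real (ef (b i) x))"
    unfolding independent_ae_def
  proof (intro allI impI)
    fix c :: "nat \<Rightarrow> complex" and i
    assume a: "AE x in torus_measure2. (\<Sum>i<?d. c i * complex_of_real (ef (b i) x)) = 0" and i: "i < ?d"
    have "AE q in tm. AE p in tm. (\<Sum>i<?d. c i * complex_of_real (ef (b i) (q, p))) = 0"
      using a unfolding AE_tm2[symmetric] by (rule tm2.AE_pair)
    then have ae: "AE q in tm. (\<Sum>i<?d. c i * complex_of_real (wv (b i) q)) = 0"
    proof eventually_elim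
      case (elim q)
      have ii: "integrable tm (\<lambda>p. c i * complex_of_real (ef (b i) (p, q)))" if "i < ?d" for i
        by (intro integrable_mult_right integrable_of_real ef_mean(1)[OF bk[OF that]])
      have "(\<Sum>i<?d. c i * complex_of_real (wv (b i) q)) = (\<Sum>i<?d. (\<integral>p. c i * complex_of_real (ef (b i) (p, q)) \<partial>tm))"
        by (intro sum.cong refl) (simp add: ef_mean(2)[OF bk])
      also have "\<dots> = (\<integral>p. (\<Sum>i<?d. c i * complex_of_real (ef (b i) (p, q))) \<partial>tm)"
        by (rule Bochner_Integration.integral_sum[symmetric]) (simp add: ii)
      also have "\<dots> = 0"
      proof (rule integral_eq_zero_AE)
        show "AE p in tm. (\<Sum>i<?d. c i * complex_of_real (ef (b i) (p, q))) = 0"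
          using elim
        proof eventually_elim
          case (elim p)
          have "(\<Sum>i<?d. c i * complex_of_real (ef (b i) (p, q))) = - (\<Sum>i<?d. c i * complex_of_real (ef (b i) (q, p)))"
            unfolding sum_negf[symmetric] by (intro sum.cong refl, subst ef_antisym) simp
          then show ?case using elim by simp
        qed
      qed
      finally show ?case .
    qed
    have "AE q in tm. wv (\<Sum>i<?d. Re (c i) *\<^sub>R b i) q = 0" using ae
    proof eventually_elim
      case (elim q)
      have "Re (\<Sum>i<?d. c i * complex_of_real (wv (b i) q)) = (\<Sum>i<?d. Re (c i) * wv (b i) q)" by simp
      then show ?case using elim by (simp add: wv_sum)
    qed
    from lin[OF wv_AE_zero[OF this] i] have re: "Re (c i) = 0" .
    have "AE q in tm. wv (\<Sum>i<?d. Im (c i) *\<^sub>R b i) q = 0" using ae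
    proof eventually_elim
      case (elim q)
      have "Im (\<Sum>i<?d. c i * complex_of_real (wv (b i) q)) = (\<Sum>i<?d. Im (c i) * wv (b i) q)" by simp
      then show ?case using elim by (simp add: wv_sum)
    qed
    from lin[OF wv_AE_zero[OF this] i] have "Im (c i) = 0" .
    with re show "c i = 0" by (simp add: complex_eq_iff)
  qed
  moreover have "\<forall>i<?d. (\<lambda>x. complex_of_real (ef (b i) x)) \<in> eigenspace torus_measure2 L2_antisym (H_op \<gamma> lam K) (of_real (- \<zeta>))"
    using ef_eigenspace[OF bk] by blast
  ultimately show ?thesis unfolding multiplicity_ev_def X(3)[symmetric]
    by (intro Sup_upper) (auto intro!: exI[of _ "card X"])
qed

end

section \<open>Existence of eigenvalues\<close>

lemma Dsym_lipschitz:
  assumes g: "0 \<le> \<gamma>" and z: "0 < z0" "z0 \<le> \<zeta>" "z0 \<le> \<zeta>'" "\<zeta> \<le> lam" "\<zeta>' \<le> lam"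
  shows "\<bar>rem \<gamma> K \<zeta> p q - rem \<gamma> K \<zeta>' p q\<bar> \<le> (emax \<gamma>)\<^sup>2 / z0\<^sup>2 * \<bar>\<zeta> - \<zeta>'\<bar>"
    and "\<bar>Dsym \<gamma> K lam \<zeta> q - Dsym \<gamma> K lam \<zeta>' q\<bar> \<le> (3 + (emax \<gamma>)\<^sup>2 / z0\<^sup>2) * \<bar>\<zeta> - \<zeta>'\<bar>"
proof -
  let ?M = "(emax \<gamma>)\<^sup>2"
  have zp: "0 < \<zeta>" "0 < \<zeta>'" "0 < lam" using z by auto
  have rem: "\<bar>rem \<gamma> K \<zeta> p q - rem \<gamma> K \<zeta>' p q\<bar> \<le> ?M / z0\<^sup>2 * \<bar>\<zeta> - \<zeta>'\<bar>" for p q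
  proof -
    define x where "x = total_energy \<gamma> K p q"
    have x: "0 \<le> x" "x \<le> emax \<gamma>" unfolding x_def by (auto intro: total_energy_nonneg total_energy_le g)
    have p: "x + \<zeta> > 0" "x + \<zeta>' > 0" using x zp by auto
    have "x\<^sup>2 / (x + \<zeta>) - x\<^sup>2 / (x + \<zeta>') = x\<^sup>2 / ((x + \<zeta>) * (x + \<zeta>')) * (\<zeta>' - \<zeta>)"
      using p by (simp add: field_simps)
    then have "\<bar>rem \<gamma> K \<zeta> p q - rem \<gamma> K \<zeta>' p q\<bar> = x\<^sup>2 / ((x + \<zeta>) * (x + \<zeta>')) * \<bar>\<zeta> - \<zeta>'\<bar>"
      using p by (simp add: rem_def x_def[symmetric] abs_mult abs_minus_commute)
    also have "\<dots> \<le> ?M / z0\<^sup>2 * \<bar>\<zeta> - \<zeta>'\<bar>"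
    proof (rule mult_right_mono)
      have "z0 * z0 \<le> (x + \<zeta>) * (x + \<zeta>')" using x z by (intro mult_mono) auto
      then show "x\<^sup>2 / ((x + \<zeta>) * (x + \<zeta>')) \<le> ?M / z0\<^sup>2"
        using x z(1) by (intro frac_le power_mono) (auto simp: power2_eq_square)
    qed simp
    finally show ?thesis .
  qed
  then show "\<bar>rem \<gamma> K \<zeta> p q - rem \<gamma> K \<zeta>' p q\<bar> \<le> ?M / z0\<^sup>2 * \<bar>\<zeta> - \<zeta>'\<bar>" .
  have ir: "integrable tm (\<lambda>p. rem \<gamma> K \<zeta> p q)" "integrable tm (\<lambda>p. rem \<gamma> K \<zeta>' p q)" using integrable_rem[OF g] zp by auto
  have "\<bar>(\<integral>p. rem \<gamma> K \<zeta> p q \<partial>tm) - (\<integral>p. rem \<gamma> K \<zeta>' p q \<partial>tm)\<bar> = \<bar>\<integral>p. rem \<gamma> K \<zeta> p q - rem \<gamma> K \<zeta>' p q \<partial>tm\<bar>"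
    using ir by simp
  also have "\<dots> \<le> (\<integral>p. \<bar>rem \<gamma> K \<zeta> p q - rem \<gamma> K \<zeta>' p q\<bar> \<partial>tm)" by (rule integral_abs_bound)
  also have "\<dots> \<le> ?M / z0\<^sup>2 * \<bar>\<zeta> - \<zeta>'\<bar>" using ir rem by (intro tm.integral_le_const) auto
  finally have 1: "\<bar>(\<integral>p. rem \<gamma> K \<zeta> p q \<partial>tm) - (\<integral>p. rem \<gamma> K \<zeta>' p q \<partial>tm)\<bar> \<le> ?M / z0\<^sup>2 * \<bar>\<zeta> - \<zeta>'\<bar>" .
  have "\<zeta>\<^sup>2 / lam - \<zeta>'\<^sup>2 / lam = (\<zeta> + \<zeta>') / lam * (\<zeta> - \<zeta>')"
    by (simp add: power2_eq_square algebra_simps diff_divide_distrib add_divide_distrib)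
  then have "\<bar>\<zeta>\<^sup>2 / lam - \<zeta>'\<^sup>2 / lam\<bar> = (\<zeta> + \<zeta>') / lam * \<bar>\<zeta> - \<zeta>'\<bar>" using zp by (simp add: abs_mult)
  also have "\<dots> \<le> 2 * \<bar>\<zeta> - \<zeta>'\<bar>" using z zp by (intro mult_right_mono) (auto simp: divide_le_eq)
  finally have 2: "\<bar>\<zeta>\<^sup>2 / lam - \<zeta>'\<^sup>2 / lam\<bar> \<le> 2 * \<bar>\<zeta> - \<zeta>'\<bar>" .
  have "\<bar>Dsym \<gamma> K lam \<zeta> q - Dsym \<gamma> K lam \<zeta>' q\<bar> \<le> \<bar>\<zeta> - \<zeta>'\<bar> + 2 * \<bar>\<zeta> - \<zeta>'\<bar> + ?M / z0\<^sup>2 * \<bar>\<zeta> - \<zeta>'\<bar>"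
    unfolding Dsym_eq[OF g zp(1)] Dsym_eq[OF g zp(2)] using 1 2 by linarith
  then show "\<bar>Dsym \<gamma> K lam \<zeta> q - Dsym \<gamma> K lam \<zeta>' q\<bar> \<le> (3 + ?M / z0\<^sup>2) * \<bar>\<zeta> - \<zeta>'\<bar>" by (simp add: algebra_simps)
qed

lemma Mat_lipschitz:
  assumes G: "gap_point \<gamma> K lam \<zeta> \<delta>" and G': "gap_point \<gamma> K lam \<zeta>' \<delta>"
    and z: "0 < z0" "z0 \<le> \<zeta>" "z0 \<le> \<zeta>'" "\<zeta> \<le> lam" "\<zeta>' \<le> lam"
  shows "\<bar>gap_point.Mat \<gamma> K lam \<zeta> \<delta> j k - gap_point.Mat \<gamma> K lam \<zeta>' \<delta> j k\<bar>
     \<le> (2 / \<delta>)\<^sup>2 * (3 + 2 * ((emax \<gamma>)\<^sup>2 / z0\<^sup>2)) * \<bar>\<zeta> - \<zeta>'\<bar>"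
proof -
  interpret G: gap_point \<gamma> K lam \<zeta> \<delta> by (rule G)
  interpret G': gap_point \<gamma> K lam \<zeta>' \<delta> by (rule G')
  define f h where "f = G.sol j" and "h = G'.sol k"
  have f: "f \<in> L2R" and h: "h \<in> L2R" unfolding f_def h_def by (rule G.sol_L2R, rule G'.sol_L2R)
  have fb: "\<bar>f q\<bar> \<le> 2 / \<delta>" and hb: "\<bar>h q\<bar> \<le> 2 / \<delta>" for q unfolding f_def h_def by (rule G.sol, rule G'.sol)
  let ?L = "(emax \<gamma>)\<^sup>2 / z0\<^sup>2"
  have L0: "0 \<le> ?L" by simp
  have 1: "G'.Mat j k = G.Aform f h" unfolding f_def G.Aform_sol G'.Mat_def h_def ..
  have "G.Mat j k = G.Mat k j" by (rule G.Mat_sym)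
  also have "\<dots> = G'.Aform h f" unfolding h_def G'.Aform_sol G.Mat_def f_def ..
  also have "\<dots> = G'.Aform f h" by (rule G'.Aform_sym[OF h f])
  finally have 2: "G.Mat j k = G'.Aform f h" .
  have R: "\<bar>G.R f q - G'.R f q\<bar> \<le> 2 / \<delta> * (?L * \<bar>\<zeta> - \<zeta>'\<bar>)" for q
  proof -
    note i = integrable_rem_mult[OF G.g0 G.zeta L2R_integrable[OF f], of K q] integrable_rem_mult[OF G.g0 G'.zeta L2R_integrable[OF f], of K q]
    have "\<bar>G.R f q - G'.R f q\<bar> = \<bar>\<integral>p. rem \<gamma> K \<zeta> p q * f p - rem \<gamma> K \<zeta>' p q * f p \<partial>tm\<bar>"
      unfolding Rop_def using i by simp
    also have "\<dots> \<le> (\<integral>p. \<bar>rem \<gamma> K \<zeta> p q * f p - rem \<gamma> K \<zeta>' p q * f p\<bar> \<partial>tm)" by (rule integral_abs_bound)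
    also have "\<dots> \<le> 2 / \<delta> * (?L * \<bar>\<zeta> - \<zeta>'\<bar>)"
    proof (rule tm.integral_le_const)
      show "AE p in tm. \<bar>rem \<gamma> K \<zeta> p q * f p - rem \<gamma> K \<zeta>' p q * f p\<bar> \<le> 2 / \<delta> * (?L * \<bar>\<zeta> - \<zeta>'\<bar>)"
      proof (rule AE_I2)
        fix p
        have "\<bar>rem \<gamma> K \<zeta> p q * f p - rem \<gamma> K \<zeta>' p q * f p\<bar> = \<bar>f p\<bar> * \<bar>rem \<gamma> K \<zeta> p q - rem \<gamma> K \<zeta>' p q\<bar>"
          by (simp add: abs_mult[symmetric] algebra_simps)
        also have "\<dots> \<le> 2 / \<delta> * (?L * \<bar>\<zeta> - \<zeta>'\<bar>)"
          by (rule mult_mono[OF fb Dsym_lipschitz(1)[OF G.g0 z]]) (use G.delta in auto)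
        finally show "\<bar>rem \<gamma> K \<zeta> p q * f p - rem \<gamma> K \<zeta>' p q * f p\<bar> \<le> 2 / \<delta> * (?L * \<bar>\<zeta> - \<zeta>'\<bar>)" .
      qed
    qed (use i in auto)
    finally show ?thesis .
  qed
  have i1: "integrable tm (\<lambda>q. h q * (G.D q * f q - G.R f q))" by (intro L2R_mult_integrable h G.A_L2R f)
  have i2: "integrable tm (\<lambda>q. h q * (G'.D q * f q - G'.R f q))" by (intro L2R_mult_integrable h G'.A_L2R f)
  have "\<bar>G.Mat j k - G'.Mat j k\<bar> = \<bar>\<integral>q. h q * (G'.D q * f q - G'.R f q) - h q * (G.D q * f q - G.R f q) \<partial>tm\<bar>"
    unfolding 1 2 G.Aform_def G'.Aform_def using i1 i2 by simp
  also have "\<dots> \<le> (\<integral>q. \<bar>h q * (G'.D q * f q - G'.R f q) - h q * (G.D q * f q - G.R f q)\<bar> \<partial>tm)"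
    by (rule integral_abs_bound)
  also have "\<dots> \<le> 2 / \<delta> * ((3 + ?L) * \<bar>\<zeta> - \<zeta>'\<bar> * (2 / \<delta>) + 2 / \<delta> * (?L * \<bar>\<zeta> - \<zeta>'\<bar>))"
  proof (rule tm.integral_le_const)
    show "AE q in tm. \<bar>h q * (G'.D q * f q - G'.R f q) - h q * (G.D q * f q - G.R f q)\<bar>
        \<le> 2 / \<delta> * ((3 + ?L) * \<bar>\<zeta> - \<zeta>'\<bar> * (2 / \<delta>) + 2 / \<delta> * (?L * \<bar>\<zeta> - \<zeta>'\<bar>))"
    proof (rule AE_I2)
      fix q
      have "h q * (G'.D q * f q - G'.R f q) - h q * (G.D q * f q - G.R f q) = h q * (- ((G.D q - G'.D q) * f q) + (G.R f q - G'.R f q))"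
        by (simp add: algebra_simps)
      then have "\<bar>h q * (G'.D q * f q - G'.R f q) - h q * (G.D q * f q - G.R f q)\<bar> = \<bar>h q\<bar> * \<bar>- ((G.D q - G'.D q) * f q) + (G.R f q - G'.R f q)\<bar>"
        by (simp only: abs_mult)
      also have "\<dots> \<le> 2 / \<delta> * ((3 + ?L) * \<bar>\<zeta> - \<zeta>'\<bar> * (2 / \<delta>) + 2 / \<delta> * (?L * \<bar>\<zeta> - \<zeta>'\<bar>))"
      proof (rule mult_mono[OF hb])
        have "\<bar>(G.D q - G'.D q) * f q\<bar> \<le> (3 + ?L) * \<bar>\<zeta> - \<zeta>'\<bar> * (2 / \<delta>)"
          unfolding abs_mult by (rule mult_mono[OF Dsym_lipschitz(2)[OF G.g0 z] fb]) (use L0 in auto)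
        then show "\<bar>- ((G.D q - G'.D q) * f q) + (G.R f q - G'.R f q)\<bar> \<le> (3 + ?L) * \<bar>\<zeta> - \<zeta>'\<bar> * (2 / \<delta>) + 2 / \<delta> * (?L * \<bar>\<zeta> - \<zeta>'\<bar>)"
          using R[of q] by linarith
      qed (use G.delta in auto)
      finally show "\<bar>h q * (G'.D q * f q - G'.R f q) - h q * (G.D q * f q - G.R f q)\<bar>
        \<le> 2 / \<delta> * ((3 + ?L) * \<bar>\<zeta> - \<zeta>'\<bar> * (2 / \<delta>) + 2 / \<delta> * (?L * \<bar>\<zeta> - \<zeta>'\<bar>))" .
    qed
  qed (use i1 i2 in auto)
  also have "\<dots> = (2 / \<delta>)\<^sup>2 * (3 + 2 * ?L) * \<bar>\<zeta> - \<zeta>'\<bar>"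
  proof -
    have "d * ((3 + l) * e * d + d * (l * e)) = d\<^sup>2 * (3 + 2 * l) * e" for d l e :: real
      by (simp add: power2_eq_square algebra_simps)
    then show ?thesis .
  qed
  finally show ?thesis .
qed

lemma continuous_on_lipschitz_real:
  fixes f :: "real \<Rightarrow> real"
  assumes "\<And>x y. x \<in> S \<Longrightarrow> y \<in> S \<Longrightarrow> \<bar>f x - f y\<bar> \<le> C * \<bar>x - y\<bar>"
  shows "continuous_on S f"
proof (rule lipschitz_on_continuous_on[of "max C 0"], rule lipschitz_onI)
  fix x y assume "x \<in> S" "y \<in> S"
  then have "\<bar>f x - f y\<bar> \<le> C * \<bar>x - y\<bar>" by (rule assms)
  also have "\<dots> \<le> max C 0 * \<bar>x - y\<bar>" by (intro mult_right_mono) auto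
  finally show "dist (f x) (f y) \<le> max C 0 * dist x y" by (simp add: dist_real_def)
qed simp

lemma Bf_continuous:
  assumes G: "\<And>z. z \<in> {a..b} \<Longrightarrow> gap_point \<gamma> K lam (- z) \<delta>"
    and z0: "0 < z0" "b \<le> - z0" "- lam \<le> a"
  shows "continuous_on {a..b} (\<lambda>z. gap_point.Bf \<gamma> K lam (- z) \<delta> \<beta> \<beta>')"
proof -
  have M: "continuous_on {a..b} (\<lambda>z. gap_point.Mat \<gamma> K lam (- z) \<delta> j k)" for j k
  proof (rule continuous_on_lipschitz_real)
    fix x y assume xy: "x \<in> {a..b}" "y \<in> {a..b}"
    have "\<bar>gap_point.Mat \<gamma> K lam (- x) \<delta> j k - gap_point.Mat \<gamma> K lam (- y) \<delta> j k\<bar>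
      \<le> (2 / \<delta>)\<^sup>2 * (3 + 2 * ((emax \<gamma>)\<^sup>2 / z0\<^sup>2)) * \<bar>- x - - y\<bar>"
      by (rule Mat_lipschitz[OF G[OF xy(1)] G[OF xy(2)] z0(1)]) (use xy z0 in auto)
    then show "\<bar>gap_point.Mat \<gamma> K lam (- x) \<delta> j k - gap_point.Mat \<gamma> K lam (- y) \<delta> j k\<bar>
      \<le> (2 / \<delta>)\<^sup>2 * (3 + 2 * ((emax \<gamma>)\<^sup>2 / z0\<^sup>2)) * \<bar>x - y\<bar>" by (simp add: abs_minus_commute)
  qed
  have ne: "gap_point.Mat \<gamma> K lam (- z) \<delta> None None \<noteq> 0" if "z \<in> {a..b}" for z
    using gap_point.Mat_None_pos[OF G[OF that]] by simp
  have N: "continuous_on {a..b} (\<lambda>z. gap_point.Nmat \<gamma> K lam (- z) \<delta> j k)" for j k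
  proof -
    have "continuous_on {a..b} (\<lambda>z. gap_point.Mat \<gamma> K lam (- z) \<delta> (Some j) (Some k)
       - gap_point.Mat \<gamma> K lam (- z) \<delta> None (Some j) * gap_point.Mat \<gamma> K lam (- z) \<delta> None (Some k) / gap_point.Mat \<gamma> K lam (- z) \<delta> None None)"
      by (intro continuous_intros M) (use ne in auto)
    then show ?thesis by (rule continuous_on_cong[THEN iffD1, OF refl, rotated]) (simp add: gap_point.Nmat_def[OF G])
  qed
  have Y: "continuous_on {a..b} (\<lambda>z. gap_point.yv \<gamma> K lam (- z) \<delta> v j)" for v j
  proof -
    have "continuous_on {a..b} (\<lambda>z. \<Sum>k\<in>UNIV. v $ k * gap_point.Nmat \<gamma> K lam (- z) \<delta> j k)"
      by (intro continuous_intros N)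
    then show ?thesis by (rule continuous_on_cong[THEN iffD1, OF refl, rotated]) (simp add: gap_point.yv_def[OF G])
  qed
  have "continuous_on {a..b} (\<lambda>z. \<gamma> * (\<Sum>j\<in>UNIV. sg j * gap_point.yv \<gamma> K lam (- z) \<delta> \<beta> j * gap_point.yv \<gamma> K lam (- z) \<delta> \<beta>' j)
      - (\<Sum>j\<in>UNIV. \<beta> $ j * gap_point.yv \<gamma> K lam (- z) \<delta> \<beta>' j))"
    by (intro continuous_intros Y)
  then show ?thesis by (rule continuous_on_cong[THEN iffD1, OF refl, rotated]) (simp add: gap_point.Bf_def[OF G])
qed

lemma eigenvalue_count_supercritical:
  fixes T :: "real \<Rightarrow> real" and n :: nat and w :: "nat \<Rightarrow> real^3 \<Rightarrow> real"
  assumes g: "0 < \<gamma>" and c0: "0 < c0" and T: "filterlim T at_top at_top"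
    and w: "\<And>i. i < n \<Longrightarrow> w i \<in> L2R" "\<And>i. i < n \<Longrightarrow> (\<integral>q. w i q \<partial>tm) = 0"
    and pos: "\<And>c. \<exists>i<n. c i \<noteq> 0 \<Longrightarrow>
       (\<integral>q. (6 - dispersion q + c0) * (\<Sum>i<n. c i * w i q)\<^sup>2 \<partial>tm) < \<gamma> * Vform K (\<lambda>q. \<Sum>i<n. c i * w i q)"
  shows "\<exists>L>0. \<forall>lam>L. enat n \<le> H_eigenvalue_count \<gamma> lam K {tau_max \<gamma> K lam..tau_max \<gamma> K lam + T lam}"
proof -
  have g0: "0 \<le> \<gamma>" using g by simp
  define m where "m = emax \<gamma>"
  have m0: "m > 0" using g by (simp add: m_def)
  define c1 where "c1 = c0 / 2"
  define B where "B = c1 + 48 * \<gamma> + 48"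
  define \<delta> where "\<delta> = c1 / 8"
  have c1: "0 < c1" "c1 < B" and B: "3 * \<gamma> < (B / 8) / 2" using c0 g by (auto simp: c1_def B_def)
  have d0: "0 < \<delta>" "\<delta> \<le> B / 8" using c1 by (auto simp: \<delta>_def)
  have e1: "eventually (\<lambda>lam. 4 * m \<le> lam) at_top" by (rule eventually_ge_at_top)
  have e2: "eventually (\<lambda>lam. 4 * B \<le> lam) at_top" by (rule eventually_ge_at_top)
  have e3: "eventually (\<lambda>lam. 4 * m\<^sup>2 / lam \<le> min (\<delta> / 2) (c1 / 2)) at_top"
    using d0 c1 by (intro eventually_divide_le) auto
  have e4: "eventually (\<lambda>lam. B \<le> T lam) at_top" using T unfolding filterlim_at_top by blast
  have "eventually (\<lambda>lam. 4 * m \<le> lam \<and> 4 * B \<le> lam \<and> 4 * m\<^sup>2 / lam \<le> min (\<delta> / 2) (c1 / 2) \<and> B \<le> T lam) at_top"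
    using e1 e2 e3 e4 by eventually_elim blast
  then obtain L where L: "\<And>lam. L \<le> lam \<Longrightarrow> 4 * m \<le> lam \<and> 4 * B \<le> lam \<and> 4 * m\<^sup>2 / lam \<le> min (\<delta> / 2) (c1 / 2) \<and> B \<le> T lam"
    unfolding eventually_at_top_linorder by blast
  show ?thesis
  proof (intro exI[of _ "max L 1"] conjI allI impI)
    fix lam assume "lam > max L 1"
    then have "L \<le> lam" by simp
    from L[OF this] have l: "4 * m \<le> lam" "4 * B \<le> lam" "4 * m\<^sup>2 / lam \<le> \<delta> / 2" "4 * m\<^sup>2 / lam \<le> c1 / 2" "B \<le> T lam" by auto
    have lam0: "lam > 0" using l(1) m0 by linarith
    have lm: "emax \<gamma> < lam" using l(1) m0 by (simp add: m_def)
    define t where "t = - tau_max \<gamma> K lam"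
    have t: "lam - m \<le> t" "t \<le> lam"
      using tau_max_threshold(1,2)[OF g0 lm] by (auto simp: t_def m_def)
    have Dt: "0 \<le> Dsym \<gamma> K lam t q" for q using tau_max_threshold(3)[OF g0 lm] by (simp add: t_def)
    have t0: "t > 0" using t l(1) m0 by linarith
    have msmall: "m\<^sup>2 / \<zeta> \<le> 4 * m\<^sup>2 / lam" if "lam / 4 \<le> \<zeta>" for \<zeta>
    proof -
      have "m\<^sup>2 / \<zeta> \<le> m\<^sup>2 / (lam / 4)" using that lam0 by (intro divide_left_mono) auto
      then show ?thesis by (simp add: mult.commute)
    qed
    have z_ge: "lam / 2 \<le> \<zeta>" if "t - B \<le> \<zeta>" for \<zeta> using that t(1) l(1,2) by linarith
    have D_ge: "(t - \<zeta>) / 8 \<le> Dsym \<gamma> K lam \<zeta> q" if "t - B \<le> \<zeta>" "\<zeta> \<le> t" for \<zeta> q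
    proof -
      have z2: "lam / 2 \<le> \<zeta>" by (rule z_ge[OF that(1)])
      then have z0: "0 < \<zeta>" using lam0 by linarith
      have "(m + \<zeta>) * (m + t) \<le> (2 * \<zeta>) * (4 * \<zeta>)"
        using z2 t l(1) m0 by (intro mult_mono) linarith+
      then have "(t - \<zeta>) * ((m + \<zeta>) * (m + t)) \<le> (t - \<zeta>) * (8 * \<zeta>\<^sup>2)"
        using that by (intro mult_left_mono) (auto simp: power2_eq_square)
      moreover have "0 < (m + \<zeta>) * (m + t)" using z0 t0 m0 by (intro mult_pos_pos) auto
      ultimately have "(t - \<zeta>) / 8 \<le> (t - \<zeta>) * \<zeta>\<^sup>2 / ((m + \<zeta>) * (m + t))" by (simp add: field_simps)
      moreover have "0 \<le> (\<zeta> / t)\<^sup>2 * Dsym \<gamma> K lam t q" using Dt by simp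
      ultimately show ?thesis using Dsym_shift(1)[OF g0 z0 that(2), of K lam q] unfolding m_def by linarith
    qed
    have gp: "gap_point \<gamma> K lam \<zeta> \<delta>'" if z: "t - B \<le> \<zeta>" "\<zeta> \<le> t" and d: "\<delta> \<le> \<delta>'" "\<delta>' \<le> (t - \<zeta>) / 8" for \<zeta> \<delta>'
    proof
      have "lam / 2 \<le> \<zeta>" by (rule z_ge[OF z(1)])
      then have z4: "lam / 4 \<le> \<zeta>" using lam0 by linarith
      then show "0 < \<zeta>" using lam0 by linarith
      show "\<delta>' \<le> Dsym \<gamma> K lam \<zeta> q" for q using D_ge[OF z, of q] d by linarith
      show "(emax \<gamma>)\<^sup>2 / \<zeta> \<le> \<delta>' / 2" using msmall[OF z4] l(3) d unfolding m_def by linarith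
    qed (use g lam0 d0 d in auto)
    define a b where "a = - (t - c1)" and "b = - (t - B)"
    have ab: "a \<le> b" using c1 by (simp add: a_def b_def)
    have G: "gap_point \<gamma> K lam (- z) \<delta>" if "z \<in> {a..b}" for z
      by (rule gp) (use that c1 in \<open>auto simp: a_def b_def \<delta>_def\<close>)
    have Ga: "gap_point \<gamma> K lam (t - c1) \<delta>" using G[of a] ab by (simp add: a_def)
    interpret A: gap_point \<gamma> K lam "t - c1" \<delta> by (rule Ga)
    have Gb: "gap_point \<gamma> K lam (t - B) \<delta>" using G[of b] ab by (simp add: b_def)
    have Gb': "gap_point \<gamma> K lam (t - B) (B / 8)" by (rule gp) (use d0 c1 in auto)
    let ?Bf = "\<lambda>z. gap_point.Bf \<gamma> K lam (- z) \<delta>"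
    have bil: "bilinear (?Bf z)" if "z \<in> {a..b}" for z by (rule gap_point.bilinear_Bf[OF G[OF that]])
    have sym: "?Bf z x y = ?Bf z y x" if "z \<in> {a..b}" for z x y by (rule gap_point.Bf_sym[OF G[OF that]])
    have cont: "continuous_on {a..b} (\<lambda>z. ?Bf z x y)" for x y
    proof (rule Bf_continuous[OF G, of a b "lam / 2"])
      show "b \<le> - (lam / 2)" using z_ge[of "t - B"] by (simp add: b_def)
      show "- lam \<le> a" using t c1 by (simp add: a_def)
    qed (use lam0 in auto)
    have upper: "Dsym \<gamma> K lam (t - c1) q + m\<^sup>2 / (t - c1) \<le> 6 - dispersion q + c0" for q
    proof -
      obtain q0 where q0: "Dsym \<gamma> K lam t q0 = 0" using tau_max_threshold(4)[OF g0 lm] by (auto simp: t_def)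
      have zc: "lam / 2 \<le> t - c1" using z_ge[of "t - c1"] c1 by simp
      have zc0: "0 < t - c1" using zc lam0 by linarith
      have r: "m\<^sup>2 / (t - c1) \<le> c1 / 2" using msmall[of "t - c1"] zc lam0 l(4) by linarith
      have rt: "m\<^sup>2 / t \<le> c1 / 2" using msmall[of t] zc c1 lam0 l(4) by linarith
      have "Dsym \<gamma> K lam t q = Dsym \<gamma> K lam t q - Dsym \<gamma> K lam t q0" using q0 by simp
      also have "\<dots> \<le> 6 - dispersion q + m\<^sup>2 / t"
        unfolding Dsym_eq[OF g0 t0]
        using dispersion_le[of q0] integral_rem_nonneg[OF g0 t0, of K q0] integral_rem_le[OF g0 t0, of K q]
        unfolding m_def by linarith
      finally have D1: "Dsym \<gamma> K lam t q \<le> 6 - dispersion q + m\<^sup>2 / t" .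
      have "Dsym \<gamma> K lam (t - c1) q \<le> ((t - c1) / t)\<^sup>2 * Dsym \<gamma> K lam t q + (t - (t - c1))"
        by (rule Dsym_shift(2)[OF g0 zc0]) (use c1 in simp)
      also have "((t - c1) / t)\<^sup>2 * Dsym \<gamma> K lam t q \<le> 1 * Dsym \<gamma> K lam t q"
      proof (rule mult_right_mono[OF _ Dt])
        have "(t - c1) / t \<le> 1" "0 \<le> (t - c1) / t" using t0 c1 zc0 by auto
        then show "((t - c1) / t)\<^sup>2 \<le> 1" by (rule power_le_one[rotated])
      qed
      finally have "Dsym \<gamma> K lam (t - c1) q \<le> Dsym \<gamma> K lam t q + c1" by simp
      moreover have "c0 = 2 * c1" by (simp add: c1_def)
      ultimately show ?thesis using D1 r rt by linarith
    qed
    have "\<exists>\<beta>. \<forall>c. (\<exists>i<n. c i \<noteq> 0) \<longrightarrow> 0 < A.Bf (\<Sum>i<n. c i *\<^sub>R \<beta> i) (\<Sum>i<n. c i *\<^sub>R \<beta> i)"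
    proof (rule A.positive_subspace[OF w])
      fix c :: "nat \<Rightarrow> real" assume c: "\<exists>i<n. c i \<noteq> 0"
      define f where "f = (\<lambda>x. \<Sum>i<n. c i * w i x)"
      have f: "f \<in> L2R" unfolding f_def by (rule L2R_sum) (auto simp: w)
      have f1: "integrable tm f" and f2: "integrable tm (\<lambda>q. (f q)\<^sup>2)" using L2R_integrable[OF f] L2R_D[OF f] by auto
      have Rf: "- (\<integral>q. f q * A.R f q \<partial>tm) \<le> m\<^sup>2 / (t - c1) * (\<integral>q. (f q)\<^sup>2 \<partial>tm)"
      proof -
        have "- (\<integral>q. f q * A.R f q \<partial>tm) \<le> \<bar>\<integral>q. f q * A.R f q \<partial>tm\<bar>" by linarith
        also have "\<dots> \<le> (\<integral>q. \<bar>f q * A.R f q\<bar> \<partial>tm)" by (rule integral_abs_bound)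
        also have "\<dots> \<le> (\<integral>q. \<bar>f q\<bar> * (m\<^sup>2 / (t - c1) * (\<integral>p. \<bar>f p\<bar> \<partial>tm)) \<partial>tm)"
        proof (rule integral_mono)
          show "integrable tm (\<lambda>q. \<bar>f q * A.R f q\<bar>)" by (intro integrable_abs L2R_mult_integrable f A.R_L2R f1)
          show "\<bar>f q * A.R f q\<bar> \<le> \<bar>f q\<bar> * (m\<^sup>2 / (t - c1) * (\<integral>p. \<bar>f p\<bar> \<partial>tm))" for q
            unfolding abs_mult m_def by (intro mult_left_mono abs_Rop_le g0 A.zeta f1) simp
        qed (use f1 in auto)
        also have "\<dots> = m\<^sup>2 / (t - c1) * (\<integral>p. \<bar>f p\<bar> \<partial>tm)\<^sup>2" by (simp add: power2_eq_square)
        also have "\<dots> \<le> m\<^sup>2 / (t - c1) * (\<integral>q. (f q)\<^sup>2 \<partial>tm)"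
          using tm_square_integral[of "\<lambda>p. \<bar>f p\<bar>"] f1 f2 A.zeta by (intro mult_left_mono) auto
        finally show ?thesis .
      qed
      have i: "integrable tm (\<lambda>q. f q * (A.D q * f q))" by (intro L2R_mult_integrable f A.D_mult_L2R)
      have "A.Aform f f \<le> (\<integral>q. f q * (A.D q * f q) \<partial>tm) + m\<^sup>2 / (t - c1) * (\<integral>q. (f q)\<^sup>2 \<partial>tm)"
        unfolding A.Aform_split[OF f f] using Rf by linarith
      also have "\<dots> = (\<integral>q. f q * (A.D q * f q) + m\<^sup>2 / (t - c1) * (f q)\<^sup>2 \<partial>tm)"
        using i f2 by simp
      also have "\<dots> \<le> (\<integral>q. (6 - dispersion q + c0) * (f q)\<^sup>2 \<partial>tm)"
      proof (rule integral_mono)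
        show "integrable tm (\<lambda>q. f q * (A.D q * f q) + m\<^sup>2 / (t - c1) * (f q)\<^sup>2)" using i f2 by simp
        show "integrable tm (\<lambda>q. (6 - dispersion q + c0) * (f q)\<^sup>2)"
          using f2 integrable_dispersion_mult[OF f2] by (simp add: algebra_simps)
        fix q
        have "f q * (A.D q * f q) + m\<^sup>2 / (t - c1) * (f q)\<^sup>2 = (A.D q + m\<^sup>2 / (t - c1)) * (f q)\<^sup>2"
          by (simp add: power2_eq_square algebra_simps)
        also have "\<dots> \<le> (6 - dispersion q + c0) * (f q)\<^sup>2" using upper[of q] by (rule mult_right_mono) simp
        finally show "f q * (A.D q * f q) + m\<^sup>2 / (t - c1) * (f q)\<^sup>2 \<le> (6 - dispersion q + c0) * (f q)\<^sup>2" .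
      qed
      also have "\<dots> < \<gamma> * Vform K f" using pos[OF c] unfolding f_def .
      finally show "A.Aform (\<lambda>x. \<Sum>i<n. c i * w i x) (\<lambda>x. \<Sum>i<n. c i * w i x) < \<gamma> * Vform K (\<lambda>x. \<Sum>i<n. c i * w i x)"
        unfolding f_def .
    qed
    then obtain \<beta> where "\<And>c. \<exists>i<n. c i \<noteq> 0 \<Longrightarrow> 0 < A.Bf (\<Sum>i<n. c i *\<^sub>R \<beta> i) (\<Sum>i<n. c i *\<^sub>R \<beta> i)" by blast
    from positive_on_span[OF A.bilinear_Bf this] obtain S where S: "positive_on A.Bf S" "dim S = n" by blast
    have Sa: "positive_on (?Bf a) S" using S(1) by (simp add: a_def)
    have neg: "?Bf b x x < 0" if "x \<noteq> 0" for x
      using gap_point.Bf_negative[OF Gb Gb' B that] by (simp add: b_def)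
    obtain Z where Z: "finite Z" "Z \<subseteq> {a..b}" "n \<le> (\<Sum>z\<in>Z. dim (form_kernel (?Bf z)))"
      using kernel_dims_ge_index_drop[where B = ?Bf, OF ab bil sym cont Sa neg] S(2) by auto
    show "enat n \<le> H_eigenvalue_count \<gamma> lam K {tau_max \<gamma> K lam..tau_max \<gamma> K lam + T lam}"
    proof (rule eigenvalue_count_ge[OF Z(1) _ _ Z(3)])
      show "Z \<subseteq> {tau_max \<gamma> K lam..tau_max \<gamma> K lam + T lam}"
        using Z(2) c1 l(5) by (force simp: a_def b_def t_def)
      fix z assume "z \<in> Z"
      then have "z \<in> {a..b}" using Z(2) by auto
      from gap_point.multiplicity_ge_kernel_dim[OF G[OF this]]
      show "enat (dim (form_kernel (?Bf z))) \<le> multiplicity_ev torus_measure2 L2_antisym (H_op \<gamma> lam K) (complex_of_real z)" by simp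
    qed
  qed auto
qed

lemma eigenvalue_of_count_pos:
  assumes "enat 1 \<le> eigenvalue_count M S A I"
  shows "\<exists>z\<in>I. is_eigenvalue M S A (of_real z)"
proof -
  have "0 < eigenvalue_count M S A I" using assms by (auto simp: zero_enat_def elim: less_le_trans[rotated])
  then obtain Z where Z: "Z \<subseteq> I" "0 < (\<Sum>z\<in>Z. multiplicity_ev M S A (of_real z))"
    unfolding eigenvalue_count_def less_SUP_iff by blast
  then have "\<exists>z\<in>Z. multiplicity_ev M S A (of_real z) \<noteq> 0" by (metis less_irrefl sum.neutral)
  then obtain z where "z \<in> Z" "0 < multiplicity_ev M S A (of_real z)" by (auto simp: zero_less_iff_neq_zero)
  then show ?thesis using Z(1) multiplicity_pos_imp_eigenvalue by blast
qed

lemma eigenvalue_supercritical: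
  fixes T :: "real \<Rightarrow> real"
  assumes g: "g \<in> supercritical K" "g < \<gamma>" and T: "filterlim T at_top at_top"
  shows "\<exists>L>0. \<forall>lam>L. \<exists>z\<in>{tau_max \<gamma> K lam..tau_max \<gamma> K lam + T lam}. H_eigenvalue \<gamma> lam K z"
proof -
  obtain w where w: "w \<in> L2R" "(\<integral>v. w v \<partial>tm) = 0" and lt: "(\<integral>v. dispersion v * (w v)\<^sup>2 \<partial>tm) < g * Vform K w" and g0: "0 < g"
    using g by (auto simp: supercritical_def)
  define a :: "real^3" where "a = (\<chi> i. pi)"
  define W where "W = (\<lambda>v. w (wrap (v + a)))"
  have W: "W \<in> L2R" unfolding W_def by (rule L2R_wrap_shift[OF w(1)])
  have W2: "integrable tm (\<lambda>x. (W x)\<^sup>2)" by (rule L2R_D(2)[OF W])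
  have W0: "(\<integral>v. W v \<partial>tm) = 0" unfolding W_def using integral_wrap_shift[OF L2R_D(1)[OF w(1)], of a] w(2) by simp
  have "\<bar>Vform K w - Vform K W\<bar> \<le> 18 * 0 * (\<integral>v. \<bar>W v\<bar> \<partial>tm)\<^sup>2"
    by (rule Vform_shift[OF L2R_integrable[OF w(1)] W_def]) (simp add: a_def)
  then have V: "Vform K W = Vform K w" by simp
  define X where "X = (\<integral>v. dispersion v * (w v)\<^sup>2 \<partial>tm)"
  have X0: "0 \<le> X" unfolding X_def by (intro integral_nonneg_AE) (simp add: dispersion_nonneg)
  have "dispersion (q + a) = 6 - dispersion q" for q
    by (simp add: dispersion_def a_def sum_subtractf sum.distrib)
  then have "(\<integral>q. (6 - dispersion q) * (W q)\<^sup>2 \<partial>tm) = (\<integral>q. dispersion (wrap (q + a)) * (w (wrap (q + a)))\<^sup>2 \<partial>tm)"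
    by (simp add: W_def dispersion_wrap)
  also have "\<dots> = X" unfolding X_def
    by (rule integral_wrap_shift) (use integrable_dispersion_mult[OF L2R_D(2)[OF w(1)]] in auto)
  finally have XW: "(\<integral>q. (6 - dispersion q) * (W q)\<^sup>2 \<partial>tm) = X" .
  have "0 < g * Vform K w" using lt X0 unfolding X_def by linarith
  then have "0 < Vform K w" using g0 by (simp add: zero_less_mult_iff)
  then have "g * Vform K w \<le> \<gamma> * Vform K w" using g(2) by (intro mult_right_mono) auto
  then have gap: "X < \<gamma> * Vform K W" using lt unfolding X_def V by linarith
  define Y where "Y = (\<integral>q. (W q)\<^sup>2 \<partial>tm)"
  have Y0: "0 \<le> Y" unfolding Y_def by (rule integral_nonneg_AE) simp
  define c0 where "c0 = (\<gamma> * Vform K W - X) / (2 * (Y + 1))"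
  have c0: "0 < c0" using gap Y0 by (simp add: c0_def)
  have "c0 * Y \<le> c0 * (Y + 1)" using c0 by (intro mult_left_mono) auto
  also have "\<dots> = (\<gamma> * Vform K W - X) / 2"
  proof -
    have "d / (2 * y) * y = d / 2" if "y \<noteq> 0" for d y :: real using that by simp
    from this[of "Y + 1"] show ?thesis using Y0 by (simp add: c0_def del: distrib_left_numeral)
  qed
  finally have cY: "c0 * Y \<le> (\<gamma> * Vform K W - X) / 2" .
  have XY: "X + c0 * Y < \<gamma> * Vform K W"
  proof -
    have "x + y < v" if "y \<le> (v - x) / 2" "x < v" for x y v :: real using that by argo
    from this[OF cY gap] show ?thesis .
  qed
  have i6: "integrable tm (\<lambda>q. (6 - dispersion q) * (W q)\<^sup>2)"
    using W2 integrable_dispersion_mult[OF W2] by (simp add: left_diff_distrib)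
  have "\<exists>L>0. \<forall>lam>L. enat 1 \<le> H_eigenvalue_count \<gamma> lam K {tau_max \<gamma> K lam..tau_max \<gamma> K lam + T lam}"
  proof (rule eigenvalue_count_supercritical[where w = "\<lambda>_. W", OF _ c0 T W W0])
    show "0 < \<gamma>" using g0 g(2) by linarith
    fix c :: "nat \<Rightarrow> real" assume "\<exists>i<1. c i \<noteq> 0"
    then have c: "0 < (c 0)\<^sup>2" by auto
    have V0: "Vform K (\<lambda>q. c 0 * W q) = (c 0)\<^sup>2 * Vform K W"
    proof -
      have "coef K (\<lambda>q. c 0 * W q) j = c 0 * coef K W j" for j
        unfolding coef_def by (simp add: mult.left_commute[of _ "c 0"])
      then show ?thesis unfolding Vform_def by (simp add: power_mult_distrib sum_distrib_left mult_ac)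
    qed
    have "(\<integral>q. (6 - dispersion q + c0) * (c 0 * W q)\<^sup>2 \<partial>tm)
       = (\<integral>q. (c 0)\<^sup>2 * ((6 - dispersion q) * (W q)\<^sup>2 + c0 * (W q)\<^sup>2) \<partial>tm)"
      by (rule Bochner_Integration.integral_cong[OF refl]) (simp add: power_mult_distrib algebra_simps)
    also have "\<dots> = (c 0)\<^sup>2 * ((\<integral>q. (6 - dispersion q) * (W q)\<^sup>2 \<partial>tm) + (\<integral>q. c0 * (W q)\<^sup>2 \<partial>tm))"
      unfolding integral_mult_right_zero
      by (subst Bochner_Integration.integral_add[OF i6]) (use W2 in auto)
    also have "\<dots> = (c 0)\<^sup>2 * (X + c0 * Y)" unfolding XW by (simp add: Y_def)
    also have "\<dots> < (c 0)\<^sup>2 * (\<gamma> * Vform K W)" using XY c by (intro mult_strict_left_mono)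
    also have "\<dots> = \<gamma> * Vform K (\<lambda>q. c 0 * W q)" unfolding V0 by (rule mult.left_commute)
    finally have fin: "(\<integral>q. (6 - dispersion q + c0) * (c 0 * W q)\<^sup>2 \<partial>tm) < \<gamma> * Vform K (\<lambda>q. c 0 * W q)" .
    have e: "(\<Sum>i<1. c i * W q) = c 0 * W q" for q by simp
    show "(\<integral>q. (6 - dispersion q + c0) * (\<Sum>i<1. c i * W q)\<^sup>2 \<partial>tm) < \<gamma> * Vform K (\<lambda>q. \<Sum>i<1. c i * W q)"
      unfolding e by (rule fin)
  qed
  then show ?thesis using eigenvalue_of_count_pos by blast
qed

lemma three_eigenvalues:
  fixes T :: "real \<Rightarrow> real"
  assumes g: "13 < \<gamma>" and T: "filterlim T at_top at_top"
  shows "\<exists>L>0. \<forall>lam>L. 3 \<le> H_eigenvalue_count \<gamma> lam K {tau_max \<gamma> K lam..tau_max \<gamma> K lam + T lam}"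
proof -
  define idx :: "nat \<Rightarrow> 3" where "idx i = (if i = 0 then 1 else if i = 1 then 2 else 3)" for i
  have idx: "idx i = idx k \<longleftrightarrow> i = k" if "i < 3" "k < 3" for i k
    using that by (auto simp: idx_def)
  define w where "w i = phi K (Some (idx i, True))" for i
  have w: "w i \<in> L2R" "(\<integral>q. w i q \<partial>tm) = 0" for i unfolding w_def by (rule L2R_phi, rule phi_mean)
  have cw: "coef K (w i) j = (if j = (idx i, True) then 1 / 2 else 0)" for i j
    unfolding coef_def w_def phi_orthogonal by simp
  have "\<exists>L>0. \<forall>lam>L. enat 3 \<le> H_eigenvalue_count \<gamma> lam K {tau_max \<gamma> K lam..tau_max \<gamma> K lam + T lam}"
  proof (rule eigenvalue_count_supercritical[where w = w and ?c0.0 = "1 / 8", OF _ _ T w])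
    show "0 < \<gamma>" using g by simp
    fix c :: "nat \<Rightarrow> real" assume c: "\<exists>i<3. c i \<noteq> 0"
    define f where "f = (\<lambda>q. \<Sum>i<3. c i * w i q)"
    define s where "s = (\<Sum>i<3. (c i)\<^sup>2)"
    have s: "0 < s" unfolding s_def using c by (auto simp: less_le sum_nonneg sum_nonneg_eq_0_iff)
    have f: "f \<in> L2R" unfolding f_def by (rule L2R_sum) (auto simp: w)
    have f2: "integrable tm (\<lambda>q. (f q)\<^sup>2)" by (rule L2R_D(2)[OF f])
    have cf: "coef K f j = (\<Sum>i<3. c i * coef K (w i) j)" for j
      unfolding f_def by (rule coef_sum) (rule w)
    have cfi: "coef K f (idx i, True) = c i / 2" if "i < 3" for i
    proof -
      have "coef K f (idx i, True) = (\<Sum>k<3. if k = i then c i / 2 else 0)"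
        unfolding cf cw by (intro sum.cong) (auto simp: idx that)
      then show ?thesis using that by simp
    qed
    have cff: "coef K f (j, False) = 0" for j unfolding cf cw by simp
    have V: "Vform K f = s / 4"
    proof -
      have "Vform K f = (coef K f (1, True))\<^sup>2 + (coef K f (2, True))\<^sup>2 + (coef K f (3, True))\<^sup>2"
        unfolding Vform_def sum_3_bool sum_3 by (simp add: sg_def cff)
      also have "\<dots> = (c 0 / 2)\<^sup>2 + (c 1 / 2)\<^sup>2 + (c 2 / 2)\<^sup>2"
        using cfi[of 0, symmetric] cfi[of 1, symmetric] cfi[of 2, symmetric] by (simp add: idx_def)
      also have "\<dots> = s / 4" by (simp add: s_def numeral_3_eq_3 numeral_2_eq_2 power_divide)
      finally show ?thesis .
    qed
    have n: "(\<integral>q. (f q)\<^sup>2 \<partial>tm) = s / 2"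
    proof -
      have "(\<integral>q. (f q)\<^sup>2 \<partial>tm) = (\<integral>q. f q * (\<Sum>i<3. c i * w i q) \<partial>tm)"
        by (simp add: power2_eq_square f_def)
      also have "\<dots> = (\<Sum>i<3. c i * (\<integral>q. f q * w i q \<partial>tm))"
        by (intro integral_sum_scaled L2R_mult_integrable f w)
      also have "\<dots> = (\<Sum>i<3. c i * (c i / 2))"
      proof (intro sum.cong refl)
        fix i :: nat assume "i \<in> {..<3}"
        then have "(\<integral>q. f q * w i q \<partial>tm) = c i / 2" using cfi[of i] by (simp add: coef_def w_def mult.commute)
        then show "c i * (\<integral>q. f q * w i q \<partial>tm) = c i * (c i / 2)" by simp
      qed
      finally show ?thesis by (simp add: s_def power2_eq_square sum_divide_distrib)
    qed
    have "(\<integral>q. (6 - dispersion q + 1 / 8) * (f q)\<^sup>2 \<partial>tm) \<le> (\<integral>q. 49 / 8 * (f q)\<^sup>2 \<partial>tm)"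
    proof (rule integral_mono)
      show "integrable tm (\<lambda>q. (6 - dispersion q + 1 / 8) * (f q)\<^sup>2)"
        using f2 integrable_dispersion_mult[OF f2] by (simp add: algebra_simps)
      fix q show "(6 - dispersion q + 1 / 8) * (f q)\<^sup>2 \<le> 49 / 8 * (f q)\<^sup>2"
        using dispersion_nonneg[of q] by (intro mult_right_mono) auto
    qed (use f2 in auto)
    also have "\<dots> = 49 / 16 * s" using n by simp
    also have "\<dots> < \<gamma> * (s / 4)" using mult_strict_right_mono[OF g s] s by simp
    finally have "(\<integral>q. (6 - dispersion q + 1 / 8) * (f q)\<^sup>2 \<partial>tm) < \<gamma> * Vform K f" unfolding V .
    then show "(\<integral>q. (6 - dispersion q + 1 / 8) * (\<Sum>i<3. c i * w i q)\<^sup>2 \<partial>tm) < \<gamma> * Vform K (\<lambda>q. \<Sum>i<3. c i * w i q)"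
      unfolding f_def .
  qed auto
  then show ?thesis by (simp add: numeral_eq_enat)
qed

theorem theorem1p3:
  fixes K :: "real^3"
  assumes "K \<in> torus3"
  shows "\<exists>\<gamma>\<^sub>2>0. \<exists>\<gamma>\<^sub>2'>\<gamma>\<^sub>2. \<forall>T::real \<Rightarrow> real.
    strict_mono_on {0<..} T \<longrightarrow> filterlim (\<lambda>lam. lam / T lam) at_top at_top \<longrightarrow>
    (\<forall>\<gamma>. 0 < \<gamma> \<and> \<gamma> < \<gamma>\<^sub>2 \<longrightarrow>
       (\<exists>lam\<^sub>4>0. \<forall>lam>lam\<^sub>4.
          \<not> (\<exists>z\<in>{tau_max \<gamma> K lam..tau_max \<gamma> K lam + T lam}. H_eigenvalue \<gamma> lam K z))) \<and>
    (filterlim T at_top at_top \<longrightarrow>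
      (\<forall>\<gamma>>\<gamma>\<^sub>2. \<exists>lam\<^sub>5>0. \<forall>lam>lam\<^sub>5.
          \<exists>z\<in>{tau_max \<gamma> K lam..tau_max \<gamma> K lam + T lam}. H_eigenvalue \<gamma> lam K z) \<and>
      (\<forall>\<gamma>>\<gamma>\<^sub>2'. \<exists>lam\<^sub>6>0. \<forall>lam>lam\<^sub>6.
          H_eigenvalue_count \<gamma> lam K {tau_max \<gamma> K lam..tau_max \<gamma> K lam + T lam} \<ge> 3))"
proof -
  define g2 where "g2 = Inf (supercritical K)"
  obtain c where c: "c > 0" "\<And>g. g \<in> supercritical K \<Longrightarrow> c \<le> g" using supercritical_lower_bound by blast
  have ne: "supercritical K \<noteq> {}" using supercritical_nonempty by blast
  have bdd: "bdd_below (supercritical K)" by (rule bdd_belowI[of _ c]) (rule c(2))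
  have "c \<le> g2" unfolding g2_def by (rule cInf_greatest[OF ne c(2)])
  then have g2: "0 < g2" using c(1) by linarith
  show ?thesis
  proof (rule exI[of _ g2], rule conjI, rule g2, rule exI[of _ "g2 + 13"], intro conjI allI impI)
    fix T :: "real \<Rightarrow> real" and \<gamma>
    assume T: "filterlim (\<lambda>lam. lam / T lam) at_top at_top" and \<gamma>: "0 < \<gamma> \<and> \<gamma> < g2"
    have "(\<gamma> + g2) / 2 \<notin> supercritical K"
    proof
      assume "(\<gamma> + g2) / 2 \<in> supercritical K"
      then have "g2 \<le> (\<gamma> + g2) / 2" unfolding g2_def by (rule cInf_lower[OF _ bdd])
      then show False using \<gamma> by simp
    qed
    then show "\<exists>lam>0. \<forall>l>lam. \<not> (\<exists>z\<in>{tau_max \<gamma> K l..tau_max \<gamma> K l + T l}. H_eigenvalue \<gamma> l K z)"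
      using no_eigenvalue_subcritical[of \<gamma> "(\<gamma> + g2) / 2" K T] T \<gamma> by simp
  next
    fix T :: "real \<Rightarrow> real" and \<gamma>
    assume T: "filterlim T at_top at_top" and \<gamma>: "g2 < \<gamma>"
    then obtain g where "g \<in> supercritical K" "g < \<gamma>" unfolding g2_def cInf_less_iff[OF ne bdd] by blast
    from eigenvalue_supercritical[OF this T]
    show "\<exists>lam>0. \<forall>l>lam. \<exists>z\<in>{tau_max \<gamma> K l..tau_max \<gamma> K l + T l}. H_eigenvalue \<gamma> l K z" .
  next
    fix T :: "real \<Rightarrow> real" and \<gamma>
    assume T: "filterlim T at_top at_top" and \<gamma>: "g2 + 13 < \<gamma>"
    show "\<exists>lam>0. \<forall>l>lam. 3 \<le> H_eigenvalue_count \<gamma> l K {tau_max \<gamma> K l..tau_max \<gamma> K l + T l}"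
      using three_eigenvalues[OF _ T] \<gamma> g2 by simp
  qed simp
qed

end
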